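(* Let $f\in H^2(\partial\mathbb B)$, $f\not\equiv0$. Then $f$ has a factorization $f=\varphi*g$ where $\varphi$ is inner and $g\in H^2(\partial\mathbb B)$ is outer. Moreover, this factorization is unique up to a unitary constant in the following sense: if $f=\varphi*g=\varphi_1*g_1$ with $\varphi,\varphi_1$ inner and $g,g_1$ outer, then $\varphi_1=\varphi*\lambda$ and $g_1=\overline\lambda*g$ for some $\lambda\in\mathbb H$ with $|\lambda|=1$.
   Context: $\mathbb H$ is the skew field of quaternions, $\mathbb B=\{q\in\mathbb H:|q|<1\}$, $\mathbb S=\{q\in\mathbb H: q^2=-1\}$, and $\partial\mathbb B=\{e^{tI}: t\in\mathbb R, I\in\mathbb S\}$, where $e^{tI}=\cos t+I\sin t$. It carries the measure $d\Sigma(e^{tI})=d\sigma(I)\,dt$, with $dt$ Lebesgue measure and $\sigma$ the area measure on $\mathbb S$, normalized so that $\sigma(\mathbb S)=\Sigma(\partial\mathbb B)=1$. $H^2(\partial\mathbb B)$ is the space of functions on $\partial\mathbb B$ (identified when equal $\Sigma$-a.e.) of the form $f(q)=\sum_{n\ge0}q^na_n$ ($\Sigma$-a.e.) with $\{a_n\}\in\ell^2(\mathbb N,\mathbb H)$; such $f$ is the boundary value of the slice regular function $\sum_{n\ge0}q^na_n$ on $\mathbb B$, also denoted $f$, so that $f(q)$ makes sense for $|q|<1$. A function $f:\mathbb B\to\mathbb H$ is slice regular if for each $I\in\mathbb S$ its restriction to $\mathbb B\cap(\mathbb R+\mathbb RI)$ has continuous partial derivatives and satisfies $\frac12\left(\frac{\partial}{\partial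 x}+I\frac{\partial}{\partial y}\right)f(x+yI)=0$; equivalently, $f(q)=\sum_{n\ge0}q^na_n$ on $\mathbb B$. $H^\infty(\partial\mathbb B)$ is the space of boundary values on $\partial\mathbb B$ of bounded slice regular functions on $\mathbb B$; the slice regular extension to $\mathbb B$ is denoted by the same symbol. A function $\varphi\in H^\infty(\partial\mathbb B)$ is inner if $|\varphi(q)|\le1$ for $q\in\mathbb B$ and $|\varphi(q)|=1$ for $\Sigma$-a.e. $q\in\partial\mathbb B$. A function $g\in H^2(\partial\mathbb B)$ is outer if for every $f\in H^2(\partial\mathbb B)$ such that $|g(q)|=|f(q)|$ for $\Sigma$-a.e. $q\in\partial\mathbb B$ one has $|g(q)|\ge|f(q)|$ for every $q\in\mathbb B$. For $f(q)=\sum_n q^na_n$ and $g(q)=\sum_n q^nb_n$ the $*$-product is $f*g(q)=\sum_{n}q^n\sum_{k}a_kb_{n-k}$; quaternions are regarded as constant functions. *)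

theory Defs
  imports "HOL-Probability.Probability"
begin

section \<open>The skew field of quaternions\<close>

datatype quat = Quat (qRe: real) (qI: real) (qJ: real) (qK: real)

lemma quat_eq_iff: "p = q \<longleftrightarrow> qRe p = qRe q \<and> qI p = qI q \<and> qJ p = qJ q \<and> qK p = qK q"
  by (auto intro: quat.expand)

lemma quat_eqI: "qRe p = qRe q \<Longrightarrow> qI p = qI q \<Longrightarrow> qJ p = qJ q \<Longrightarrow> qK p = qK q \<Longrightarrow> p = q"
  by (simp add: quat_eq_iff)

definition qcnj :: "quat \<Rightarrow> quat" where
  "qcnj q = Quat (qRe q) (- qI q) (- qJ q) (- qK q)"

instantiation quat :: ab_group_add
begin
definition "0 = Quat 0 0 0 0"
definition "p + q = Quat (qRe p + qRe q) (qI p + qI q) (qJ p + qJ q) (qK p + qK q)"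
definition "p - q = Quat (qRe p - qRe q) (qI p - qI q) (qJ p - qJ q) (qK p - qK q)"
definition "- q = Quat (- qRe q) (- qI q) (- qJ q) (- qK q)"
instance
  by standard (simp_all add: zero_quat_def plus_quat_def minus_quat_def uminus_quat_def)
end

instantiation quat :: real_vector
begin
definition "r *\<^sub>R q = Quat (r * qRe q) (r * qI q) (r * qJ q) (r * qK q)"
instance
  by standard (simp_all add: plus_quat_def scaleR_quat_def algebra_simps)
end

instantiation quat :: ring_1
begin
definition "1 = Quat 1 0 0 0"
definition "p * q = Quat
  (qRe p * qRe q - qI p * qI q - qJ p * qJ q - qK p * qK q)
  (qRe p * qI q + qI p * qRe q + qJ p * qK q - qK p * qJ q)
  (qRe p * qJ q - qI p * qK q + qJ p * qRe q + qK p * qI q)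
  (qRe p * qK q + qI p * qJ q - qJ p * qI q + qK p * qRe q)"
instance
  by standard (simp_all add: zero_quat_def one_quat_def plus_quat_def times_quat_def algebra_simps)
end

lemma quat_sel [simp]:
  "qRe 0 = 0" "qI 0 = 0" "qJ 0 = 0" "qK 0 = 0"
  "qRe 1 = 1" "qI 1 = 0" "qJ 1 = 0" "qK 1 = 0"
  "qRe (p + q) = qRe p + qRe q" "qI (p + q) = qI p + qI q"
  "qJ (p + q) = qJ p + qJ q" "qK (p + q) = qK p + qK q"
  "qRe (p - q) = qRe p - qRe q" "qI (p - q) = qI p - qI q"
  "qJ (p - q) = qJ p - qJ q" "qK (p - q) = qK p - qK q"
  "qRe (- p) = - qRe p" "qI (- p) = - qI p" "qJ (- p) = - qJ p" "qK (- p) = - qK p"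
  "qRe (r *\<^sub>R p) = r * qRe p" "qI (r *\<^sub>R p) = r * qI p"
  "qJ (r *\<^sub>R p) = r * qJ p" "qK (r *\<^sub>R p) = r * qK p"
  "qRe (qcnj p) = qRe p" "qI (qcnj p) = - qI p" "qJ (qcnj p) = - qJ p" "qK (qcnj p) = - qK p"
  by (simp_all add: zero_quat_def one_quat_def plus_quat_def minus_quat_def uminus_quat_def
      scaleR_quat_def qcnj_def)

lemma quat_mult_sel:
  "qRe (p * q) = qRe p * qRe q - qI p * qI q - qJ p * qJ q - qK p * qK q"
  "qI (p * q) = qRe p * qI q + qI p * qRe q + qJ p * qK q - qK p * qJ q"
  "qJ (p * q) = qRe p * qJ q - qI p * qK q + qJ p * qRe q + qK p * qI q"
  "qK (p * q) = qRe p * qK q + qI p * qJ q - qJ p * qI q + qK p * qRe q"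
  by (simp_all add: times_quat_def)

instance quat :: real_algebra_1
  by standard (simp_all add: quat_eq_iff quat_mult_sel algebra_simps)

lemma quat_of_real_sel [simp]:
  "qRe (of_real r) = r" "qI (of_real r) = 0" "qJ (of_real r) = 0" "qK (of_real r) = 0"
  by (simp_all add: of_real_def)

instantiation quat :: real_inner
begin
definition "p \<bullet> q = qRe p * qRe q + qI p * qI q + qJ p * qJ q + qK p * qK q"
definition "norm q = sqrt ((qRe q)\<^sup>2 + (qI q)\<^sup>2 + (qJ q)\<^sup>2 + (qK q)\<^sup>2)"
definition "sgn q = q /\<^sub>R norm q" for q :: quat
definition "dist p q = norm (p - q)" for p q :: quat
definition "(uniformity :: (quat \<times> quat) filter) = (INF e\<in>{0 <..}. principal {(x, y). dist x y < e})"
definition "open U \<longleftrightarrow> (\<forall>x\<in>U. eventually (\<lambda>(x', y). x' = x \<longrightarrow> y \<in> U) uniformity)"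
  for U :: "quat set"
instance
proof
  fix x y z :: quat and r :: real and U :: "quat set"
  show "sgn x = x /\<^sub>R norm x" by (rule sgn_quat_def)
  show "dist x y = norm (x - y)" by (rule dist_quat_def)
  show "(uniformity :: (quat \<times> quat) filter) = (INF e\<in>{0 <..}. principal {(x, y). dist x y < e})"
    by (rule uniformity_quat_def)
  show "open U \<longleftrightarrow> (\<forall>x\<in>U. eventually (\<lambda>(x', y). x' = x \<longrightarrow> y \<in> U) uniformity)"
    by (rule open_quat_def)
  show "x \<bullet> y = y \<bullet> x" by (simp add: inner_quat_def mult.commute)
  show "(x + y) \<bullet> z = x \<bullet> z + y \<bullet> z" by (simp add: inner_quat_def algebra_simps)
  show "(r *\<^sub>R x) \<bullet> y = r * (x \<bullet> y)" by (simp add: inner_quat_def algebra_simps)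
  show "0 \<le> x \<bullet> x" by (simp add: inner_quat_def)
  show "(x \<bullet> x = 0) = (x = 0)"
    by (simp add: inner_quat_def quat_eq_iff add_nonneg_eq_0_iff)
  show "norm x = sqrt (x \<bullet> x)"
    by (simp add: inner_quat_def norm_quat_def power2_eq_square)
qed
end

instantiation quat :: euclidean_space
begin
definition "Basis = {Quat 1 0 0 0, Quat 0 1 0 0, Quat 0 0 1 0, Quat 0 0 0 1}"
instance
proof
  fix x u v :: quat
  show "(Basis :: quat set) \<noteq> {}" "finite (Basis :: quat set)" by (simp_all add: Basis_quat_def)
  show "u \<in> Basis \<Longrightarrow> v \<in> Basis \<Longrightarrow> u \<bullet> v = (if u = v then 1 else 0)"
    unfolding Basis_quat_def inner_quat_def by (elim insertE emptyE) simp_all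
  show "(\<forall>u\<in>Basis. x \<bullet> u = 0) \<longleftrightarrow> x = 0"
    unfolding Basis_quat_def inner_quat_def by (cases x) (simp add: zero_quat_def)
qed
end

instantiation quat :: real_normed_div_algebra
begin
definition "inverse q = qcnj q /\<^sub>R (norm q)\<^sup>2"
definition "p div q = p * inverse q" for p q :: quat
instance
proof
  fix p q :: quat
  have sq: "(norm q)\<^sup>2 = (qRe q)\<^sup>2 + (qI q)\<^sup>2 + (qJ q)\<^sup>2 + (qK q)\<^sup>2" for q :: quat
    by (simp add: norm_quat_def)
  have nz: "(norm q)\<^sup>2 \<noteq> 0" if "q \<noteq> 0" for q :: quat using that by simp
  have 1: "q * qcnj q = of_real ((norm q)\<^sup>2)" "qcnj q * q = of_real ((norm q)\<^sup>2)" for q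
    unfolding sq by (simp_all add: quat_eq_iff quat_mult_sel power2_eq_square)
  show "q \<noteq> 0 \<Longrightarrow> inverse q * q = 1" "q \<noteq> 0 \<Longrightarrow> q * inverse q = 1"
    using nz[of q] by (simp_all add: inverse_quat_def 1 of_real_def del: of_real_power)
  show "inverse (0::quat) = 0" by (simp add: inverse_quat_def quat_eq_iff)
  show "p div q = p * inverse q" by (rule divide_quat_def)
  have "(norm (p * q))\<^sup>2 = (norm p * norm q)\<^sup>2"
    unfolding power_mult_distrib sq quat_mult_sel by algebra
  then show "norm (p * q) = norm p * norm q"
    by (simp add: power2_eq_iff_nonneg)
qed
end

section \<open>The boundary of the unit ball and its measure\<close>

definition imag_units :: "quat set" where
  "imag_units = {q. q\<^sup>2 = - 1}"

definition qexp :: "real \<Rightarrow> quat \<Rightarrow> quat" where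
  "qexp t I = of_real (cos t) + I * of_real (sin t)"

definition qboundary :: "quat set" where
  "qboundary = {qexp t I | t I. I \<in> imag_units}"

text \<open>Spherical coordinates on the 2-sphere of imaginary units; the area element is
  \<open>sin \<theta> d\<theta> d\<phi>\<close> and the total area is \<open>4 pi\<close>.\<close>

definition spherical :: "real \<times> real \<Rightarrow> quat" where
  "spherical = (\<lambda>(\<theta>, \<phi>). Quat 0 (sin \<theta> * cos \<phi>) (sin \<theta> * sin \<phi>) (cos \<theta>))"

definition sphere_area :: "quat measure" where
  "sphere_area =
     distr (density (lborel \<Otimes>\<^sub>M lborel)
              (\<lambda>(\<theta>, \<phi>). ennreal (indicator ({0..pi} \<times> {0..2 * pi}) (\<theta>, \<phi>) * (sin \<theta> / (4 * pi)))))
       (restrict_space borel imag_units) spherical"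

text \<open>With \<open>t\<close> ranging over a full period, every non-real point of the boundary is represented
  twice (\<open>(t, I)\<close> and \<open>(-t, -I)\<close>); this only affects the normalizing constant.\<close>

definition boundary_measure :: "quat measure" where
  "boundary_measure =
     distr (uniform_measure lborel {0..2 * pi} \<Otimes>\<^sub>M sphere_area)
       (restrict_space borel qboundary) (\<lambda>(t, I). qexp t I)"

abbreviation eq_ae :: "(quat \<Rightarrow> quat) \<Rightarrow> (quat \<Rightarrow> quat) \<Rightarrow> bool" (infix "\<doteq>" 50) where
  "f \<doteq> g \<equiv> (AE q in boundary_measure. f q = g q)"

lemma imag_units_iff: "q \<in> imag_units \<longleftrightarrow> qRe q = 0 \<and> (qI q)\<^sup>2 + (qJ q)\<^sup>2 + (qK q)\<^sup>2 = 1"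
proof -
  have "q * q = -1 \<longleftrightarrow> qRe q = 0 \<and> (qI q)\<^sup>2 + (qJ q)\<^sup>2 + (qK q)\<^sup>2 = 1"
  proof
    assume "q * q = -1"
    then have a: "qRe q * qRe q - qI q * qI q - qJ q * qJ q - qK q * qK q = -1"
      "qRe q * qI q = 0" "qRe q * qJ q = 0" "qRe q * qK q = 0"
      by (auto simp: quat_eq_iff quat_mult_sel)
    show "qRe q = 0 \<and> (qI q)\<^sup>2 + (qJ q)\<^sup>2 + (qK q)\<^sup>2 = 1"
    proof (cases "qRe q = 0")
      case False
      then have "qRe q * qRe q = -1" using a by auto
      then show ?thesis using zero_le_square[of "qRe q"] by linarith
    qed (use a in \<open>auto simp: power2_eq_square\<close>)
  qed (auto simp: quat_eq_iff quat_mult_sel power2_eq_square)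
  then show ?thesis by (simp add: imag_units_def power2_eq_square)
qed

lemma spherical_in: "spherical x \<in> imag_units"
proof -
  obtain a b where x: "x = (a, b)" by fastforce
  have "(sin a * cos b)\<^sup>2 + (sin a * sin b)\<^sup>2 + (cos a)\<^sup>2
      = (sin a)\<^sup>2 * ((sin b)\<^sup>2 + (cos b)\<^sup>2) + (cos a)\<^sup>2"
    unfolding power_mult_distrib by (simp add: algebra_simps del: sin_cos_squared_add sin_cos_squared_add2)
  then show ?thesis by (simp add: x imag_units_iff spherical_def)
qed

lemma borel_measurable_spherical: "spherical \<in> borel_measurable borel"
proof (rule borel_measurable_continuous_onI)
  have eq: "spherical = (\<lambda>x. (sin (fst x) * cos (snd x)) *\<^sub>R Quat 0 1 0 0
      + (sin (fst x) * sin (snd x)) *\<^sub>R Quat 0 0 1 0 + cos (fst x) *\<^sub>R Quat 0 0 0 1)"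
    by (auto simp: spherical_def fun_eq_iff quat_eq_iff)
  show "continuous_on UNIV spherical"
    unfolding eq by (intro continuous_intros)
qed

lemma measurable_spherical:
  "spherical \<in> density (lborel \<Otimes>\<^sub>M lborel) h \<rightarrow>\<^sub>M restrict_space borel imag_units"
proof (rule measurable_restrict_space2)
  have "sets (density (lborel \<Otimes>\<^sub>M lborel) h) = sets (borel :: (real \<times> real) measure)"
    unfolding sets_density lborel_prod by simp
  then show "spherical \<in> density (lborel \<Otimes>\<^sub>M lborel) h \<rightarrow>\<^sub>M borel"
    using borel_measurable_spherical measurable_cong_sets[OF _ refl] by blast
qed (use spherical_in in blast)

lemma prob_space_sphere_area: "prob_space sphere_area"
  unfolding sphere_area_def
proof (rule prob_space.prob_space_distr[OF _ measurable_spherical], rule prob_spaceI)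
  let ?h = "\<lambda>(\<theta>, \<phi>). ennreal (indicator ({0..pi} \<times> {0..2 * pi}) (\<theta>, \<phi>) * (sin \<theta> / (4 * pi)))"
  have m: "?h \<in> borel_measurable (lborel \<Otimes>\<^sub>M lborel)"
    unfolding case_prod_beta by measurable
  have h: "?h (a, b) = ennreal (sin a / (4 * pi)) * indicator {0..pi} a * indicator {0..2 * pi} b" for a b
    by (auto simp: indicator_def)
  have "(\<integral>\<^sup>+ x. ?h x \<partial>(lborel \<Otimes>\<^sub>M lborel)) = (\<integral>\<^sup>+ a. \<integral>\<^sup>+ b. ?h (a, b) \<partial>lborel \<partial>lborel)"
    using m by (rule lborel.nn_integral_fst[symmetric])
  also have "\<dots> = (\<integral>\<^sup>+ a. ennreal (sin a / 2) * indicator {0..pi} a \<partial>lborel)"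
  proof (intro nn_integral_cong)
    fix a :: real
    have "(\<integral>\<^sup>+ b. ?h (a, b) \<partial>lborel) = ennreal (sin a / (4 * pi)) * indicator {0..pi} a * ennreal (2 * pi)"
      unfolding h by (subst nn_integral_cmult_indicator) auto
    also have "\<dots> = ennreal (sin a / 2) * indicator {0..pi} a"
      by (auto simp: indicator_def sin_ge_zero simp flip: ennreal_mult)
    finally show "(\<integral>\<^sup>+ b. ?h (a, b) \<partial>lborel) = ennreal (sin a / 2) * indicator {0..pi} a" .
  qed
  also have "\<dots> = ennreal (- cos pi / 2 - - cos 0 / 2)"
  proof (rule nn_integral_FTC_Icc)
    show "((\<lambda>x. - cos x / 2) has_real_derivative sin x / 2) (at x)" for x
      by (auto intro!: derivative_eq_intros)
  qed (auto simp: sin_ge_zero)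
  finally have "(\<integral>\<^sup>+ x. ?h x \<partial>(lborel \<Otimes>\<^sub>M lborel)) = 1" by simp
  moreover have "emeasure (density (lborel \<Otimes>\<^sub>M lborel) ?h) (space (lborel \<Otimes>\<^sub>M lborel))
      = (\<integral>\<^sup>+ x. ?h x * indicator (space (lborel \<Otimes>\<^sub>M lborel)) x \<partial>(lborel \<Otimes>\<^sub>M lborel))"
    using m sets.top by (rule emeasure_density)
  moreover have "\<dots> = (\<integral>\<^sup>+ x. ?h x \<partial>(lborel \<Otimes>\<^sub>M lborel))"
    by (rule nn_integral_cong, subst indicator_simps(1), assumption, rule mult_1_right)
  ultimately show "emeasure (density (lborel \<Otimes>\<^sub>M lborel) ?h) (space (density (lborel \<Otimes>\<^sub>M lborel) ?h)) = 1"
    unfolding space_density by metis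
qed

lemma measurable_qexp:
  "(\<lambda>(t, I). qexp t I) \<in> uniform_measure lborel {0..2 * pi} \<Otimes>\<^sub>M sphere_area \<rightarrow>\<^sub>M restrict_space borel qboundary"
proof (rule measurable_restrict_space2)
  have "continuous_on UNIV (\<lambda>(t, I). qexp t I)"
    unfolding case_prod_beta qexp_def by (intro continuous_intros)
  then have m: "(\<lambda>(t, I). qexp t I) \<in> borel \<Otimes>\<^sub>M borel \<rightarrow>\<^sub>M borel"
    unfolding borel_prod by (rule borel_measurable_continuous_onI)
  have *: "(\<lambda>x. qexp (fst x) (snd x)) \<in> M \<rightarrow>\<^sub>M borel"
    if "(\<lambda>x. (fst x, snd x)) \<in> M \<rightarrow>\<^sub>M borel \<Otimes>\<^sub>M borel" for M
    using measurable_compose[OF that m] by (simp only: prod.case)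
  have "(\<lambda>(t, I). (t, I)) \<in> uniform_measure lborel {0..2 * pi} \<Otimes>\<^sub>M sphere_area \<rightarrow>\<^sub>M borel \<Otimes>\<^sub>M borel"
    unfolding case_prod_beta
  proof (rule measurable_Pair)
    show "fst \<in> uniform_measure lborel {0..2 * pi} \<Otimes>\<^sub>M sphere_area \<rightarrow>\<^sub>M borel"
      using measurable_fst[of "uniform_measure lborel {0..2 * pi}" sphere_area]
      by (simp cong: measurable_cong_sets)
    have "snd \<in> uniform_measure lborel {0..2 * pi} \<Otimes>\<^sub>M sphere_area \<rightarrow>\<^sub>M restrict_space borel imag_units"
      using measurable_snd[of "uniform_measure lborel {0..2 * pi}" sphere_area]
      by (simp add: sphere_area_def cong: measurable_cong_sets)
    then show "snd \<in> uniform_measure lborel {0..2 * pi} \<Otimes>\<^sub>M sphere_area \<rightarrow>\<^sub>M borel"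
      by (simp add: measurable_restrict_space2_iff)
  qed
  then show "(\<lambda>(t, I). qexp t I) \<in> uniform_measure lborel {0..2 * pi} \<Otimes>\<^sub>M sphere_area \<rightarrow>\<^sub>M borel"
    unfolding case_prod_beta by (rule *)
  have "space sphere_area = imag_units" by (simp add: sphere_area_def space_restrict_space)
  then show "(\<lambda>(t, I). qexp t I) \<in> space (uniform_measure lborel {0..2 * pi} \<Otimes>\<^sub>M sphere_area) \<rightarrow> qboundary"
    by (auto simp: space_pair_measure qboundary_def)
qed

lemma prob_space_boundary_measure: "prob_space boundary_measure"
proof -
  interpret S: prob_space sphere_area by (rule prob_space_sphere_area)
  interpret T: prob_space "uniform_measure lborel {0..2 * pi}"
    by (rule prob_space_uniform_measure) auto
  interpret P: pair_prob_space "uniform_measure lborel {0..2 * pi}" sphere_area ..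
  show ?thesis
    unfolding boundary_measure_def by (rule P.prob_space_distr[OF measurable_qexp])
qed

section \<open>Slice regular functions and Hardy spaces\<close>

definition slice_regular :: "(quat \<Rightarrow> quat) \<Rightarrow> bool" where
  "slice_regular F \<longleftrightarrow>
     (\<forall>I\<in>imag_units. \<exists>Fx Fy.
        continuous_on (ball 0 1) Fx \<and> continuous_on (ball 0 1) Fy \<and>
        (\<forall>(x, y) \<in> ball (0 :: real \<times> real) 1.
           ((\<lambda>s. F (of_real s + of_real y * I)) has_vector_derivative Fx (x, y)) (at x) \<and>
           ((\<lambda>s. F (of_real x + of_real s * I)) has_vector_derivative Fy (x, y)) (at y) \<and>
           (1 / 2) *\<^sub>R (Fx (x, y) + I * Fy (x, y)) = 0))"

definition qseries :: "(nat \<Rightarrow> quat) \<Rightarrow> quat \<Rightarrow> quat" where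
  "qseries a q = (\<Sum>n. q ^ n * a n)"

definition ell2 :: "(nat \<Rightarrow> quat) \<Rightarrow> bool" where
  "ell2 a \<longleftrightarrow> summable (\<lambda>n. (norm (a n))\<^sup>2)"

text \<open>Boundary values are radial limits at almost every boundary point.\<close>

definition has_boundary_value :: "(quat \<Rightarrow> quat) \<Rightarrow> (quat \<Rightarrow> quat) \<Rightarrow> bool" where
  "has_boundary_value F f \<longleftrightarrow>
     (AE q in boundary_measure. ((\<lambda>r. F (of_real r * q)) \<longlongrightarrow> f q) (at_left (1 :: real)))"

definition boundary_value :: "(quat \<Rightarrow> quat) \<Rightarrow> quat \<Rightarrow> quat" where
  "boundary_value F q = Lim (at_left (1 :: real)) (\<lambda>r. F (of_real r * q))"

text \<open>The values of \<open>f\<close> away from the boundary play no role.  The identity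
  \<open>f(q) = (\<Sum>n. q ^ n * a n)\<close> on the boundary is read in the sense that \<open>f\<close> is the boundary value
  of the slice regular function given by the series on the ball.\<close>

definition H2 :: "(quat \<Rightarrow> quat) set" where
  "H2 = {f. \<exists>a. ell2 a \<and> has_boundary_value (qseries a) f}"

definition Hinf :: "(quat \<Rightarrow> quat) set" where
  "Hinf = {f. \<exists>F. slice_regular F \<and> bounded (F ` ball 0 1) \<and> has_boundary_value F f}"

text \<open>An element of \<open>H2\<close> determines its coefficients uniquely, and \<open>Hinf \<subseteq> H2\<close>; so
  \<open>extension f\<close> is the slice regular extension to the ball of an element of either space.\<close>

definition coeffs :: "(quat \<Rightarrow> quat) \<Rightarrow> nat \<Rightarrow> quat" where
  "coeffs f = (THE a. ell2 a \<and> has_boundary_value (qseries a) f)"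

definition extension :: "(quat \<Rightarrow> quat) \<Rightarrow> quat \<Rightarrow> quat" where
  "extension f = qseries (coeffs f)"

definition inner_function :: "(quat \<Rightarrow> quat) \<Rightarrow> bool" where
  "inner_function \<phi> \<longleftrightarrow>
     \<phi> \<in> Hinf \<and> (\<forall>q\<in>ball 0 1. norm (extension \<phi> q) \<le> 1) \<and>
     (AE q in boundary_measure. norm (\<phi> q) = 1)"

definition outer_function :: "(quat \<Rightarrow> quat) \<Rightarrow> bool" where
  "outer_function g \<longleftrightarrow>
     g \<in> H2 \<and>
     (\<forall>f\<in>H2. (AE q in boundary_measure. norm (g q) = norm (f q)) \<longrightarrow>
        (\<forall>q\<in>ball 0 1. norm (extension g q) \<ge> norm (extension f q)))"

text \<open>The Cauchy product of the coefficients defines a slice regular function on the ball;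
  \<open>f \<star> g\<close> is its boundary value.  Constants enter as \<open>\<lambda>_. c\<close>.\<close>

definition star_prod :: "(quat \<Rightarrow> quat) \<Rightarrow> (quat \<Rightarrow> quat) \<Rightarrow> quat \<Rightarrow> quat" (infixl "\<star>" 70) where
  "f \<star> g = boundary_value (qseries (\<lambda>n. \<Sum>k\<le>n. coeffs f k * coeffs g (n - k)))"

end

theory Submission
  imports Defs "HOL-Complex_Analysis.Complex_Analysis" "HOL-Real_Asymp.Real_Asymp"
begin

text \<open>
  Functions in \<open>H\<^sup>2\<close> are identified with their square summable coefficient sequences, multiplied as
  formal power series over the skew field of quaternions.  A series \<open>\<phi>\<close> is inner iff multiplication by
  \<open>\<phi>\<close> (equivalently from the left or from the right) is isometric.  The Wold decomposition of the shift
  on the invariant subspace generated by \<open>f\<close> yields \<open>f = \<phi> * g\<close> with \<open>\<phi>\<close> inner and \<open>g\<close> cyclic, i.e. with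
  \<open>1\<close> in the closure of \<open>{g * p}\<close>, \<open>p\<close> ranging over polynomials.

  On the boundary sphere through \<open>e\<^sup>t\<^sup>I\<close> a function has the form \<open>b + I * c\<close>.  If \<open>|f| = |g|\<close> there, then
  \<open>|p * f| = |p * g|\<close> for all \<open>p\<close>, so for left cyclic \<open>g\<close> one gets \<open>f = g * u\<close> with \<open>u\<close> inner, whence
  \<open>|f| \<le> |g|\<close> in the ball: left cyclic functions are outer.  Conversely, an outer \<open>g = h * \<psi>\<close> with \<open>h\<close>
  left cyclic satisfies \<open>|h(0)| \<le> |g(0)| = |h(0)| |\<psi>(0)|\<close>, which forces \<open>\<psi>\<close> to be constant.

  Left and right cyclicity agree, because the symmetrization \<open>f\<^sup>c * f\<close> has real coefficients and is
  central.  Uniqueness follows by approximating \<open>\<phi>\<close> by \<open>\<phi> * g * p = \<phi>\<^sub>1 * g\<^sub>1 * p\<close>.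

  Radial limits exist almost everywhere by the Hardy-Littlewood maximal inequality.
\<close>

section \<open>The maximal inequality and radial limits\<close>

text \<open>Noncommutativity shapes the proof. Where \<open>p\<close> does not vanish, the value of
  \<open>p * f\<close> at \<open>q\<close> is the value of \<open>p\<close> at \<open>q\<close>
  times the value of \<open>f\<close> at another point of the same sphere, and that point depends on
  \<open>p\<close> alone. Hence equality of boundary moduli survives multiplication from the left
  but not from the right, and outer functions are reached through left cyclicity. The factorization
  that comes with left cyclicity has its inner factor on the right, whereas the theorem wants it on
  the left. Conjugating the coefficients reverses products and moves the factor, but it turns left
  cyclicity into right cyclicity; this is why the two notions have to be compared. The
  symmetrization cannot be used directly for that, since a square summable \<open>h\<close> need not
  multiply square summable series into themselves. Therefore \<open>h\<close> is first written as a
  quotient of a bounded multiplier by a central bounded multiplier, and the symmetrization of the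
  numerator is used.\<close>

text \<open>Vitali covering. The intervals that violate the bound have radii bounded in terms of the
  total mass, so countably many disjoint ones have fivefold enlargements covering all of them. An
  enlargement has length \<open>10 * h\<close> while its core has mass above
  \<open>2 * h * c\<close>, which gives the factor 5. Taking for \<open>E\<close> the union of the
  enlargements, rather than the set of bad centres, makes it visibly Borel.\<close>

lemma hardy_littlewood_weak_type:
  fixes \<nu> :: "real measure"
  assumes fin: "finite_measure \<nu>" and sets: "sets \<nu> = sets borel" and c: "0 < c"
  obtains E where "E \<in> sets borel" "emeasure lborel E \<le> ennreal (5 / c * measure \<nu> UNIV)"
    "\<And>t h. t \<notin> E \<Longrightarrow> 0 < h \<Longrightarrow> measure \<nu> (cball t h) \<le> 2 * h * c"
proof -
  interpret finite_measure \<nu> by (rule fin)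
  have sp: "space \<nu> = UNIV" using sets_eq_imp_space_eq[OF sets] by simp
  define K where "K = {(t, h). 0 < h \<and> 2 * h * c < measure \<nu> (cball t h)}"
  define S where "S = (\<Union>i\<in>K. cball (fst i) (snd i))"
  have B: "0 < snd i \<and> snd i \<le> measure \<nu> UNIV / (2 * c)" if "i \<in> K" for i
  proof -
    have "2 * snd i * c < measure \<nu> (cball (fst i) (snd i))" "0 < snd i"
      using that by (auto simp: K_def)
    moreover have "measure \<nu> (cball (fst i) (snd i)) \<le> measure \<nu> UNIV"
      using finite_measure_mono[of _ UNIV] sets by auto
    ultimately show ?thesis using c by (auto simp: field_simps)
  qed
  obtain C where C: "countable C" "C \<subseteq> K"
     "pairwise (\<lambda>i j. disjnt (cball (fst i) (snd i)) (cball (fst j) (snd j))) C"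
     "S \<subseteq> (\<Union>i\<in>C. cball (fst i) (5 * snd i))"
    using Vitali_covering_lemma_cballs[where S=S and K=K and a=fst and r=snd and B="measure \<nu> UNIV / (2 * c)"] B
    unfolding S_def by blast
  define N where "N = to_nat_on C ` C"
  define g where "g = from_nat_into C"
  have g: "g n \<in> C" "g n \<in> K" if "n \<in> N" for n
    using that C(1,2) by (auto simp: N_def g_def)
  have gC: "(\<Union>n\<in>N. f (g n)) = (\<Union>i\<in>C. f i)" for f :: "real \<times> real \<Rightarrow> real set"
    using C(1) by (auto simp: N_def g_def)
  have inj: "g m \<noteq> g n" if "m \<in> N" "n \<in> N" "m \<noteq> n" for m n
    using that C(1) by (auto simp: N_def g_def)
  \<comment> \<open>Indexing by natural numbers, with empty sets off \<open>N\<close>, lets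
    countable additivity apply even when \<open>C\<close> is finite.\<close>
  define A where "A r n = (if n \<in> N then cball (fst (g n)) (r * snd (g n)) else {})" for r n
  define E where "E = (\<Union>n. A 5 n)"
  have E: "E = (\<Union>i\<in>C. cball (fst i) (5 * snd i))"
    unfolding gC[symmetric] by (auto simp: E_def A_def split: if_splits)
  have disj: "disjoint_family (A 1)"
    unfolding disjoint_family_on_def
  proof (intro ballI impI)
    fix m n :: nat assume "m \<noteq> n"
    show "A 1 m \<inter> A 1 n = {}"
    proof (cases "m \<in> N \<and> n \<in> N")
      case True
      then show ?thesis
        using C(3) g(1)[of m] g(1)[of n] inj[of m n] \<open>m \<noteq> n\<close>
        by (auto simp: A_def pairwise_def disjnt_def)
    qed (auto simp: A_def)
  qed
  have "emeasure lborel E \<le> (\<Sum>n. emeasure lborel (A 5 n))"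
    unfolding E_def by (rule emeasure_subadditive_countably) (auto simp: A_def)
  also have "\<dots> \<le> (\<Sum>n. ennreal (5 / c) * emeasure \<nu> (A 1 n))"
  proof (rule suminf_le)
    fix n
    show "emeasure lborel (A 5 n) \<le> ennreal (5 / c) * emeasure \<nu> (A 1 n)"
    proof (cases "n \<in> N")
      case True
      obtain t h where th: "g n = (t, h)" by fastforce
      have K: "0 < h" "2 * h * c < measure \<nu> (cball t h)"
        using g(2)[OF True] th by (auto simp: K_def)
      have "emeasure lborel (A 5 n) = ennreal (10 * h)"
        using True th K by (simp add: A_def cball_eq_atLeastAtMost)
      also have "\<dots> \<le> ennreal (5 / c * measure \<nu> (cball t h))"
        using K c by (intro ennreal_leI) (auto simp: field_simps)
      also have "\<dots> = ennreal (5 / c) * emeasure \<nu> (A 1 n)"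
        using True th c by (simp add: A_def emeasure_eq_measure ennreal_mult'' del: times_divide_eq_left)
      finally show ?thesis .
    qed (auto simp: A_def)
  qed auto
  also have "\<dots> = ennreal (5 / c) * emeasure \<nu> (\<Union>n. A 1 n)"
    using disj by (subst ennreal_suminf_cmult, subst suminf_emeasure) (auto simp: A_def sets)
  also have "\<dots> \<le> ennreal (5 / c) * emeasure \<nu> UNIV"
    by (intro mult_left_mono emeasure_mono) (auto simp: sets)
  also have "\<dots> = ennreal (5 / c * measure \<nu> UNIV)"
    using c by (simp add: emeasure_eq_measure ennreal_mult'' del: times_divide_eq_left)
  finally have m: "emeasure lborel E \<le> ennreal (5 / c * measure \<nu> UNIV)" .
  show thesis
  proof (rule that[OF _ m])
    show "E \<in> sets borel" by (auto simp: E_def A_def)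
  next
    fix t h :: real assume t: "t \<notin> E" "0 < h"
    show "measure \<nu> (cball t h) \<le> 2 * h * c"
    proof (rule ccontr)
      assume "\<not> ?thesis"
      then have "(t, h) \<in> K" using t by (auto simp: K_def)
      then have "t \<in> S" using t by (auto simp: S_def intro!: bexI[of _ "(t, h)"])
      then show False using C(4) t(1) unfolding E by blast
    qed
  qed
qed

text \<open>The least dyadic scale containing \<open>s\<close> works: if it is not the first, then
  \<open>s\<close> lies outside the preceding interval, and the kernel is at most
  \<open>\<delta>\<close> over the square of that radius. The loss of one scale is the factor
  4.\<close>

lemma dyadic_annulus_exists:
  fixes s \<delta> :: real
  assumes "0 < \<delta>"
  shows "\<exists>j. \<bar>s\<bar> \<le> 2 ^ j * \<delta> \<and> \<delta> / (\<delta>\<^sup>2 + s\<^sup>2) \<le> 4 / \<delta> * (1/4) ^ j"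
proof (cases "\<bar>s\<bar> \<le> \<delta>")
  case True
  have "\<delta> / (\<delta>\<^sup>2 + s\<^sup>2) \<le> \<delta> / \<delta>\<^sup>2"
    using assms by (intro divide_left_mono) (auto simp: add_pos_nonneg)
  also have "\<dots> \<le> 4 / \<delta>" using assms by (simp add: power2_eq_square field_simps)
  finally show ?thesis using True by (intro exI[of _ 0]) auto
next
  case False
  have "\<exists>j. \<bar>s\<bar> / \<delta> < 2 ^ j" using real_arch_pow[of 2] by simp
  then have ex: "\<exists>j. \<bar>s\<bar> \<le> 2 ^ j * \<delta>" using assms by (auto simp: field_simps intro: less_imp_le)
  define j where "j = (LEAST j. \<bar>s\<bar> \<le> 2 ^ j * \<delta>)"
  have j: "\<bar>s\<bar> \<le> 2 ^ j * \<delta>" unfolding j_def using ex by (rule LeastI_ex)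
  have "j \<noteq> 0" using j False by (metis mult_1 power_0)
  then obtain i where i: "j = Suc i" by (cases j) auto
  have "\<not> \<bar>s\<bar> \<le> 2 ^ i * \<delta>" using not_less_Least[of i "\<lambda>j. \<bar>s\<bar> \<le> 2 ^ j * \<delta>"] i by (simp add: j_def)
  then have "(2 ^ i * \<delta>)\<^sup>2 \<le> s\<^sup>2" using assms by (subst abs_le_square_iff[symmetric]) auto
  then have "\<delta> / (\<delta>\<^sup>2 + s\<^sup>2) \<le> \<delta> / (2 ^ i * \<delta>)\<^sup>2"
    using assms by (intro divide_left_mono) (auto simp: add_pos_nonneg add_increasing)
  also have "\<dots> = 4 / \<delta> * (1/4) ^ j"
    using assms by (simp add: i power2_eq_square field_simps flip: power_mult_distrib)
  finally show ?thesis using j by auto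
qed

text \<open>The kernel is dominated by a sum of multiples of indicators of concentric intervals. The
  interval at scale \<open>j\<close> contributes at most \<open>8 * c * (1/2)^j\<close>, because the
  height decays like \<open>(1/4)^j\<close> and the length grows like \<open>2^j\<close>; the
  geometric series gives 16.\<close>

lemma nn_integral_poisson_le:
  fixes \<nu> :: "real measure"
  assumes fin: "finite_measure \<nu>" and sets: "sets \<nu> = sets borel" and "0 \<le> c" "0 < \<delta>"
    and M: "\<And>h. 0 < h \<Longrightarrow> measure \<nu> (cball t h) \<le> 2 * h * c"
  shows "(\<integral>\<^sup>+ u. ennreal (\<delta> / (\<delta>\<^sup>2 + (u - t)\<^sup>2)) \<partial>\<nu>) \<le> ennreal (16 * c)"
proof -
  interpret finite_measure \<nu> by (rule fin)
  have "(\<integral>\<^sup>+ u. ennreal (\<delta> / (\<delta>\<^sup>2 + (u - t)\<^sup>2)) \<partial>\<nu>)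
     \<le> (\<integral>\<^sup>+ u. (\<Sum>j. ennreal (4 / \<delta> * (1/4) ^ j) * indicator (cball t (2 ^ j * \<delta>)) u) \<partial>\<nu>)"
  proof (rule nn_integral_mono)
    fix u
    obtain j where j: "\<bar>u - t\<bar> \<le> 2 ^ j * \<delta>" "\<delta> / (\<delta>\<^sup>2 + (u - t)\<^sup>2) \<le> 4 / \<delta> * (1/4) ^ j"
      using dyadic_annulus_exists[OF \<open>0 < \<delta>\<close>] by blast
    let ?f = "\<lambda>j. ennreal (4 / \<delta> * (1/4) ^ j) * indicator (cball t (2 ^ j * \<delta>)) u :: ennreal"
    have "ennreal (\<delta> / (\<delta>\<^sup>2 + (u - t)\<^sup>2)) \<le> ?f j"
      using j by (auto simp: dist_real_def abs_minus_commute indicator_def intro!: ennreal_leI)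
    also have "\<dots> \<le> (\<Sum>j. ?f j)"
      using sum_le_suminf[of ?f "{j}"] by (simp del: sum_mult_indicator)
    finally show "ennreal (\<delta> / (\<delta>\<^sup>2 + (u - t)\<^sup>2)) \<le> (\<Sum>j. ?f j)" .
  qed
  also have "\<dots> = (\<Sum>j. ennreal (4 / \<delta> * (1/4) ^ j) * emeasure \<nu> (cball t (2 ^ j * \<delta>)))"
  proof (subst nn_integral_suminf)
    have "cball t h \<in> sets \<nu>" for h using sets by simp
    then show "(\<lambda>u. ennreal (4 / \<delta> * (1/4) ^ j) * indicator (cball t (2 ^ j * \<delta>)) u) \<in> borel_measurable \<nu>" for j
      by (intro borel_measurable_times_ennreal borel_measurable_const borel_measurable_indicator)
  qed (simp add: nn_integral_cmult_indicator sets)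
  also have "\<dots> \<le> (\<Sum>j. ennreal (8 * c * (1/2) ^ j))"
  proof (rule suminf_le)
    fix j
    have "ennreal (4 / \<delta> * (1/4) ^ j) * emeasure \<nu> (cball t (2 ^ j * \<delta>))
        = ennreal (4 / \<delta> * (1/4) ^ j * measure \<nu> (cball t (2 ^ j * \<delta>)))"
      using \<open>0 < \<delta>\<close> by (subst emeasure_eq_measure, subst ennreal_mult'') auto
    also have "\<dots> \<le> ennreal (4 / \<delta> * (1/4) ^ j * (2 * (2 ^ j * \<delta>) * c))"
      using assms by (intro ennreal_leI mult_left_mono M) auto
    also have "4 / \<delta> * (1/4) ^ j * (2 * (2 ^ j * \<delta>) * c) = 8 * c * (1/2) ^ j"
    proof -
      have "(1/4::real) ^ j * 2 ^ j = (1/2) ^ j" by (simp flip: power_mult_distrib)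
      moreover have "4 / \<delta> * (1/4) ^ j * (2 * (2 ^ j * \<delta>) * c) = 8 * c * ((1/4::real) ^ j * 2 ^ j)"
        using assms by (simp add: field_simps)
      ultimately show ?thesis by simp
    qed
    finally show "ennreal (4 / \<delta> * (1/4) ^ j) * emeasure \<nu> (cball t (2 ^ j * \<delta>)) \<le> ennreal (8 * c * (1/2) ^ j)" .
  qed auto
  also have "\<dots> = ennreal (16 * c)"
  proof (rule suminf_ennreal_eq)
    show "(\<lambda>j. 8 * c * (1/2) ^ j) sums (16 * c)"
      using sums_mult[OF geometric_sums[of "1/2::real"], of "8 * c"] by simp
  qed (use assms in auto)
  finally show ?thesis .
qed

section \<open>The Poisson kernel of the disc and the radial maximal function\<close>

text \<open>Compares the Poisson kernel of the disc with that of the half-plane. The distance to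
  \<open>\<rho>\<close> dominates \<open>1 - \<rho>\<close> by the triangle inequality, and it
  dominates \<open>u / pi\<close> because a chord has length at least \<open>2 * u / pi\<close>. The
  constant is 1 + 10, with 10 bounding the square of \<open>pi\<close>.\<close>

lemma chord_lower_bound:
  assumes "0 \<le> u" "u \<le> pi" "0 \<le> \<rho>" "\<rho> < 1"
  shows "(1 - \<rho>)\<^sup>2 + u\<^sup>2 \<le> 11 * (norm (cis u - of_real \<rho>))\<^sup>2"
proof -
  let ?n = "norm (cis u - of_real \<rho>)"
  have a: "1 - \<rho> \<le> ?n" using norm_triangle_ineq2[of "cis u" "of_real \<rho>"] assms by simp
  have "norm (cis u - 1) \<le> norm (cis u - of_real \<rho>) + norm (of_real \<rho> - 1 :: complex)"
    using norm_triangle_ineq[of "cis u - of_real \<rho>" "of_real \<rho> - 1"] by simp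
  also have "norm (of_real \<rho> - 1 :: complex) = 1 - \<rho>"
    using assms norm_of_real[of "\<rho> - 1", where 'a = complex] by simp
  finally have "norm (cis u - 1) \<le> 2 * ?n" using a by simp
  moreover have "2 * u / pi \<le> norm (cis u - 1)"
  proof -
    have "(norm (cis u - 1))\<^sup>2 = (2 * sin (u / 2))\<^sup>2"
    proof -
      have "cos u = 1 - 2 * (sin (u/2))\<^sup>2" using cos_double_sin[of "u/2"] by simp
      moreover have "(norm (cis u - 1))\<^sup>2 = 2 - 2 * cos u"
        using sin_cos_squared_add[of u] unfolding cmod_power2 by (simp add: power2_diff)
      ultimately show ?thesis by (simp add: power_mult_distrib)
    qed
    moreover have "0 \<le> sin (u / 2)" using assms by (intro sin_ge_zero) auto
    ultimately have "norm (cis u - 1) = 2 * sin (u / 2)"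
      by (intro power2_eq_imp_eq[of "norm (cis u - 1)"]) auto
    moreover have "u / pi \<le> sin (u / 2)"
    proof -
      \<comment> \<open>Jordan's inequality: by concavity the sine lies above its chord on the
        quarter period.\<close>
      have "convex_on {0..pi/2} (\<lambda>x. - sin x)"
        by (rule f''_ge0_imp_convex[where f' = "\<lambda>x. - cos x" and f'' = sin])
           (auto intro!: derivative_eq_intros sin_ge_zero)
      then have "(\<lambda>x. - sin x) ((1 - u/pi) *\<^sub>R 0 + (u/pi) *\<^sub>R (pi/2))
          \<le> (1 - u/pi) * (- sin 0) + (u/pi) * (- sin (pi/2))"
        using assms by (intro convex_onD) (auto simp: field_simps)
      then show ?thesis by simp
    qed
    ultimately show ?thesis by simp
  qed
  ultimately have "2 * u / pi \<le> 2 * ?n" by linarith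
  then have "u \<le> pi * ?n" by (simp add: field_simps)
  then have "u\<^sup>2 \<le> (pi * ?n)\<^sup>2" using assms by (intro power_mono) auto
  moreover have "(1 - \<rho>)\<^sup>2 \<le> ?n\<^sup>2" using a assms by (intro power_mono) auto
  moreover have "pi\<^sup>2 \<le> 10"
  proof -
    have "pi \<le> 3.16" using pi_approx by simp
    then have "pi\<^sup>2 \<le> 3.16\<^sup>2" by (intro power_mono) auto
    then show ?thesis by (simp add: power2_eq_square)
  qed
  then have "pi\<^sup>2 * ?n\<^sup>2 \<le> 10 * ?n\<^sup>2" by (intro mult_right_mono) auto
  ultimately show ?thesis by (simp add: power_mult_distrib)
qed

lemma nn_integral_interval:
  fixes f :: "real \<Rightarrow> real"
  assumes "continuous_on {a..b} f" "\<And>v. v \<in> {a..b} \<Longrightarrow> 0 \<le> f v"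
  shows "(\<integral>\<^sup>+ v. ennreal (f v) * indicator {a..b} v \<partial>lborel) = ennreal (integral {a..b} f)"
proof -
  have "(\<integral>\<^sup>+ v. ennreal (f v) * indicator {a..b} v \<partial>lborel) = (\<integral>\<^sup>+ v. ennreal (indicator {a..b} v *\<^sub>R f v) \<partial>lborel)"
    by (intro nn_integral_cong) (auto simp: indicator_def)
  also have "\<dots> = ennreal (LINT v:{a..b}|lborel. f v)"
    unfolding set_lebesgue_integral_def using assms borel_integrable_atLeastAtMost'[OF assms(1)]
    by (intro nn_integral_eq_integral) (auto simp: set_integrable_def indicator_def)
  also have "(LINT v:{a..b}|lborel. f v) = integral {a..b} f"
    by (rule set_borel_integral_eq_integral(2)[OF borel_integrable_atLeastAtMost'[OF assms(1)]])
  finally show ?thesis .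
qed

text \<open>Cauchy's formula at \<open>\<rho>\<close> for the rotated function times
  \<open>(1 - \<rho>^2) / (1 - \<rho> * w)\<close>. This factor is holomorphic near the closed disc
  and equals 1 at \<open>\<rho>\<close>. On the circle \<open>1 - \<rho> * w\<close> and
  \<open>w - \<rho>\<close> have equal modulus, so the Cauchy kernel becomes the Poisson
  kernel.\<close>

lemma poisson_estimate:
  assumes cont: "continuous_on (cball 0 1) F" and hol: "F holomorphic_on ball 0 1"
    and \<rho>: "0 \<le> \<rho>" "\<rho> < 1"
  shows "norm (F (of_real \<rho> * cis t)) \<le>
    integral {0..2*pi} (\<lambda>u. norm (F (cis (t + u))) * ((1 - \<rho>\<^sup>2) / (norm (cis u - of_real \<rho>))\<^sup>2)) / (2 * pi)"
proof -
  define G where "G = (\<lambda>w. F (cis t * w) * (of_real (1 - \<rho>\<^sup>2) / (1 - of_real \<rho> * w)))"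
  have nz: "1 - of_real \<rho> * w \<noteq> 0" if "norm w \<le> 1" for w :: complex
  proof
    assume "1 - of_real \<rho> * w = 0"
    then have "norm (of_real \<rho> * w) = 1" by (metis eq_iff_diff_eq_0 norm_one)
    moreover have "\<rho> * norm w \<le> \<rho> * 1" using \<rho> that by (intro mult_left_mono) auto
    ultimately show False using \<rho> by (simp add: norm_mult)
  qed
  have sub: "(\<lambda>w. cis t * w) ` cball 0 1 \<subseteq> cball 0 1" "(\<lambda>w. cis t * w) ` ball 0 1 \<subseteq> ball 0 1"
    by (auto simp: norm_mult)
  have "continuous_on (cball 0 1) (\<lambda>w. F (cis t * w))"
    by (rule continuous_on_compose2[OF cont _ sub(1)]) (intro continuous_intros)
  then have G1: "continuous_on (cball 0 1) G"
    unfolding G_def using nz by (intro continuous_intros) auto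
  have "(F \<circ> (\<lambda>w. cis t * w)) holomorphic_on ball 0 1"
    by (rule holomorphic_on_compose_gen[OF _ hol]) (use sub in \<open>auto intro!: holomorphic_intros\<close>)
  then have G2: "G holomorphic_on ball 0 1"
    unfolding G_def comp_def using nz by (intro holomorphic_intros) auto
  have "((\<lambda>u. G u / (u - of_real \<rho>)) has_contour_integral (2 * of_real pi * \<i> * G (of_real \<rho>))) (circlepath 0 1)"
    by (rule Cauchy_integral_circlepath[OF G1 G2]) (use \<rho> in auto)
  then have I: "((\<lambda>u. G (cis u) / (cis u - of_real \<rho>) * \<i> * cis u) has_integral (2 * of_real pi * \<i> * G (of_real \<rho>))) {0..2*pi}"
    unfolding circlepath_def by (subst (asm) has_contour_integral_part_circlepath_iff) (auto simp: mult_ac)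
  have ne: "cis u \<noteq> of_real \<rho>" for u
  proof
    assume "cis u = of_real \<rho>"
    then have "norm (of_real \<rho> :: complex) = 1" by (metis norm_cis)
    then show False using \<rho> by simp
  qed
  have eq: "norm (G (cis u) / (cis u - of_real \<rho>) * \<i> * cis u)
      = norm (F (cis (t + u))) * ((1 - \<rho>\<^sup>2) / (norm (cis u - of_real \<rho>))\<^sup>2)" for u
  proof -
    have "norm (1 - of_real \<rho> * cis u) = norm (cis u - of_real \<rho>)"
    proof -
      have "norm (1 - of_real \<rho> * cis u) = norm (cnj (cis u) * (1 - of_real \<rho> * cis u))"
        by (simp add: norm_mult)
      also have "cnj (cis u) * (1 - of_real \<rho> * cis u) = cnj (cis u - of_real \<rho>)"
        by (simp add: algebra_simps cis_cnj cis_mult)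
      finally show ?thesis by (metis complex_mod_cnj)
    qed
    moreover have "norm (of_real (1 - \<rho>\<^sup>2) :: complex) = 1 - \<rho>\<^sup>2"
      using \<rho> by (simp add: power_le_one_iff abs_square_le_1 del: of_real_diff of_real_power)
    ultimately show ?thesis
      by (simp add: G_def norm_mult norm_divide cis_mult power2_eq_square del: of_real_diff of_real_power)
  qed
  have "(1 - \<rho>\<^sup>2) / (1 - of_real \<rho> * of_real \<rho>) = (1::complex)"
    using nz[of "of_real \<rho>"] \<rho> by (simp add: power2_eq_square flip: of_real_mult)
  then have G\<rho>: "G (of_real \<rho>) = F (of_real \<rho> * cis t)"
    by (simp add: G_def mult.commute)
  have C: "continuous_on {0..2*pi} (\<lambda>u. norm (F (cis (t + u))) * ((1 - \<rho>\<^sup>2) / (norm (cis u - of_real \<rho>))\<^sup>2))"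
  proof -
    have "continuous_on {0..2*pi} (\<lambda>u. F (cis (t + u)))"
      by (rule continuous_on_compose2[OF cont]) (auto intro!: continuous_intros)
    then show ?thesis using ne by (intro continuous_intros) auto
  qed
  have "norm (2 * of_real pi * \<i> * G (of_real \<rho>)) \<le>
      integral {0..2*pi} (\<lambda>u. norm (F (cis (t + u))) * ((1 - \<rho>\<^sup>2) / (norm (cis u - of_real \<rho>))\<^sup>2))"
    unfolding integral_unique[OF I, symmetric]
  proof (rule integral_norm_bound_integral)
    show "(\<lambda>u. G (cis u) / (cis u - of_real \<rho>) * \<i> * cis u) integrable_on {0..2*pi}"
      using I by (rule has_integral_integrable)
  qed (use C in \<open>auto simp only: eq intro: integrable_continuous_interval\<close>)
  then show ?thesis by (simp add: norm_mult G\<rho> field_simps)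
qed

lemma cis_diff_2pi: "cis (v - 2 * pi) = cis v" "cis (v + 2 * pi) = cis v"
  by (simp_all add: cis.code complex_eq_iff sin_diff cos_diff sin_add cos_add)

text \<open>Off the Vitali set the Poisson average is controlled at every radius at once. The
  constants: 15 is the factor 5 for three periods of mass; 22 is 2 from
  \<open>1 - \<rho>^2 <= 2 * (1 - \<rho>)\<close> times 11 from the chord bound; two peaks of size
  \<open>22 * 16\<close> give 704, and 250 is a generous bound for
  \<open>704 / (2 * pi)\<close>.\<close>

lemma radial_maximal_estimate:
  assumes cont: "continuous_on (cball 0 1) F" and hol: "F holomorphic_on ball 0 1" and c: "0 < c"
    and int: "integral {0..2*pi} (\<lambda>v. norm (F (cis v))) \<le> m"
  obtains E where "E \<in> sets borel" "emeasure lborel E \<le> ennreal (15 / c * m)"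
    "\<And>t \<rho>. t \<in> {0..2*pi} \<Longrightarrow> t \<notin> E \<Longrightarrow> 0 \<le> \<rho> \<Longrightarrow> \<rho> < 1 \<Longrightarrow> norm (F (of_real \<rho> * cis t)) \<le> 250 * c"
proof -
  have cF: "continuous_on S (\<lambda>v. norm (F (cis v)))" for S
  proof -
    have "continuous_on S (\<lambda>u. F (cis u))"
      by (rule continuous_on_compose2[OF cont]) (auto intro!: continuous_intros)
    then show ?thesis by (intro continuous_intros)
  qed
  define w where "w = (\<lambda>v. norm (F (cis v)))"
  have cw: "continuous_on S w" for S using cF by (simp add: w_def)
  have w0: "0 \<le> w v" for v by (simp add: w_def)
  have per: "w (v - 2 * pi) = w v" "w (v + 2 * pi) = w v" for v by (simp_all add: w_def cis_diff_2pi)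
  have mw: "w \<in> borel_measurable borel" by (rule borel_measurable_continuous_onI[OF cw])
  \<comment> \<open>Three periods: for \<open>t\<close> and \<open>u\<close> in the middle one, both
    \<open>t + u\<close> and \<open>t + u - 2 * pi\<close> stay inside.\<close>
  define \<nu> where "\<nu> = density lborel (\<lambda>v. ennreal (w v) * indicator {-2*pi..4*pi} v)"
  have sets: "sets \<nu> = sets borel" by (simp add: \<nu>_def)
  have trans: "(\<integral>\<^sup>+ v. f v \<partial>lborel) = (\<integral>\<^sup>+ v. f (d + v) \<partial>lborel)"
    if "f \<in> borel_measurable borel" for f :: "real \<Rightarrow> ennreal" and d
    using nn_integral_real_affine[OF that, of 1 d] by simp
  have m0: "0 \<le> m"
    using int integral_nonneg[of w "{0..2*pi}"] cw w0
    by (auto simp: w_def[symmetric] integrable_continuous_interval intro: order_trans)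
  have J: "(\<integral>\<^sup>+ v. ennreal (w v) * indicator {0..2*pi} v \<partial>lborel) \<le> ennreal m"
    using nn_integral_interval[OF cw, of 0 "2*pi"] w0 int by (simp add: w_def[symmetric] ennreal_leI)
  have "emeasure \<nu> UNIV = (\<integral>\<^sup>+ v. ennreal (w v) * indicator {-2*pi..4*pi} v \<partial>lborel)"
    unfolding \<nu>_def using mw by (subst emeasure_density) auto
  also have "\<dots> \<le> (\<integral>\<^sup>+ v. ennreal (w v) * indicator {0..2*pi} (2*pi + v) + ennreal (w v) * indicator {0..2*pi} v
      + ennreal (w v) * indicator {0..2*pi} (-2*pi + v) \<partial>lborel)"
    by (intro nn_integral_mono) (auto simp: indicator_def)
  also have "\<dots> = (\<integral>\<^sup>+ v. ennreal (w v) * indicator {0..2*pi} (2*pi + v) \<partial>lborel)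
      + (\<integral>\<^sup>+ v. ennreal (w v) * indicator {0..2*pi} v \<partial>lborel)
      + (\<integral>\<^sup>+ v. ennreal (w v) * indicator {0..2*pi} (-2*pi + v) \<partial>lborel)"
    using mw by (subst nn_integral_add, simp, simp)+ simp
  also have "(\<integral>\<^sup>+ v. ennreal (w v) * indicator {0..2*pi} (2*pi + v) \<partial>lborel)
      = (\<integral>\<^sup>+ v. ennreal (w v) * indicator {0..2*pi} v \<partial>lborel)"
    using mw per(2) by (subst trans[of "\<lambda>v. ennreal (w v) * indicator {0..2*pi} v" "2*pi"]) (auto simp: add.commute)
  also have "(\<integral>\<^sup>+ v. ennreal (w v) * indicator {0..2*pi} (-2*pi + v) \<partial>lborel)
      = (\<integral>\<^sup>+ v. ennreal (w v) * indicator {0..2*pi} v \<partial>lborel)"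
    using mw per(1) by (subst trans[of "\<lambda>v. ennreal (w v) * indicator {0..2*pi} v" "-2*pi"]) (auto simp: add.commute)
  finally have "emeasure \<nu> UNIV \<le> ennreal m + ennreal m + ennreal m"
    using J by (meson add_mono order_trans)
  then have mass: "emeasure \<nu> UNIV \<le> ennreal (3 * m)"
    using m0 by (simp flip: ennreal_plus)
  then have fin: "finite_measure \<nu>"
    by (intro finite_measureI) (auto simp: \<nu>_def top_unique)
  then interpret finite_measure \<nu> .
  have mass': "measure \<nu> UNIV \<le> 3 * m"
    using mass m0 by (simp add: emeasure_eq_measure)
  obtain E where E: "E \<in> sets borel" "emeasure lborel E \<le> ennreal (5 / c * measure \<nu> UNIV)"
    "\<And>t h. t \<notin> E \<Longrightarrow> 0 < h \<Longrightarrow> measure \<nu> (cball t h) \<le> 2 * h * c"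
    using hardy_littlewood_weak_type[OF fin sets c] by blast
  show thesis
  proof (rule that[OF E(1)])
    have "5 / c * measure \<nu> UNIV \<le> 5 / c * (3 * m)" using mass' c by (intro mult_left_mono) auto
    then show "emeasure lborel E \<le> ennreal (15 / c * m)"
      using E(2) by (auto intro: order_trans ennreal_leI)
  next
    fix t \<rho> :: real assume t: "t \<in> {0..2*pi}" "t \<notin> E" and \<rho>: "0 \<le> \<rho>" "\<rho> < 1"
    define \<delta> where "\<delta> = 1 - \<rho>"
    define k where "k = (\<lambda>s. \<delta> / (\<delta>\<^sup>2 + s\<^sup>2))"
    have \<delta>: "0 < \<delta>" "\<delta> \<le> 1" using \<rho> by (auto simp: \<delta>_def)
    have k0: "0 \<le> k s" for s using \<delta> by (auto simp: k_def)
    have mk: "k \<in> borel_measurable borel" unfolding k_def by measurable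
    have P: "(\<integral>\<^sup>+ u. ennreal (k (u - t)) \<partial>\<nu>) \<le> ennreal (16 * c)"
      unfolding k_def using c \<delta> E(3)[OF t(2)] by (intro nn_integral_poisson_le[OF fin sets]) auto
    have P': "(\<integral>\<^sup>+ u. ennreal (k (u - t)) \<partial>\<nu>)
        = (\<integral>\<^sup>+ v. ennreal (w v) * indicator {-2*pi..4*pi} v * ennreal (k (v - t)) \<partial>lborel)"
      unfolding \<nu>_def using mw mk by (subst nn_integral_density) auto
    define K where "K = (\<lambda>u. (1 - \<rho>\<^sup>2) / (norm (cis u - of_real \<rho>))\<^sup>2)"
    have K1: "K u \<le> 22 * k u" if "0 \<le> u" "u \<le> pi" for u
    proof -
      have pos: "0 < \<delta>\<^sup>2 + u\<^sup>2" using \<delta> by (simp add: add_pos_nonneg)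
      then have n0: "0 < (norm (cis u - of_real \<rho>))\<^sup>2"
        using chord_lower_bound[OF that \<rho>, folded \<delta>_def] by linarith
      have "1 - \<rho>\<^sup>2 \<le> 2 * \<delta>"
      proof -
        have "1 - \<rho>\<^sup>2 = \<delta> * (1 + \<rho>)" by (simp add: \<delta>_def power2_eq_square algebra_simps)
        also have "\<dots> \<le> \<delta> * 2" using \<rho> \<delta> by (intro mult_left_mono) auto
        finally show ?thesis by simp
      qed
      then have "K u \<le> 2 * \<delta> / (norm (cis u - of_real \<rho>))\<^sup>2"
        unfolding K_def by (intro divide_right_mono) auto
      also have "\<dots> \<le> 2 * \<delta> / ((\<delta>\<^sup>2 + u\<^sup>2) / 11)"
        using chord_lower_bound[OF that \<rho>] pos n0 \<delta> by (intro divide_left_mono) (auto simp: \<delta>_def)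
      finally show ?thesis by (simp add: k_def)
    qed
    have K2: "K u = K (2 * pi - u)" for u
    proof -
      have "cis (2 * pi - u) = cnj (cis u)"
        by (simp add: complex_eq_iff sin_diff cos_diff)
      then have "cis (2 * pi - u) - of_real \<rho> = cnj (cis u - of_real \<rho>)" by simp
      then show ?thesis unfolding K_def by (metis complex_mod_cnj)
    qed
    \<comment> \<open>The chord bound covers the half circle near 0; reflection covers the other
      half, where the periodic kernel peaks at \<open>2 * pi\<close> instead.\<close>
    have K: "K u \<le> 22 * k u + 22 * k (u - 2*pi)" if "0 \<le> u" "u \<le> 2*pi" for u
    proof (cases "u \<le> pi")
      case True
      then show ?thesis using K1[of u] k0[of "u - 2*pi"] that by simp
    next
      case False
      have "k (2 * pi - u) = k (u - 2*pi)" by (simp add: k_def power2_commute)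
      then show ?thesis using K1[of "2 * pi - u"] K2[of u] k0[of u] that False by simp
    qed
    have ne: "cis u \<noteq> of_real \<rho>" for u
    proof
      assume "cis u = of_real \<rho>"
      then have "norm (of_real \<rho> :: complex) = 1" by (metis norm_cis)
      then show False using \<rho> by simp
    qed
    have KC: "continuous_on S K" for S unfolding K_def using ne by (intro continuous_intros) auto
    have Kn: "0 \<le> K u" for u using \<rho> by (auto simp: K_def power_le_one_iff abs_square_le_1)
    have wC: "continuous_on S (\<lambda>u. w (t + u))" for S
      by (rule continuous_on_compose2[OF cw[of UNIV]]) (auto intro!: continuous_intros)
    have i1: "(\<integral>\<^sup>+ u. ennreal (w (t + u)) * indicator {0..2*pi} u * ennreal (k u) \<partial>lborel) \<le> ennreal (16 * c)"
    proof -
      have "(\<integral>\<^sup>+ u. ennreal (w (t + u)) * indicator {0..2*pi} u * ennreal (k u) \<partial>lborel)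
        = (\<integral>\<^sup>+ v. ennreal (w v) * indicator {0..2*pi} (v - t) * ennreal (k (v - t)) \<partial>lborel)"
        using mw mk by (subst trans[of "\<lambda>v. ennreal (w v) * indicator {0..2*pi} (v - t) * ennreal (k (v - t))" t]) auto
      also have "\<dots> \<le> (\<integral>\<^sup>+ v. ennreal (w v) * indicator {-2*pi..4*pi} v * ennreal (k (v - t)) \<partial>lborel)"
        using t by (intro nn_integral_mono mult_right_mono mult_left_mono) (auto simp: indicator_def)
      finally show ?thesis using P P' by simp
    qed
    have i2: "(\<integral>\<^sup>+ u. ennreal (w (t + u)) * indicator {0..2*pi} u * ennreal (k (u - 2*pi)) \<partial>lborel) \<le> ennreal (16 * c)"
    proof -
      have "(\<integral>\<^sup>+ u. ennreal (w (t + u)) * indicator {0..2*pi} u * ennreal (k (u - 2*pi)) \<partial>lborel)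
        = (\<integral>\<^sup>+ v. ennreal (w v) * indicator {0..2*pi} (v - t + 2*pi) * ennreal (k (v - t)) \<partial>lborel)"
        using mw mk per(1)
        by (subst trans[of "\<lambda>v. ennreal (w v) * indicator {0..2*pi} (v - t + 2*pi) * ennreal (k (v - t))" "t - 2*pi"])
           (auto simp: algebra_simps diff_add_eq intro!: nn_integral_cong)
      also have "\<dots> \<le> (\<integral>\<^sup>+ v. ennreal (w v) * indicator {-2*pi..4*pi} v * ennreal (k (v - t)) \<partial>lborel)"
        using t by (intro nn_integral_mono mult_right_mono mult_left_mono) (auto simp: indicator_def)
      finally show ?thesis using P P' by simp
    qed
    have "ennreal (integral {0..2*pi} (\<lambda>u. w (t + u) * K u))
        = (\<integral>\<^sup>+ u. ennreal (w (t + u) * K u) * indicator {0..2*pi} u \<partial>lborel)"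
      using wC KC w0 Kn by (subst nn_integral_interval) (auto intro!: continuous_intros)
    also have "\<dots> \<le> (\<integral>\<^sup>+ u. 22 * (ennreal (w (t + u)) * indicator {0..2*pi} u * ennreal (k u))
        + 22 * (ennreal (w (t + u)) * indicator {0..2*pi} u * ennreal (k (u - 2*pi))) \<partial>lborel)"
    proof (rule nn_integral_mono)
      fix u
      show "ennreal (w (t + u) * K u) * indicator {0..2*pi} u \<le> 22 * (ennreal (w (t + u)) * indicator {0..2*pi} u * ennreal (k u))
        + 22 * (ennreal (w (t + u)) * indicator {0..2*pi} u * ennreal (k (u - 2*pi)))"
      proof (cases "u \<in> {0..2*pi}")
        case True
        have "w (t + u) * K u \<le> w (t + u) * (22 * k u + 22 * k (u - 2*pi))"
          using True w0 K[of u] by (intro mult_left_mono) auto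
        then have "ennreal (w (t + u) * K u) \<le> ennreal (22 * (w (t + u) * k u) + 22 * (w (t + u) * k (u - 2*pi)))"
          by (intro ennreal_leI) (simp add: algebra_simps)
        also have "\<dots> = 22 * (ennreal (w (t + u)) * ennreal (k u)) + 22 * (ennreal (w (t + u)) * ennreal (k (u - 2*pi)))"
          using w0 k0 by (simp add: ennreal_mult ennreal_plus)
        finally show ?thesis using True by simp
      qed auto
    qed
    also have "\<dots> = 22 * (\<integral>\<^sup>+ u. ennreal (w (t + u)) * indicator {0..2*pi} u * ennreal (k u) \<partial>lborel)
       + 22 * (\<integral>\<^sup>+ u. ennreal (w (t + u)) * indicator {0..2*pi} u * ennreal (k (u - 2*pi)) \<partial>lborel)"
      using mw mk by (subst nn_integral_add, simp, simp) (subst nn_integral_cmult, simp, subst nn_integral_cmult, simp, simp)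
    also have "\<dots> \<le> 22 * ennreal (16 * c) + 22 * ennreal (16 * c)"
      by (intro add_mono mult_left_mono i1 i2) auto
    also have "\<dots> = ennreal (704 * c)"
      using c by (simp flip: ennreal_numeral ennreal_mult ennreal_plus)
    finally have "integral {0..2*pi} (\<lambda>u. w (t + u) * K u) \<le> 704 * c"
      using c by (subst (asm) ennreal_le_iff) auto
    moreover have "norm (F (of_real \<rho> * cis t)) \<le> integral {0..2*pi} (\<lambda>u. w (t + u) * K u) / (2 * pi)"
      using poisson_estimate[OF cont hol \<rho>, of t] by (simp add: w_def K_def)
    ultimately have "norm (F (of_real \<rho> * cis t)) \<le> 704 * c / (2 * pi)"
      using divide_right_mono[of _ "704 * c" "2 * pi"] pi_gt_zero by fastforce
    also have "\<dots> \<le> 250 * c"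
    proof -
      have "704 * c \<le> 250 * c * (2 * pi)" using pi_gt3 c by (simp add: field_simps)
      then show ?thesis using pi_gt_zero by (simp add: field_simps)
    qed
    finally show "norm (F (of_real \<rho> * cis t)) \<le> 250 * c" .
  qed
qed

section \<open>Parseval's identity for trigonometric sums\<close>

lemma integral_cos_multiple:
  fixes k :: int and j :: nat
  assumes "k \<noteq> 0"
  shows "((\<lambda>t. cos (of_int k * t)) has_integral 0) {0..real j * pi}"
proof -
  have "sin (of_int k * (real j * pi)) = 0"
    using sin_times_pi_eq_0[of "of_int (k * int j)"] by (simp add: mult.assoc)
  moreover have "((\<lambda>t. cos (of_int k * t)) has_integral
      (sin (of_int k * (real j * pi)) / of_int k - sin (of_int k * 0) / of_int k)) {0..real j * pi}"
    using assms by (intro fundamental_theorem_of_calculus)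
      (auto intro!: derivative_eq_intros simp: has_real_derivative_iff_has_vector_derivative[symmetric])
  ultimately show ?thesis by simp
qed

text \<open>The two squares together replace the squared modulus of an exponential sum, which needs
  a complex structure on the coefficient space. The cross terms combine to the cosine of an integer
  multiple of \<open>t\<close>, and this integrates to 0 already over half a period. Hence
  \<open>j = 1\<close> serves the upper half circle on slices and \<open>j = 2\<close> the full
  complex circle.\<close>

lemma finite_trig_parseval:
  fixes a :: "nat \<Rightarrow> 'a::real_inner"
  shows "((\<lambda>t. (norm (\<Sum>n<N. cos (real n * t) *\<^sub>R a n))\<^sup>2 + (norm (\<Sum>n<N. sin (real n * t) *\<^sub>R a n))\<^sup>2)
    has_integral (real j * pi * (\<Sum>n<N. (norm (a n))\<^sup>2))) {0..real j * pi}"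
proof -
  have eq: "(norm (\<Sum>n<N. cos (real n * t) *\<^sub>R a n))\<^sup>2 + (norm (\<Sum>n<N. sin (real n * t) *\<^sub>R a n))\<^sup>2
    = (\<Sum>n<N. \<Sum>m<N. cos (of_int (int n - int m) * t) * (a n \<bullet> a m))" for t
    unfolding power2_norm_eq_inner inner_sum_left inner_sum_right
    by (subst sum.swap) (simp add: algebra_simps cos_diff flip: sum.distrib)
  have *: "((\<lambda>t. cos (of_int (int n - int m) * t) * (a n \<bullet> a m)) has_integral
      (if n = m then real j * pi * (norm (a n))\<^sup>2 else 0)) {0..real j * pi}" for n m
  proof (cases "n = m")
    case True
    then show ?thesis
      using has_integral_const_real[of "(norm (a n))\<^sup>2" 0 "real j * pi"] by (simp add: power2_norm_eq_inner)
  next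
    case False
    then show ?thesis
      using has_integral_mult_left[OF integral_cos_multiple[of "int n - int m" j], of "a n \<bullet> a m"] by simp
  qed
  have "((\<lambda>t. \<Sum>n<N. \<Sum>m<N. cos (of_int (int n - int m) * t) * (a n \<bullet> a m)) has_integral
      (\<Sum>n<N. \<Sum>m<N. if n = m then real j * pi * (norm (a n))\<^sup>2 else 0)) {0..real j * pi}"
    by (intro has_integral_sum * ballI finite_lessThan)
  then show ?thesis by (simp add: eq sum_distrib_left)
qed

lemma trig_parseval:
  fixes a :: "nat \<Rightarrow> 'a::{real_inner, banach}"
  assumes sm: "summable (\<lambda>n. norm (a n))"
  shows "((\<lambda>t. (norm (\<Sum>n. cos (real n * t) *\<^sub>R a n))\<^sup>2 + (norm (\<Sum>n. sin (real n * t) *\<^sub>R a n))\<^sup>2)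
    has_integral (real j * pi * (\<Sum>n. (norm (a n))\<^sup>2))) {0..real j * pi}"
proof -
  let ?A = "\<Sum>n. norm (a n)"
  define f where "f = (\<lambda>N t. (norm (\<Sum>n<N. cos (real n * t) *\<^sub>R a n))\<^sup>2 + (norm (\<Sum>n<N. sin (real n * t) *\<^sub>R a n))\<^sup>2)"
  define g where "g = (\<lambda>t. (norm (\<Sum>n. cos (real n * t) *\<^sub>R a n))\<^sup>2 + (norm (\<Sum>n. sin (real n * t) *\<^sub>R a n))\<^sup>2)"
  have sc: "summable (\<lambda>n. c n *\<^sub>R a n)" if "\<And>n. \<bar>c n\<bar> \<le> 1" for c :: "nat \<Rightarrow> real"
    by (rule summable_norm_cancel, rule summable_comparison_test'[OF sm, of 0])
       (use that in \<open>auto intro!: mult_left_le_one_le\<close>)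
  have bd: "norm (\<Sum>n<N. c n *\<^sub>R a n) \<le> ?A" if "\<And>n. \<bar>c n\<bar> \<le> 1" for N and c :: "nat \<Rightarrow> real"
  proof -
    have "norm (\<Sum>n<N. c n *\<^sub>R a n) \<le> (\<Sum>n<N. norm (a n))"
      by (rule sum_norm_le) (use that in \<open>auto intro!: mult_left_le_one_le\<close>)
    also have "\<dots> \<le> ?A" by (rule sum_le_suminf[OF sm]) auto
    finally show ?thesis .
  qed
  have fi: "(f N has_integral (real j * pi * (\<Sum>n<N. (norm (a n))\<^sup>2))) {0..real j * pi}" for N
    unfolding f_def by (rule finite_trig_parseval)
  have conv: "(\<lambda>N. f N t) \<longlonglongrightarrow> g t" for t
    unfolding f_def g_def by (intro tendsto_intros summable_LIMSEQ sc) auto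
  have dom: "norm (f N t) \<le> 2 * ?A\<^sup>2" for N t
  proof -
    have "(norm (\<Sum>n<N. cos (real n * t) *\<^sub>R a n))\<^sup>2 \<le> ?A\<^sup>2" "(norm (\<Sum>n<N. sin (real n * t) *\<^sub>R a n))\<^sup>2 \<le> ?A\<^sup>2"
      by (intro power_mono bd; simp)+
    then show ?thesis unfolding f_def by simp
  qed
  have 1: "g integrable_on {0..real j * pi}"
    and 2: "(\<lambda>N. integral {0..real j * pi} (f N)) \<longlonglongrightarrow> integral {0..real j * pi} g"
    using fi by (rule_tac dominated_convergence[of f "{0..real j * pi}" "\<lambda>_. 2 * ?A\<^sup>2" g];
      use conv dom in \<open>auto intro: has_integral_integrable\<close>)+
  have "summable (\<lambda>n. (norm (a n))\<^sup>2)"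
  proof (rule summable_comparison_test_ev)
    have "(\<lambda>n. norm (a n)) \<longlonglongrightarrow> 0" by (rule summable_LIMSEQ_zero[OF sm])
    then have "\<forall>\<^sub>F n in sequentially. norm (a n) < 1" by (rule order_tendstoD) simp
    then show "\<forall>\<^sub>F n in sequentially. norm ((norm (a n))\<^sup>2) \<le> norm (a n)"
      by eventually_elim (auto simp: power2_eq_square intro!: mult_left_le_one_le)
  qed (rule sm)
  then have "(\<lambda>N. real j * pi * (\<Sum>n<N. (norm (a n))\<^sup>2)) \<longlonglongrightarrow> real j * pi * (\<Sum>n. (norm (a n))\<^sup>2)"
    by (intro tendsto_intros summable_LIMSEQ)
  then have "integral {0..real j * pi} g = real j * pi * (\<Sum>n. (norm (a n))\<^sup>2)"
    using 2 LIMSEQ_unique unfolding integral_unique[OF fi] by blast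
  then show ?thesis using integrable_integral[OF 1] unfolding g_def by simp
qed

lemma square_summable_bounded:
  fixes a :: "nat \<Rightarrow> 'a::real_normed_vector"
  assumes "summable (\<lambda>n. (norm (a n))\<^sup>2)"
  shows "\<exists>M. \<forall>n. norm (a n) \<le> M"
proof -
  have "norm (a n) \<le> sqrt (\<Sum>n. (norm (a n))\<^sup>2)" for n
    using sum_le_suminf[OF assms, of "{n}"] by (intro real_le_rsqrt) auto
  then show ?thesis by blast
qed

section \<open>Radial limits of complex power series\<close>

lemma square_summable_power:
  fixes a :: "nat \<Rightarrow> 'a::real_normed_vector" and r :: real
  assumes "summable (\<lambda>n. (norm (a n))\<^sup>2)" "0 \<le> r" "r < 1"
  shows "summable (\<lambda>n. r ^ n * norm (a n))"
proof -
  obtain M where M: "norm (a n) \<le> M" for n using square_summable_bounded[OF assms(1)] by blast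
  show ?thesis
    by (rule summable_comparison_test'[of "\<lambda>n. r ^ n * M" 0])
       (use assms M in \<open>auto intro!: summable_mult2 summable_geometric mult_left_mono\<close>)
qed

text \<open>The coefficients are real because each of the four real components of a quaternionic
  sequence is fed into it separately; complex function theory enters through these four
  series.\<close>

definition psum :: "(nat \<Rightarrow> real) \<Rightarrow> complex \<Rightarrow> complex" where
  "psum a z = (\<Sum>n. of_real (a n) * z ^ n)"

lemma psum_sums:
  assumes "summable (\<lambda>n. (a n)\<^sup>2)" "norm z < 1"
  shows "(\<lambda>n. of_real (a n) * z ^ n) sums psum a z"
  unfolding psum_def
proof (rule summable_sums, rule summable_norm_cancel)
  show "summable (\<lambda>n. norm (of_real (a n) * z ^ n))"
    using square_summable_power[of a "norm z"] assms by (simp add: norm_mult norm_power mult.commute)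
qed

lemma psum_holomorphic:
  assumes "summable (\<lambda>n. (a n)\<^sup>2)"
  shows "psum a holomorphic_on ball 0 1"
proof (rule power_series_holomorphic)
  show "(\<lambda>n. of_real (a n) * (w - 0) ^ n) sums psum a w" if "w \<in> ball 0 1" for w
    using psum_sums[OF assms, of w] that by simp
qed

lemma psum_polar:
  fixes r t :: real
  assumes "summable (\<lambda>n. (a n)\<^sup>2)" "0 \<le> r" "r < 1"
  shows "Re (psum a (of_real r * cis t)) = (\<Sum>n. cos (real n * t) *\<^sub>R (r ^ n * a n))"
    "Im (psum a (of_real r * cis t)) = (\<Sum>n. sin (real n * t) *\<^sub>R (r ^ n * a n))"
proof -
  have "(\<lambda>n. of_real (a n) * (of_real r * cis t) ^ n) sums psum a (of_real r * cis t)"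
    using assms by (intro psum_sums) (auto simp: norm_mult)
  from sums_Re[OF this] sums_Im[OF this]
  show "Re (psum a (of_real r * cis t)) = (\<Sum>n. cos (real n * t) *\<^sub>R (r ^ n * a n))"
    "Im (psum a (of_real r * cis t)) = (\<Sum>n. sin (real n * t) *\<^sub>R (r ^ n * a n))"
    by (auto simp: sums_iff mult_ac power_mult_distrib Complex.DeMoivre simp flip: of_real_power)
qed

text \<open>For \<open>R < 1\<close> the dilate \<open>F\<close> is holomorphic beyond the closed
  disc, so the maximal estimate applies at level \<open>l / 250\<close>. Its integral over the
  circle is at most \<open>2 * pi * \<eta>\<close>: integrate
  \<open>x <= x^2 / (2 * \<eta>) + \<eta> / 2\<close> and use Parseval. The constant is
  \<open>15 * 250 * 2 = 7500\<close>.\<close>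

lemma psum_maximal:
  assumes sm: "summable (\<lambda>n. (a n)\<^sup>2)" and \<eta>: "(\<Sum>n. (a n)\<^sup>2) \<le> \<eta>\<^sup>2" "0 < \<eta>" and R: "0 \<le> R" "R < 1" and l: "0 < l"
  shows "emeasure lborel {t \<in> {0..2*pi}. \<exists>\<rho>. 0 \<le> \<rho> \<and> \<rho> < R \<and> l < norm (psum a (of_real \<rho> * cis t))}
     \<le> ennreal (7500 * pi * \<eta> / l)"
proof (cases "R = 0")
  case False
  define F where "F = (\<lambda>z. psum a (of_real R * z))"
  have sub: "of_real R * z \<in> ball 0 1" if "z \<in> cball 0 1" for z :: complex
  proof -
    have "R * norm z \<le> R * 1" using that R by (intro mult_left_mono) auto
    then show ?thesis using R by (simp add: norm_mult)
  qed
  have hol: "F holomorphic_on (ball 0 (1/R))"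
  proof -
    have "(psum a \<circ> (\<lambda>z. of_real R * z)) holomorphic_on ball 0 (1/R)"
      by (rule holomorphic_on_compose_gen[OF _ psum_holomorphic[OF sm]])
         (use R False in \<open>auto intro!: holomorphic_intros simp: norm_mult pos_less_divide_eq mult.commute\<close>)
    then show ?thesis by (simp add: F_def comp_def)
  qed
  have sub2: "cball 0 1 \<subseteq> ball (0::complex) (1/R)"
    using R False sub by (auto simp: norm_mult pos_less_divide_eq mult.commute)
  have cont: "continuous_on (cball 0 1) F"
    by (rule continuous_on_subset[OF holomorphic_on_imp_continuous_on[OF hol] sub2])
  have hol1: "F holomorphic_on ball 0 1"
    using hol by (rule holomorphic_on_subset) (use sub2 ball_subset_cball in blast)
  have eqF: "(norm (F (cis v)))\<^sup>2 = (norm (\<Sum>n. cos (real n * v) *\<^sub>R (R ^ n * a n)))\<^sup>2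
      + (norm (\<Sum>n. sin (real n * v) *\<^sub>R (R ^ n * a n)))\<^sup>2" for v
    unfolding F_def cmod_power2 psum_polar[OF sm R] by simp
  have smR: "summable (\<lambda>n. norm (R ^ n * a n))"
    using square_summable_power[of a R] sm R by (simp add: abs_mult)
  have P: "((\<lambda>v. (norm (F (cis v)))\<^sup>2) has_integral (2 * pi * (\<Sum>n. (R ^ n * a n)\<^sup>2))) {0..2*pi}"
    using trig_parseval[OF smR, of 2] unfolding eqF by simp
  have le: "(\<Sum>n. (R ^ n * a n)\<^sup>2) \<le> \<eta>\<^sup>2"
  proof -
    have *: "(R ^ n * a n)\<^sup>2 \<le> (a n)\<^sup>2" for n
    proof -
      have "(R ^ n)\<^sup>2 \<le> 1" using R by (simp add: power_le_one)
      then show ?thesis unfolding power_mult_distrib by (simp add: mult_left_le_one_le)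
    qed
    have "(\<Sum>n. (R ^ n * a n)\<^sup>2) \<le> (\<Sum>n. (a n)\<^sup>2)"
      by (rule suminf_le[OF * summable_comparison_test'[OF sm, of 0] sm]) (use * in auto)
    then show ?thesis using \<eta> by simp
  qed
  have cF: "continuous_on {0..2*pi} (\<lambda>v. norm (F (cis v)))"
  proof -
    have "continuous_on {0..2*pi} (\<lambda>u. F (cis u))"
      by (rule continuous_on_compose2[OF cont]) (auto intro!: continuous_intros)
    then show ?thesis by (intro continuous_intros)
  qed
  have int: "integral {0..2*pi} (\<lambda>v. norm (F (cis v))) \<le> 2 * pi * \<eta>"
  proof -
    have I: "((\<lambda>v. (norm (F (cis v)))\<^sup>2 * (1 / (2 * \<eta>)) + \<eta> / 2) has_integral
       (2 * pi * (\<Sum>n. (R ^ n * a n)\<^sup>2) * (1 / (2 * \<eta>)) + 2 * pi * (\<eta> / 2))) {0..2*pi}"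
      using has_integral_add[OF has_integral_mult_left[OF P, of "1 / (2 * \<eta>)"] has_integral_const_real[of "\<eta>/2" 0 "2*pi"]]
      by simp
    have "integral {0..2*pi} (\<lambda>v. norm (F (cis v))) \<le> integral {0..2*pi} (\<lambda>v. (norm (F (cis v)))\<^sup>2 * (1 / (2 * \<eta>)) + \<eta> / 2)"
    proof (rule integral_le)
      fix v
      have "0 \<le> (norm (F (cis v)) - \<eta>)\<^sup>2" by simp
      then show "norm (F (cis v)) \<le> (norm (F (cis v)))\<^sup>2 * (1 / (2 * \<eta>)) + \<eta> / 2"
        using \<eta> by (simp add: power2_diff field_simps power2_eq_square)
    qed (use cF I in \<open>auto intro: integrable_continuous_interval has_integral_integrable\<close>)
    also have "\<dots> = 2 * pi * (\<Sum>n. (R ^ n * a n)\<^sup>2) * (1 / (2 * \<eta>)) + 2 * pi * (\<eta> / 2)"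
      using I by (rule integral_unique)
    also have "\<dots> \<le> 2 * pi * \<eta>\<^sup>2 * (1 / (2 * \<eta>)) + 2 * pi * (\<eta> / 2)"
      using le \<eta> by (intro add_right_mono mult_right_mono mult_left_mono) auto
    also have "\<dots> = 2 * pi * \<eta>" using \<eta> by (simp add: power2_eq_square field_simps)
    finally show ?thesis .
  qed
  have "0 < l / 250" using l by simp
  from radial_maximal_estimate[OF cont hol1 this int] obtain E where E:
    "E \<in> sets borel" "emeasure lborel E \<le> ennreal (15 / (l / 250) * (2 * pi * \<eta>))"
    "\<And>t \<rho>. t \<in> {0..2*pi} \<Longrightarrow> t \<notin> E \<Longrightarrow> 0 \<le> \<rho> \<Longrightarrow> \<rho> < 1 \<Longrightarrow> norm (F (of_real \<rho> * cis t)) \<le> 250 * (l / 250)"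
    by blast
  have "emeasure lborel {t \<in> {0..2*pi}. \<exists>\<rho>. 0 \<le> \<rho> \<and> \<rho> < R \<and> l < norm (psum a (of_real \<rho> * cis t))} \<le> emeasure lborel E"
  proof (rule emeasure_mono)
    show "{t \<in> {0..2*pi}. \<exists>\<rho>. 0 \<le> \<rho> \<and> \<rho> < R \<and> l < norm (psum a (of_real \<rho> * cis t))} \<subseteq> E"
    proof (clarify, rule ccontr)
      fix t \<rho> assume t: "t \<in> {0..2*pi}" "0 \<le> \<rho>" "\<rho> < R" "l < norm (psum a (of_real \<rho> * cis t))" "t \<notin> E"
      then have "norm (F (of_real (\<rho> / R) * cis t)) \<le> l"
        using E(3)[of t "\<rho> / R"] R by (simp add: divide_simps)
      then show False using t False by (simp add: F_def)
    qed
  qed (use E in auto)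
  then show ?thesis using E(2) l by (auto simp: mult_ac intro: order_trans)
next
  case True
  then have "{t \<in> {0..2*pi}. \<exists>\<rho>. 0 \<le> \<rho> \<and> \<rho> < R \<and> l < norm (psum a (of_real \<rho> * cis t))} = {}" by auto
  then show ?thesis by (simp only: emeasure_empty zero_le)
qed

text \<open>The bound does not depend on \<open>R\<close>, so continuity from below lets
  \<open>R\<close> tend to 1. Measurability survives the uncountable union over radii because each
  radius contributes a set that is open in \<open>t\<close>.\<close>

lemma psum_maximal_set:
  assumes sm: "summable (\<lambda>n. (a n)\<^sup>2)" and \<eta>: "(\<Sum>n. (a n)\<^sup>2) \<le> \<eta>\<^sup>2" "0 < \<eta>" and l: "0 < l"
  defines "B \<equiv> {t \<in> {0..2*pi}. \<exists>\<rho>. 0 \<le> \<rho> \<and> \<rho> < 1 \<and> l < norm (psum a (of_real \<rho> * cis t))}"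
  shows "B \<in> sets borel" "emeasure lborel B \<le> ennreal (7500 * pi * \<eta> / l)"
proof -
  define C where "C R = {t \<in> {0..2*pi}. \<exists>\<rho>. 0 \<le> \<rho> \<and> \<rho> < R \<and> l < norm (psum a (of_real \<rho> * cis t))}" for R
  define r where "r m = 1 - 1 / real (Suc m)" for m
  have r: "0 \<le> r m" "r m < 1" for m by (auto simp: r_def)
  have ex: "\<exists>m. \<rho> < r m" if "\<rho> < 1" for \<rho> :: real
    using reals_Archimedean[of "1 - \<rho>"] that by (auto simp: r_def inverse_eq_divide algebra_simps)
  have meas: "C R \<in> sets borel" if "R \<le> 1" for R
  proof -
    have "C R = {0..2*pi} \<inter> (\<Union>\<rho>\<in>{0..<R}. {t. l < norm (psum a (of_real \<rho> * cis t))})"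
      by (auto simp: C_def)
    moreover have op: "open {t. l < norm (psum a (of_real \<rho> * cis t))}" if "\<rho> \<in> {0..<R}" for \<rho>
    proof (rule open_Collect_less)
      have "continuous_on UNIV (\<lambda>t. psum a (of_real \<rho> * cis t))"
        by (rule continuous_on_compose2[OF holomorphic_on_imp_continuous_on[OF psum_holomorphic[OF sm]]])
           (use that \<open>R \<le> 1\<close> in \<open>auto intro!: continuous_intros simp: norm_mult\<close>)
      then show "continuous_on UNIV (\<lambda>t. norm (psum a (of_real \<rho> * cis t)))" by (intro continuous_intros)
    qed (intro continuous_intros)
    have "open (\<Union>\<rho>\<in>{0..<R}. {t. l < norm (psum a (of_real \<rho> * cis t))})" using op by blast
    then have "{0..2*pi} \<inter> (\<Union>\<rho>\<in>{0..<R}. {t. l < norm (psum a (of_real \<rho> * cis t))}) \<in> sets borel"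
      by (intro sets.Int) (auto intro: borel_open)
    ultimately show ?thesis by (simp only:)
  qed
  have B: "B = (\<Union>m. C (r m))"
  proof (intro set_eqI iffI)
    fix t assume "t \<in> B"
    then obtain \<rho> where \<rho>: "t \<in> {0..2*pi}" "0 \<le> \<rho>" "\<rho> < 1" "l < norm (psum a (of_real \<rho> * cis t))"
      unfolding B_def by blast
    obtain m where "\<rho> < r m" using ex[OF \<rho>(3)] by blast
    then have "t \<in> C (r m)" unfolding C_def using \<rho> by blast
    then show "t \<in> (\<Union>m. C (r m))" by blast
  next
    fix t assume "t \<in> (\<Union>m. C (r m))"
    then obtain m \<rho> where "t \<in> {0..2*pi}" "0 \<le> \<rho>" "\<rho> < r m" "l < norm (psum a (of_real \<rho> * cis t))"
      unfolding C_def by blast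
    then show "t \<in> B" unfolding B_def using r(2)[of m] by (auto intro!: exI[of _ \<rho>])
  qed
  then show "B \<in> sets borel" using meas r(2) by (auto intro: less_imp_le)
  have "incseq (\<lambda>m. C (r m))"
  proof (rule incseq_SucI)
    fix m
    have "r m \<le> r (Suc m)" by (simp add: r_def field_simps)
    then show "C (r m) \<subseteq> C (r (Suc m))" by (auto simp: C_def)
  qed
  then have "emeasure lborel B = (SUP m. emeasure lborel (C (r m)))"
    unfolding B using meas r(2) by (subst SUP_emeasure_incseq) (auto intro: less_imp_le)
  also have "\<dots> \<le> ennreal (7500 * pi * \<eta> / l)"
    unfolding C_def by (intro SUP_least psum_maximal assms r)
  finally show "emeasure lborel B \<le> ennreal (7500 * pi * \<eta> / l)" .
qed

text \<open>A finite head of the series has a limit everywhere, and a tail with small square sum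
  exceeds \<open>1 / (j + 1)\<close> somewhere on a radius only for a small set of angles. Outside a
  null set every \<open>j\<close> therefore admits a tail that is uniformly small on the radius,
  which makes the radial values Cauchy.\<close>

theorem fatou_radial_limit:
  assumes sm: "summable (\<lambda>n. (a n)\<^sup>2)"
  shows "AE t in lborel. t \<in> {0..2*pi} \<longrightarrow> (\<exists>L. ((\<lambda>r. psum a (of_real r * cis t)) \<longlongrightarrow> L) (at_left 1))"
proof -
  define tl where "tl N n = (if n < N then 0 else a n)" for N n
  define hd where "hd N n = (if n < N then a n else 0)" for N n
  have sm_tl: "summable (\<lambda>n. (tl N n)\<^sup>2)" for N
    by (rule summable_comparison_test'[OF sm, of 0]) (auto simp: tl_def)
  have sm_hd: "summable (\<lambda>n. (hd N n)\<^sup>2)" for N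
    by (rule summable_comparison_test'[OF sm, of 0]) (auto simp: hd_def)
  define B where "B j N = {t \<in> {0..2*pi}. \<exists>\<rho>. 0 \<le> \<rho> \<and> \<rho> < 1 \<and> 1 / real (Suc j) < norm (psum (tl N) (of_real \<rho> * cis t))}" for j N
  have small: "\<exists>N. emeasure lborel (B j N) \<le> ennreal e" if "0 < e" for j and e :: real
  proof -
    \<comment> \<open>Chosen so that the maximal bound at level \<open>1 / (j + 1)\<close> becomes
      exactly \<open>e\<close>.\<close>
    define \<eta> where "\<eta> = e / (7500 * pi * real (Suc j))"
    have \<eta>: "0 < \<eta>" using that by (simp add: \<eta>_def)
    have "\<exists>N. \<forall>n\<ge>N. norm (\<Sum>i. (a (i + n))\<^sup>2) < \<eta>\<^sup>2"
      by (rule suminf_exist_split[OF _ sm]) (use \<eta> in auto)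
    then obtain N where "norm (\<Sum>i. (a (i + N))\<^sup>2) < \<eta>\<^sup>2" by blast
    then have N: "(\<Sum>i. (a (i + N))\<^sup>2) < \<eta>\<^sup>2" by simp
    have "(\<Sum>n. (tl N n)\<^sup>2) = (\<Sum>i. (tl N (i + N))\<^sup>2) + (\<Sum>i<N. (tl N i)\<^sup>2)"
      using suminf_split_initial_segment[OF sm_tl[of N], of N] by simp
    also have "\<dots> = (\<Sum>i. (a (i + N))\<^sup>2)" by (simp add: tl_def)
    finally have "(\<Sum>n. (tl N n)\<^sup>2) \<le> \<eta>\<^sup>2" using N by simp
    from psum_maximal_set(2)[OF sm_tl this \<eta>, of "1 / real (Suc j)"]
    have "emeasure lborel {t \<in> {0..2*pi}. \<exists>\<rho>. 0 \<le> \<rho> \<and> \<rho> < 1 \<and> 1 / real (Suc j) < norm (psum (tl N) (of_real \<rho> * cis t))}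
       \<le> ennreal (7500 * pi * \<eta> / (1 / real (Suc j)))" by simp
    moreover have "7500 * pi * \<eta> / (1 / real (Suc j)) = e" by (simp add: \<eta>_def del: of_nat_Suc)
    ultimately show ?thesis unfolding B_def by (intro exI[of _ N]) (simp only:)
  qed
  have Bm: "B j N \<in> sets borel" for j N
  proof -
    have "(\<Sum>n. (tl N n)\<^sup>2) \<le> (sqrt (\<Sum>n. (tl N n)\<^sup>2) + 1)\<^sup>2"
      using suminf_nonneg[OF sm_tl[of N]] by (simp add: power2_sum)
    then show ?thesis unfolding B_def
      using suminf_nonneg[OF sm_tl[of N]] by (intro psum_maximal_set(1)[OF sm_tl]) (auto simp: add_nonneg_pos)
  qed
  have null: "(\<Union>j. \<Inter>N. B j N) \<in> null_sets lborel"
  proof (intro null_sets_UN)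
    fix j
    have "emeasure lborel (\<Inter>N. B j N) \<le> ennreal e" if e: "0 < e" for e
    proof -
      obtain N where "emeasure lborel (B j N) \<le> ennreal e" using small[OF e] by blast
      moreover have "emeasure lborel (\<Inter>N. B j N) \<le> emeasure lborel (B j N)"
        using Bm by (intro emeasure_mono) auto
      ultimately show ?thesis by simp
    qed
    then have "emeasure lborel (\<Inter>N. B j N) = 0"
      by (metis ennreal_le_epsilon add_0 le_zero_eq)
    then show "(\<Inter>N. B j N) \<in> null_sets lborel" using Bm by (auto intro!: null_setsI)
  qed
  show ?thesis
  proof (rule AE_I'[OF null], clarify, rule ccontr)
    fix t assume t: "t \<in> {0..2*pi}" and nl: "\<nexists>L. ((\<lambda>r. psum a (of_real r * cis t)) \<longlongrightarrow> L) (at_left 1)"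
      and "t \<notin> (\<Union>j. \<Inter>N. B j N)"
    then have *: "\<exists>N. \<forall>\<rho>. 0 \<le> \<rho> \<and> \<rho> < 1 \<longrightarrow> norm (psum (tl N) (of_real \<rho> * cis t)) \<le> 1 / real (Suc j)" for j
    proof -
      obtain N where "t \<notin> B j N" using \<open>t \<notin> (\<Union>j. \<Inter>N. B j N)\<close> by blast
      then show ?thesis using t unfolding B_def by (intro exI[of _ N]) (simp only: mem_Collect_eq not_less not_ex de_Morgan_conj, meson not_le)
    qed
    let ?F = "filtermap (\<lambda>r. psum a (of_real r * cis t)) (at_left 1)"
    have "cauchy_filter ?F"
      unfolding cauchy_filter_metric
    proof (intro allI impI)
      fix e :: real assume e: "0 < e"
      obtain j where j: "1 / real (Suc j) < e / 4" using reals_Archimedean[of "e/4"] e by (auto simp: inverse_eq_divide)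
      obtain N where N: "norm (psum (tl N) (of_real \<rho> * cis t)) \<le> 1 / real (Suc j)" if "0 \<le> \<rho>" "\<rho> < 1" for \<rho>
        using *[of j] by blast
      have split: "psum a z = psum (hd N) z + psum (tl N) z" if "norm z < 1" for z
      proof (rule sums_unique2[OF psum_sums[OF sm that]])
        have "of_real (a n) * z ^ n = of_real (hd N n) * z ^ n + of_real (tl N n) * z ^ n" for n
          by (simp add: hd_def tl_def)
        then show "(\<lambda>n. of_real (a n) * z ^ n) sums (psum (hd N) z + psum (tl N) z)"
          using sums_add[OF psum_sums[OF sm_hd[of N] that] psum_sums[OF sm_tl[of N] that]] by presburger
      qed
      have fin: "psum (hd N) z = (\<Sum>n<N. of_real (a n) * z ^ n)" for z
        unfolding psum_def by (subst suminf_finite[of "{..<N}"]) (auto simp: hd_def)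
      define L where "L = (\<Sum>n<N. of_real (a n) * (of_real 1 * cis t) ^ n)"
      have "((\<lambda>r. \<Sum>n<N. of_real (a n) * (of_real r * cis t) ^ n) \<longlongrightarrow> L) (at_left 1)"
        unfolding L_def by (intro tendsto_intros)
      then have "\<forall>\<^sub>F r in at_left 1. dist (psum (hd N) (of_real r * cis t)) L < e / 4"
        unfolding fin using e by (intro tendstoD) auto
      moreover have "\<forall>\<^sub>F r in at_left (1::real). r < 1" by (simp add: eventually_at_filter)
      moreover have "\<forall>\<^sub>F r in at_left (1::real). 0 < r" by (rule eventually_at_left_real[of 0, THEN eventually_mono]) auto
      ultimately have "\<forall>\<^sub>F r in at_left 1. dist (psum a (of_real r * cis t)) L < e / 2"
      proof eventually_elim
        case (elim r)
        have "psum a (of_real r * cis t) - L = (psum (hd N) (of_real r * cis t) - L) + psum (tl N) (of_real r * cis t)"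
          using elim by (subst split) (auto simp: norm_mult)
        also have "norm \<dots> \<le> norm (psum (hd N) (of_real r * cis t) - L) + norm (psum (tl N) (of_real r * cis t))"
          by (rule norm_triangle_ineq)
        also have "\<dots> < e / 4 + e / 4"
          using elim N[of r] j by (intro add_strict_mono) (auto simp: dist_norm)
        finally show ?case by (simp add: dist_norm)
      qed
      then have "\<forall>\<^sub>F x in ?F. dist x L < e / 2" by (simp add: eventually_filtermap)
      moreover have "dist x y < e" if "dist x L < e / 2 \<and> dist y L < e / 2" for x y :: complex
        using that dist_triangle_half_l[of x L e y] by (simp add: dist_commute)
      ultimately show "\<exists>P. eventually P ?F \<and> (\<forall>x y. P x \<and> P y \<longrightarrow> dist x y < e)" by blast
    qed
    then obtain L where "?F \<le> nhds L"
      using cauchy_filter_complete_converges[of ?F UNIV] complete_UNIV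
      by (auto simp: filtermap_bot_iff trivial_limit_at_left_real)
    then show False using nl by (auto simp: filterlim_def)
  qed
qed

section \<open>The Wold decomposition\<close>

text \<open>A minimizing sequence for the distance is Cauchy by the parallelogram law. Its limit is
  compared with its perturbations along \<open>c\<close>, the optimal multiple being
  \<open>s\<close>; this forces the inner product to vanish.\<close>

lemma orthogonal_projection_exists:
  fixes C :: "'h::{real_inner, banach} set"
  assumes "closed C" "subspace C"
  shows "\<exists>y\<in>C. \<forall>c\<in>C. (f - y) \<bullet> c = 0"
proof -
  define \<delta> where "\<delta> = (INF y\<in>C. (norm (f - y))\<^sup>2)"
  have C0: "0 \<in> C" using assms(2) by (rule subspace_0)
  have bdd: "bdd_below ((\<lambda>y. (norm (f - y))\<^sup>2) ` C)" by (auto intro!: bdd_belowI[of _ 0])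
  have le: "\<delta> \<le> (norm (f - y))\<^sup>2" if "y \<in> C" for y
    unfolding \<delta>_def using bdd that by (rule cINF_lower)
  have "\<exists>y\<in>C. (norm (f - y))\<^sup>2 < \<delta> + 1 / real (Suc n)" for n
  proof -
    have "(INF y\<in>C. (norm (f - y))\<^sup>2) < \<delta> + 1 / real (Suc n)" by (simp add: \<delta>_def)
    then show ?thesis using cINF_less_iff[OF _ bdd] C0 by blast
  qed
  then obtain y where y: "y n \<in> C" "(norm (f - y n))\<^sup>2 < \<delta> + 1 / real (Suc n)" for n by metis
  have par: "(norm (y m - y n))\<^sup>2 \<le> 2 / real (Suc m) + 2 / real (Suc n)" for m n
  proof -
    have "(1/2) *\<^sub>R (y m + y n) \<in> C" using assms(2) y(1) by (intro subspace_scale subspace_add)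
    from le[OF this] have "4 * \<delta> \<le> 4 * (norm (f - (1/2) *\<^sub>R (y m + y n)))\<^sup>2" by simp
    also have "4 * (norm (f - (1/2) *\<^sub>R (y m + y n)))\<^sup>2 = 2 * (norm (f - y m))\<^sup>2 + 2 * (norm (f - y n))\<^sup>2 - (norm (y m - y n))\<^sup>2"
      unfolding power2_norm_eq_inner by (simp add: algebra_simps inner_commute)
    finally show ?thesis using y(2)[of m] y(2)[of n] by simp
  qed
  have "Cauchy y"
  proof (rule metric_CauchyI)
    fix e :: real assume e: "0 < e"
    obtain N where N: "4 / real (Suc N) < e\<^sup>2"
      using reals_Archimedean[of "e\<^sup>2 / 4"] e by (auto simp: inverse_eq_divide)
    show "\<exists>M. \<forall>m\<ge>M. \<forall>n\<ge>M. dist (y m) (y n) < e"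
    proof (intro exI[of _ N] allI impI)
      fix m n assume "N \<le> m" "N \<le> n"
      then have "2 / real (Suc m) \<le> 2 / real (Suc N)" "2 / real (Suc n) \<le> 2 / real (Suc N)"
        by (auto intro!: divide_left_mono)
      then have "(norm (y m - y n))\<^sup>2 < e\<^sup>2" using par[of m n] N by linarith
      then show "dist (y m) (y n) < e" using e by (simp add: dist_norm power_less_imp_less_base)
    qed
  qed
  then obtain l where l: "y \<longlonglongrightarrow> l" using Cauchy_convergent convergent_def by blast
  have lC: "l \<in> C" using closed_sequentially[OF assms(1) y(1) l] .
  have "(\<lambda>n. (norm (f - y n))\<^sup>2) \<longlonglongrightarrow> (norm (f - l))\<^sup>2" by (intro tendsto_intros l)
  moreover have "(\<lambda>n. \<delta> + 1 / real (Suc n)) \<longlonglongrightarrow> \<delta> + 0"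
    by (intro tendsto_intros LIMSEQ_Suc[OF lim_1_over_n])
  ultimately have min: "(norm (f - l))\<^sup>2 \<le> \<delta>"
    by (rule_tac LIMSEQ_le[of _ _ "\<lambda>n. \<delta> + 1 / real (Suc n)"]) (use y(2) in \<open>auto intro: less_imp_le\<close>)
  have "(f - l) \<bullet> c = 0" if c: "c \<in> C" for c
  proof (cases "c = 0")
    case False
    define s where "s = ((f - l) \<bullet> c) / (c \<bullet> c)"
    have "l + s *\<^sub>R c \<in> C" using assms(2) lC c by (intro subspace_scale subspace_add)
    from order_trans[OF min le[OF this]] have "(norm (f - l))\<^sup>2 \<le> (norm (f - l - s *\<^sub>R c))\<^sup>2"
      by (simp only: diff_diff_eq)
    also have "\<dots> = (norm (f - l))\<^sup>2 - 2 * s * ((f - l) \<bullet> c) + s * s * (c \<bullet> c)"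
      unfolding power2_norm_eq_inner by (simp add: algebra_simps inner_commute)
    also have "s * s * (c \<bullet> c) = s * ((f - l) \<bullet> c)" using False by (simp add: s_def)
    finally have "s * ((f - l) \<bullet> c) \<le> 0" by simp
    then have "((f - l) \<bullet> c)\<^sup>2 / (c \<bullet> c) \<le> 0" by (simp add: s_def power2_eq_square)
    moreover have "0 < c \<bullet> c" using False by simp
    ultimately have "((f - l) \<bullet> c)\<^sup>2 \<le> 0" by (simp add: divide_le_0_iff)
    then show ?thesis by simp
  qed simp
  then show ?thesis using lC by blast
qed

section \<open>Pure isometries commuting with a division algebra of scalars\<close>

text \<open>Two instances are needed: quaternionic sequences with quaternion scalars, and pairs of a
  quaternionic and a real sequence with real scalars. Only a real inner product is available; the
  multiplicative norm of the action compensates for a quaternion-valued one, since a nonzero scalar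
  can be moved across the inner product at the cost of a positive factor.\<close>

locale shift_module =
  fixes S :: "'h \<Rightarrow> 'h::{real_inner, banach}"
    and act :: "'d::{real_normed_div_algebra, banach} \<Rightarrow> 'h \<Rightarrow> 'h"
  assumes S_add: "S (x + y) = S x + S y"
    and S_scaleR: "S (r *\<^sub>R x) = r *\<^sub>R S x"
    and norm_S: "norm (S x) = norm x"
    and act_add_left: "act (c + d) x = act c x + act d x"
    and act_add_right: "act c (x + y) = act c x + act c y"
    and act_act: "act c (act d x) = act (c * d) x"
    and act_of_real: "act (of_real r) x = r *\<^sub>R x"
    and norm_act: "norm (act c x) = norm c * norm x"
    and S_act: "S (act c x) = act c (S x)"
    and pure: "(\<And>n. \<exists>y. x = (S ^^ n) y) \<Longrightarrow> x = 0"
begin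

lemma act_1: "act 1 x = x" using act_of_real[of 1] by simp
lemma act_0: "act 0 x = 0" using act_of_real[of 0] by simp

lemma act_scaleR: "act c (r *\<^sub>R x) = r *\<^sub>R act c x"
  unfolding act_of_real[symmetric] act_act by (simp add: of_real_def)

lemma act_scaleR_left: "act (r *\<^sub>R c) x = r *\<^sub>R act c x"
  unfolding act_of_real[symmetric] act_act by (simp add: of_real_def)

lemma linear_S: "linear S" by (rule linearI) (simp_all add: S_add S_scaleR)
lemma linear_act: "linear (act c)" by (rule linearI) (simp_all add: act_add_right act_scaleR)

lemma act_diff_left: "act (c - d) x = act c x - act d x"
  using act_add_left[of "c - d" d x] by simp

lemma bounded_linear_S: "bounded_linear S"
  by (rule bounded_linear_intro[of _ 1]) (simp_all add: S_add S_scaleR norm_S)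

lemma bounded_linear_act: "bounded_linear (act c)"
  by (rule bounded_linear_intro[of _ "norm c"]) (simp_all add: act_add_right act_scaleR norm_act)

lemma inner_S: "S x \<bullet> S y = x \<bullet> y"
proof -
  have "(norm (S (x + y)))\<^sup>2 = (norm (x + y))\<^sup>2" by (simp add: norm_S)
  then have "(norm (S x))\<^sup>2 + 2 * (S x \<bullet> S y) + (norm (S y))\<^sup>2 = (norm x)\<^sup>2 + 2 * (x \<bullet> y) + (norm y)\<^sup>2"
    by (simp add: S_add power2_norm_eq_inner algebra_simps inner_commute)
  then show ?thesis by (simp add: norm_S)
qed

lemma inner_act: "act c x \<bullet> act c y = (norm c)\<^sup>2 * (x \<bullet> y)"
proof -
  have "(norm (act c (x + y)))\<^sup>2 = (norm c)\<^sup>2 * (norm (x + y))\<^sup>2" by (simp add: norm_act power_mult_distrib)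
  then have "(norm (act c x))\<^sup>2 + 2 * (act c x \<bullet> act c y) + (norm (act c y))\<^sup>2
     = (norm c)\<^sup>2 * (norm x)\<^sup>2 + 2 * ((norm c)\<^sup>2 * (x \<bullet> y)) + (norm c)\<^sup>2 * (norm y)\<^sup>2"
    by (simp add: act_add_right power2_norm_eq_inner algebra_simps inner_commute)
  then show ?thesis by (simp add: norm_act power_mult_distrib)
qed

lemma funpow_S: "linear (S ^^ n)" "norm ((S ^^ n) x) = norm x" "(S ^^ n) x \<bullet> (S ^^ n) y = x \<bullet> y"
  "(S ^^ n) (act c x) = act c ((S ^^ n) x)"
proof (induction n arbitrary: x y)
  case (Suc n)
  { case 1 show ?case using linear_compose[OF Suc(1) linear_S] by (simp add: comp_def) }
  { case 2 show ?case using Suc(2) by (simp add: norm_S) }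
  { case 3 show ?case using Suc(3) by (simp add: inner_S) }
  { case 4 show ?case using Suc(4) by (simp add: S_act) }
qed (auto intro: linear_id)

text \<open>The polynomial with coefficients \<open>p\<close> below \<open>N\<close>, evaluated at
  the shift and applied to \<open>x\<close>; for sequences it is the product of the truncated series
  with \<open>x\<close>.\<close>

definition comb :: "nat \<Rightarrow> (nat \<Rightarrow> 'd) \<Rightarrow> 'h \<Rightarrow> 'h" where
  "comb N p x = (\<Sum>k<N. (S ^^ k) (act (p k) x))"

lemma comb_Suc_shift: "comb (Suc N) p x = act (p 0) x + S (comb N (\<lambda>k. p (Suc k)) x)"
  unfolding comb_def sum.lessThan_Suc_shift linear_sum[OF linear_S] by simp

lemma comb_mono: "N \<le> M \<Longrightarrow> comb M (\<lambda>k. if k < N then p k else 0) x = comb N p x"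
  unfolding comb_def
proof (rule sum.mono_neutral_cong_right)
  show "\<forall>i\<in>{..<M} - {..<N}. (S ^^ i) (act (if i < N then p i else 0) x) = 0"
    unfolding act_0 by (simp add: act_0 linear_0[OF funpow_S(1)])
qed auto

lemma comb_add: "comb N p x + comb N q x = comb N (\<lambda>k. p k + q k) x"
  unfolding comb_def act_add_left linear_add[OF funpow_S(1)] sum.distrib ..

lemma comb_act: "act c (comb N p x) = comb N (\<lambda>k. c * p k) x"
  unfolding comb_def linear_sum[OF linear_act] funpow_S(4)[symmetric] act_act ..

lemma comb_S: "S (comb N p x) = comb (Suc N) (\<lambda>k. case k of 0 \<Rightarrow> 0 | Suc k \<Rightarrow> p k) x"
  unfolding comb_Suc_shift by (simp add: act_0)

definition cyc :: "'h \<Rightarrow> 'h set" where "cyc x = {comb N p x | N p. True}"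

lemma subspace_cyc: "subspace (cyc x)"
proof (rule subspaceI)
  show "0 \<in> cyc x" unfolding cyc_def comb_def by (auto intro!: exI[of _ 0])
next
  fix y z assume "y \<in> cyc x" "z \<in> cyc x"
  then obtain N p M q where "y = comb N p x" "z = comb M q x" unfolding cyc_def by blast
  then have "y = comb (max N M) (\<lambda>k. if k < N then p k else 0) x" "z = comb (max N M) (\<lambda>k. if k < M then q k else 0) x"
    using comb_mono[of N "max N M" p x] comb_mono[of M "max N M" q x] by auto
  then show "y + z \<in> cyc x" unfolding cyc_def using comb_add by blast
next
  fix c y assume "y \<in> cyc x"
  then show "c *\<^sub>R y \<in> cyc x" unfolding cyc_def act_of_real[symmetric] using comb_act by blast
qed

lemma act_cyc: "y \<in> cyc x \<Longrightarrow> act c y \<in> cyc x"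
  unfolding cyc_def using comb_act by blast

lemma S_cyc: "y \<in> cyc x \<Longrightarrow> S y \<in> cyc x"
  unfolding cyc_def using comb_S by blast

lemma self_cyc: "x \<in> cyc x"
proof -
  have "x = comb 1 (\<lambda>_. 1) x" by (simp add: comb_def act_1)
  then show ?thesis unfolding cyc_def by blast
qed

lemma act_closure_cyc: "y \<in> closure (cyc x) \<Longrightarrow> act c y \<in> closure (cyc x)"
proof -
  assume "y \<in> closure (cyc x)"
  then obtain a where "\<And>n. a n \<in> cyc x" "a \<longlonglongrightarrow> y" unfolding closure_sequential by blast
  then show ?thesis unfolding closure_sequential
    by (intro exI[of _ "\<lambda>n. act c (a n)"]) (auto intro!: act_cyc bounded_linear.tendsto[OF bounded_linear_act])
qed

lemma S_closure_cyc: "y \<in> closure (cyc x) \<Longrightarrow> S y \<in> closure (cyc x)"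
proof -
  assume "y \<in> closure (cyc x)"
  then obtain a where "\<And>n. a n \<in> cyc x" "a \<longlonglongrightarrow> y" unfolding closure_sequential by blast
  then show ?thesis unfolding closure_sequential
    by (intro exI[of _ "\<lambda>n. S (a n)"]) (auto intro!: S_cyc bounded_linear.tendsto[OF bounded_linear_S])
qed

lemma subspace_closure_cyc: "subspace (closure (cyc x))"
proof (rule subspaceI)
  show "0 \<in> closure (cyc x)" using subspace_0[OF subspace_cyc] closure_subset by blast
next
  fix y z assume "y \<in> closure (cyc x)" "z \<in> closure (cyc x)"
  then obtain a b where "\<And>n. a n \<in> cyc x" "a \<longlonglongrightarrow> y" "\<And>n. b n \<in> cyc x" "b \<longlonglongrightarrow> z"
    unfolding closure_sequential by blast
  then show "y + z \<in> closure (cyc x)"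
    unfolding closure_sequential
    by (intro exI[of _ "\<lambda>n. a n + b n"]) (auto intro!: tendsto_add subspace_add[OF subspace_cyc])
next
  fix c y assume "y \<in> closure (cyc x)"
  then show "c *\<^sub>R y \<in> closure (cyc x)" using act_closure_cyc[of y x "of_real c"] by (simp add: act_of_real)
qed

lemma closed_S_image: assumes "closed K" shows "closed (S ` K)"
  unfolding closed_sequential_limits
proof (intro allI impI)
  fix x l assume "(\<forall>n. x n \<in> S ` K) \<and> x \<longlonglongrightarrow> l"
  then have ex: "\<forall>n. \<exists>y. x n = S y \<and> y \<in> K" and xl: "x \<longlonglongrightarrow> l" by blast+
  obtain y where y: "\<And>n. x n = S (y n)" "\<And>n. y n \<in> K" using choice[OF ex] by blast
  have "dist (x m) (x n) = dist (y m) (y n)" for m n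
    unfolding y dist_norm by (simp add: norm_S flip: linear_diff[OF linear_S])
  then have "Cauchy y" using LIMSEQ_imp_Cauchy[OF xl] by (simp add: Cauchy_def)
  then obtain k where k: "y \<longlonglongrightarrow> k" using Cauchy_convergent convergent_def by blast
  have "k \<in> K" using closed_sequentially[OF assms y(2) k] .
  moreover have "x \<longlonglongrightarrow> S k" unfolding y(1) using bounded_linear.tendsto[OF bounded_linear_S k] .
  ultimately show "l \<in> S ` K" using LIMSEQ_unique[OF xl] by blast
qed

text \<open>The constant term is orthogonal to everything in the shifted part, and the shift
  preserves norms, so Pythagoras applies at each induction step. Orthogonality is assumed for
  \<open>u\<close> itself and reaches \<open>act b u\<close> by moving \<open>b\<close> to the other
  side as its inverse.\<close>

lemma norm_comb_wandering:
  assumes "norm u = 1" and orth: "\<And>n c. u \<bullet> (S ^^ Suc n) (act c u) = 0"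
  shows "(norm (comb N p u))\<^sup>2 = (\<Sum>n<N. (norm (p n))\<^sup>2)"
proof (induction N arbitrary: p)
  case (Suc N)
  have "act b u \<bullet> S (comb N q u) = 0" for b q
  proof -
    have "act b u \<bullet> (S ^^ Suc n) (act c u) = 0" for n c
    proof (cases "b = 0")
      case False
      then have "act b (act (inverse b) ((S ^^ Suc n) (act c u))) = (S ^^ Suc n) (act c u)"
        by (simp add: act_act act_1)
      then have "act b u \<bullet> (S ^^ Suc n) (act c u) = (norm b)\<^sup>2 * (u \<bullet> act (inverse b) ((S ^^ Suc n) (act c u)))"
        by (metis inner_act)
      also have "act (inverse b) ((S ^^ Suc n) (act c u)) = (S ^^ Suc n) (act (inverse b * c) u)"
        by (simp only: funpow_S(4) act_act)
      finally show ?thesis using orth by simp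
    qed (simp add: act_0)
    then show ?thesis unfolding comb_def by (simp add: linear_sum[OF linear_S] inner_sum_right)
  qed
  then have "(norm (comb (Suc N) p u))\<^sup>2 = (norm (act (p 0) u))\<^sup>2 + (norm (S (comb N (\<lambda>k. p (Suc k)) u)))\<^sup>2"
    unfolding comb_Suc_shift
    by (simp add: power2_norm_eq_inner inner_add_left inner_add_right inner_commute)
  then show ?case using assms(1) Suc by (simp add: norm_act norm_S sum.lessThan_Suc_shift del: sum.lessThan_Suc)
qed (simp add: comb_def)

text \<open>A unit wandering vector turns coefficient sequences isometrically into vectors; later
  this isometry is multiplication by an inner series.\<close>

lemma comb_wandering_converges:
  assumes u: "norm u = 1" "\<And>n c. u \<bullet> (S ^^ Suc n) (act c u) = 0"
    and sm: "summable (\<lambda>n. (norm (p n))\<^sup>2)"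
  shows "\<exists>y. (\<lambda>N. comb N p u) \<longlonglongrightarrow> y \<and> (norm y)\<^sup>2 = (\<Sum>n. (norm (p n))\<^sup>2)"
proof -
  have tail: "(norm (comb M p u - comb N p u))\<^sup>2 = (\<Sum>n\<in>{N..<M}. (norm (p n))\<^sup>2)" if "N \<le> M" for M N
  proof -
    define q where "q k = (if k < N then 0 else p k)" for k
    have "comb M p u - comb N p u = (\<Sum>k\<in>{N..<M}. (S ^^ k) (act (p k) u))"
      unfolding comb_def using sum_diff_nat_ivl[of 0 N M "\<lambda>k. (S ^^ k) (act (p k) u)"] that
      by (simp add: atLeast0LessThan)
    also have "\<dots> = comb M q u"
      unfolding comb_def q_def
      by (rule sum.mono_neutral_cong_left) (auto simp: act_0 linear_0[OF funpow_S(1)])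
    finally have "(norm (comb M p u - comb N p u))\<^sup>2 = (\<Sum>n<M. (norm (q n))\<^sup>2)"
      using norm_comb_wandering[OF u] by simp
    also have "\<dots> = (\<Sum>n\<in>{N..<M}. (norm (p n))\<^sup>2)"
      unfolding q_def by (rule sum.mono_neutral_cong_right) auto
    finally show ?thesis .
  qed
  have "Cauchy (\<lambda>N. comb N p u)"
  proof (rule metric_CauchyI)
    fix e :: real assume e: "0 < e"
    then have "0 < e\<^sup>2" by simp
    then obtain N where N: "\<And>m n. N \<le> m \<Longrightarrow> norm (\<Sum>i\<in>{m..<n}. (norm (p i))\<^sup>2) < e\<^sup>2"
      using sm unfolding summable_Cauchy by blast
    have *: "dist (comb m p u) (comb n p u) < e" if "N \<le> n" "n \<le> m" for m n
    proof -
      have "(norm (comb m p u - comb n p u))\<^sup>2 < e\<^sup>2" using tail[OF that(2)] N[OF that(1), of m] by simp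
      then show ?thesis using e by (simp add: dist_norm power_less_imp_less_base)
    qed
    show "\<exists>M. \<forall>m\<ge>M. \<forall>n\<ge>M. dist (comb m p u) (comb n p u) < e"
    proof (intro exI[of _ N] allI impI)
      fix m n assume "N \<le> m" "N \<le> n"
      then show "dist (comb m p u) (comb n p u) < e"
        using *[of m n] *[of n m] by (cases "m \<le> n") (auto simp: dist_commute)
    qed
  qed
  then obtain y where y: "(\<lambda>N. comb N p u) \<longlonglongrightarrow> y" using Cauchy_convergent convergent_def by blast
  then have "(\<lambda>N. (norm (comb N p u))\<^sup>2) \<longlonglongrightarrow> (norm y)\<^sup>2" by (intro tendsto_intros)
  moreover have "(\<lambda>N. (norm (comb N p u))\<^sup>2) \<longlonglongrightarrow> (\<Sum>n. (norm (p n))\<^sup>2)"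
    unfolding norm_comb_wandering[OF u] by (rule summable_LIMSEQ[OF sm])
  ultimately show ?thesis using y LIMSEQ_unique by blast
qed

text \<open>Wold decomposition: the wandering subspace of a cyclic invariant subspace is one-dimensional.\<close>

theorem wold_beurling:
  assumes "f \<noteq> 0"
  obtains u d where "norm u = 1" "u \<in> closure (cyc f)"
    "\<And>n c. u \<bullet> (S ^^ Suc n) (act c u) = 0"
    "summable (\<lambda>n. (norm (d n))\<^sup>2)" "(\<lambda>N. comb N d u) \<longlonglongrightarrow> f"
proof -
  define K where "K = closure (cyc f)"
  define C where "C = S ` K"
  have K: "closed K" "subspace K" unfolding K_def by (auto simp: subspace_closure_cyc)
  have SK: "S y \<in> K" if "y \<in> K" for y using that unfolding K_def by (rule S_closure_cyc)
  have aK: "act c y \<in> K" if "y \<in> K" for y c using that unfolding K_def by (rule act_closure_cyc)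
  have fK: "f \<in> K" unfolding K_def using self_cyc closure_subset by blast
  have C: "closed C" "subspace C" unfolding C_def using K linear_S by (auto intro: closed_S_image linear_subspace_image)
  have CK: "C \<subseteq> K" unfolding C_def using SK by blast
  have aC: "act c y \<in> C" if "y \<in> C" for y c using that aK by (force simp: C_def S_act[symmetric])
  obtain y where y: "y \<in> C" "\<And>c. c \<in> C \<Longrightarrow> (f - y) \<bullet> c = 0"
    using orthogonal_projection_exists[OF C] by blast
  \<comment> \<open>The part of \<open>f\<close> orthogonal to the shifted subspace is the candidate
    for spanning the wandering subspace.\<close>
  define v where "v = f - y"
  have vK: "v \<in> K" using fK y(1) CK K(2) by (auto simp: v_def intro: subspace_diff)
  have vC: "v \<bullet> c = 0" if "c \<in> C" for c using y(2)[OF that] by (simp add: v_def)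
  have avC: "act b v \<bullet> c = 0" if "c \<in> C" for b c
  proof (cases "b = 0")
    case False
    then have "act b (act (inverse b) c) = c" by (simp add: act_act act_1)
    then have "act b v \<bullet> c = (norm b)\<^sup>2 * (v \<bullet> act (inverse b) c)" by (metis inner_act)
    then show ?thesis using vC[OF aC[OF that]] by simp
  qed (simp add: act_0)
  \<comment> \<open>Since \<open>f = v + y\<close> with \<open>y\<close> in \<open>C\<close>, every
    polynomial image of \<open>f\<close> lies in \<open>W\<close>. Once \<open>W\<close> is known to
    be closed it contains all of \<open>K\<close>, so one vector suffices for the wandering
    subspace.\<close>
  define W where "W = {act b v + c | b c. c \<in> C}"
  have LW: "cyc f \<subseteq> W"
  proof
    fix x assume "x \<in> cyc f"
    then obtain N p where x: "x = comb N p f" unfolding cyc_def by blast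
    show "x \<in> W"
    proof (cases N)
      case 0
      then have "x = act 0 v + 0" by (simp add: x comb_def act_0)
      then show ?thesis unfolding W_def using subspace_0[OF C(2)] by blast
    next
      case (Suc M)
      define z where "z = comb M (\<lambda>k. p (Suc k)) f"
      have "z \<in> K" unfolding K_def z_def using closure_subset by (force simp: cyc_def)
      have "x = act (p 0) f + S z" by (simp add: x Suc comb_Suc_shift z_def)
      also have "f = v + y" by (simp add: v_def)
      finally have "x = act (p 0) v + (act (p 0) y + S z)" by (simp add: act_add_right add.assoc)
      moreover have "act (p 0) y + S z \<in> C"
        using y(1) aC \<open>z \<in> K\<close> C(2) by (auto intro!: subspace_add simp: C_def)
      ultimately show ?thesis unfolding W_def by blast
    qed
  qed
  \<comment> \<open>Otherwise \<open>K\<close> would be contained in its own shift, hence in the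
    range of every power of the shift, contrary to purity.\<close>
  have v0: "v \<noteq> 0"
  proof
    assume "v = 0"
    then have "K \<subseteq> C"
      using LW closure_minimal[of "cyc f" C] C(1) by (auto simp: W_def K_def linear_0[OF linear_act])
    then have "\<exists>z\<in>K. x = (S ^^ n) z" if "x \<in> K" for x n
      using that
    proof (induction n)
      case (Suc n)
      then obtain z where "z \<in> K" "x = (S ^^ n) z" by blast
      moreover from this \<open>K \<subseteq> C\<close> obtain w where "w \<in> K" "z = S w" unfolding C_def by blast
      ultimately show ?case by (metis funpow_Suc_right comp_apply)
    qed auto
    then have "f = 0" using fK by (intro pure) blast
    then show False using assms by simp
  qed
  have Wcl: "closed W"
    unfolding closed_sequential_limits
  proof (intro allI impI)
    fix x l assume "(\<forall>n. x n \<in> W) \<and> x \<longlonglongrightarrow> l"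
    then have "\<forall>n. \<exists>b c. c \<in> C \<and> x n = act b v + c" and xl: "x \<longlonglongrightarrow> l" unfolding W_def by blast+
    then obtain b where "\<forall>n. \<exists>c. c \<in> C \<and> x n = act (b n) v + c" using choice[of "\<lambda>n b. \<exists>c. c \<in> C \<and> x n = act b v + c"] by blast
    then obtain c where bc: "\<And>n. c n \<in> C" "\<And>n. x n = act (b n) v + c n"
      using choice[of "\<lambda>n c. c \<in> C \<and> x n = act (b n) v + c"] by blast
    have "norm (b m - b n) * norm v \<le> norm (x m - x n)" for m n
    proof -
      have "x m - x n = act (b m - b n) v + (c m - c n)" by (simp add: bc act_diff_left)
      moreover have "act (b m - b n) v \<bullet> (c m - c n) = 0" using bc C(2) by (intro avC subspace_diff)
      ultimately have "(norm (x m - x n))\<^sup>2 = (norm (act (b m - b n) v))\<^sup>2 + (norm (c m - c n))\<^sup>2"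
        by (simp add: power2_norm_eq_inner inner_add_left inner_add_right inner_commute)
      then have "(norm (act (b m - b n) v))\<^sup>2 \<le> (norm (x m - x n))\<^sup>2" by simp
      then show ?thesis by (simp add: norm_act abs_le_square_iff[symmetric] abs_mult)
    qed
    then have bd: "dist (b m) (b n) \<le> dist (x m) (x n) / norm v" for m n
      using v0 by (simp add: dist_norm field_simps)
    have "Cauchy b"
    proof (rule metric_CauchyI)
      fix e :: real assume "0 < e"
      then have "0 < e * norm v" using v0 by simp
      from metric_CauchyD[OF LIMSEQ_imp_Cauchy[OF xl] this] obtain M where
        "\<forall>m\<ge>M. \<forall>n\<ge>M. dist (x m) (x n) < e * norm v" by blast
      then have "\<forall>m\<ge>M. \<forall>n\<ge>M. dist (x m) (x n) / norm v < e" using v0 by (simp add: field_simps)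
      then show "\<exists>M. \<forall>m\<ge>M. \<forall>n\<ge>M. dist (b m) (b n) < e" using bd le_less_trans by blast
    qed
    then obtain b' where b': "b \<longlonglongrightarrow> b'" using Cauchy_convergent convergent_def by blast
    have "(\<lambda>n. act (b n) v) \<longlonglongrightarrow> act b' v"
    proof -
      have "(\<lambda>n. norm (b n - b') * norm v) \<longlonglongrightarrow> 0 * norm v"
        using b' by (intro tendsto_mult tendsto_const) (simp add: LIM_zero tendsto_norm_zero)
      then have "(\<lambda>n. norm (act (b n) v - act b' v)) \<longlonglongrightarrow> 0"
        by (simp add: norm_act flip: act_diff_left)
      then show ?thesis by (simp add: tendsto_norm_zero_iff LIM_zero_cancel)
    qed
    then have "c \<longlonglongrightarrow> l - act b' v" using tendsto_diff[OF xl] bc(2) by fastforce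
    then have "l - act b' v \<in> C" using C(1) bc(1) by (auto simp: closed_sequential_limits)
    then show "l \<in> W" unfolding W_def by (intro CollectI exI[of _ b'] exI[of _ "l - act b' v"]) auto
  qed
  have KW: "K \<subseteq> W" unfolding K_def using LW Wcl by (rule closure_minimal)
  define u where "u = (1 / norm v) *\<^sub>R v"
  have u1: "norm u = 1" using v0 by (simp add: u_def)
  have uK: "u \<in> K" using vK K(2) by (simp add: u_def subspace_scale)
  have step: "\<exists>b z. z \<in> K \<and> x = act b u + S z" if "x \<in> K" for x
  proof -
    obtain b c where bc: "c \<in> C" "x = act b v + c" using KW \<open>x \<in> K\<close> unfolding W_def by blast
    then obtain z where "z \<in> K" "c = S z" unfolding C_def by blast
    moreover have "act b v = act (norm v *\<^sub>R b) u" using v0 by (simp add: u_def act_scaleR act_scaleR_left)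
    ultimately show ?thesis using bc by auto
  qed
  have "\<forall>x. \<exists>bz. x \<in> K \<longrightarrow> snd bz \<in> K \<and> x = act (fst bz) u + S (snd bz)"
  proof
    fix x
    show "\<exists>bz. x \<in> K \<longrightarrow> snd bz \<in> K \<and> x = act (fst bz) u + S (snd bz)"
    proof (cases "x \<in> K")
      case True
      then obtain b z where "z \<in> K" "x = act b u + S z" using step by blast
      then show ?thesis by (intro exI[of _ "(b, z)"]) simp
    qed blast
  qed
  from choice[OF this] obtain \<gamma> where
    \<gamma>: "\<And>x. x \<in> K \<Longrightarrow> snd (\<gamma> x) \<in> K \<and> x = act (fst (\<gamma> x)) u + S (snd (\<gamma> x))" by blast
  define \<beta> \<zeta> where "\<beta> x = fst (\<gamma> x)" and "\<zeta> x = snd (\<gamma> x)" for x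
  have bz: "\<And>x. x \<in> K \<Longrightarrow> \<zeta> x \<in> K \<and> x = act (\<beta> x) u + S (\<zeta> x)"
    using \<gamma> by (simp add: \<beta>_def \<zeta>_def)
  \<comment> \<open>Repeated division by the shift: \<open>\<beta>\<close> extracts the leading
    coefficient and \<open>\<zeta>\<close> the quotient, so \<open>k n\<close> is what remains after
    \<open>n\<close> coefficients.\<close>
  define k where "k n = (\<zeta> ^^ n) f" for n
  define d where "d n = \<beta> (k n)" for n
  have kK: "k n \<in> K" for n by (induction n) (auto simp: k_def fK bz)
  have kS: "k n = act (d n) u + S (k (Suc n))" for n
    using bz[OF kK[of n]] by (simp add: k_def d_def)
  have fN: "f = comb N d u + (S ^^ N) (k N)" for N
  proof (induction N)
    case (Suc N)
    have "(S ^^ N) (k N) = (S ^^ N) (act (d N) u) + (S ^^ Suc N) (k (Suc N))"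
      by (subst kS) (simp add: linear_add[OF funpow_S(1)] funpow_swap1)
    then show ?case using Suc by (simp add: comb_def)
  qed (simp add: comb_def k_def)
  have uC: "act b u \<bullet> c = 0" if "c \<in> C" for b c
    using avC[OF that, of "(1 / norm v) *\<^sub>R b"] by (simp add: u_def act_scaleR act_scaleR_left)
  have orth: "u \<bullet> (S ^^ Suc n) (act c u) = 0" for n c
  proof -
    have "(S ^^ n) (act c u) \<in> K" by (induction n) (auto intro: SK aK uK)
    then have "(S ^^ Suc n) (act c u) \<in> C" by (simp add: C_def)
    from uC[OF this, of 1] show ?thesis by (simp add: act_1)
  qed
  have nrm: "(norm (k n))\<^sup>2 = (norm (d n))\<^sup>2 + (norm (k (Suc n)))\<^sup>2" for n
  proof -
    have "act (d n) u \<bullet> S (k (Suc n)) = 0" using kK by (intro uC) (auto simp: C_def)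
    then have "(norm (k n))\<^sup>2 = (norm (act (d n) u))\<^sup>2 + (norm (S (k (Suc n))))\<^sup>2"
      by (subst kS) (simp add: power2_norm_eq_inner inner_add_left inner_add_right inner_commute)
    then show ?thesis by (simp add: norm_act norm_S u1)
  qed
  have total: "(\<Sum>n<N. (norm (d n))\<^sup>2) + (norm (k N))\<^sup>2 = (norm f)\<^sup>2" for N
  proof (induction N)
    case (Suc N)
    then show ?case using nrm[of N] by simp
  qed (simp add: k_def)
  have "(\<Sum>n<N. (norm (d n))\<^sup>2) \<le> (norm f)\<^sup>2" for N
    using total[of N] zero_le_power2[of "norm (k N)"] by linarith
  then have smd: "summable (\<lambda>n. (norm (d n))\<^sup>2)"
    by (intro summableI_nonneg_bounded[of _ "(norm f)\<^sup>2"]) auto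
  obtain g where g: "(\<lambda>N. comb N d u) \<longlonglongrightarrow> g"
    using comb_wandering_converges[OF u1 orth smd] by blast
  \<comment> \<open>The remainders are not estimated. The difference is a limit of vectors in the
    closed range of each power of the shift, so purity makes it vanish.\<close>
  have "f - g = 0"
  proof (rule pure)
    fix n
    have cl: "closed ((S ^^ n) ` UNIV)"
    proof (induction n)
      case (Suc n)
      have "(S ^^ Suc n) ` UNIV = S ` ((S ^^ n) ` UNIV)" by (simp add: image_comp comp_def)
      then show ?case using closed_S_image[OF Suc] by simp
    qed simp
    have lim: "(\<lambda>N. f - comb (N + n) d u) \<longlonglongrightarrow> f - g"
      by (intro tendsto_intros LIMSEQ_ignore_initial_segment g)
    have "f - comb (N + n) d u \<in> (S ^^ n) ` UNIV" for N
    proof -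
      have "f - comb (N + n) d u = (S ^^ (n + N)) (k (N + n))" using fN[of "N + n"] by (simp add: add.commute)
      then show ?thesis by (simp add: funpow_add)
    qed
    from closed_sequentially[OF cl this lim] have "f - g \<in> (S ^^ n) ` UNIV" .
    then show "\<exists>y. f - g = (S ^^ n) y" by blast
  qed
  then have "(\<lambda>N. comb N d u) \<longlonglongrightarrow> f" using g by simp
  then show thesis using that[OF u1 uK[unfolded K_def] orth smd] by blast
qed

end

section \<open>Square summable sequences\<close>

text \<open>A type of its own, so that closures, limits, completeness and the interpretations of the
  shift locale are those of the type classes.\<close>

typedef (overloaded) ('a::real_inner) l2 = "{a :: nat \<Rightarrow> 'a. summable (\<lambda>n. (norm (a n))\<^sup>2)}"
  morphisms cf L2
  by (rule exI[of _ "\<lambda>_. 0"]) simp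

lemma summable_cf: "summable (\<lambda>n. (norm (cf x n))\<^sup>2)"
  using cf[of x] by simp

lemma cf_L2: "summable (\<lambda>n. (norm (a n))\<^sup>2) \<Longrightarrow> cf (L2 a) = a"
  by (simp add: L2_inverse)

lemma l2_eqI: "(\<And>n. cf x n = cf y n) \<Longrightarrow> x = y"
  by (metis cf_inject ext)

lemma summable_square_add:
  assumes "summable (\<lambda>n. (norm (a n :: 'a::real_normed_vector))\<^sup>2)" "summable (\<lambda>n. (norm (b n))\<^sup>2)"
  shows "summable (\<lambda>n. (norm (a n + b n))\<^sup>2)"
proof (rule summable_comparison_test'[of _ 0])
  show "summable (\<lambda>n. 2 * (norm (a n))\<^sup>2 + 2 * (norm (b n))\<^sup>2)"
    using assms by (intro summable_add summable_mult)
  fix n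
  have "(norm (a n + b n))\<^sup>2 \<le> (norm (a n) + norm (b n))\<^sup>2"
    by (intro power_mono norm_triangle_ineq) auto
  also have "\<dots> \<le> 2 * (norm (a n))\<^sup>2 + 2 * (norm (b n))\<^sup>2"
    using sum_squares_bound[of "norm (a n)" "norm (b n)"] by (simp add: power2_sum)
  finally show "norm ((norm (a n + b n))\<^sup>2) \<le> 2 * (norm (a n))\<^sup>2 + 2 * (norm (b n))\<^sup>2" by simp
qed

lemma summable_square_inner:
  assumes "summable (\<lambda>n. (norm (a n :: 'a::real_inner))\<^sup>2)" "summable (\<lambda>n. (norm (b n))\<^sup>2)"
  shows "summable (\<lambda>n. a n \<bullet> b n)"
proof (rule summable_comparison_test'[of _ 0])
  show "summable (\<lambda>n. (norm (a n))\<^sup>2 + (norm (b n))\<^sup>2)"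
    using assms by (intro summable_add)
  fix n
  have "\<bar>a n \<bullet> b n\<bar> \<le> norm (a n) * norm (b n)" by (rule Cauchy_Schwarz_ineq2)
  also have "\<dots> \<le> (norm (a n))\<^sup>2 + (norm (b n))\<^sup>2"
  proof -
    have "2 * (norm (a n) * norm (b n)) \<le> (norm (a n))\<^sup>2 + (norm (b n))\<^sup>2"
      using sum_squares_bound[of "norm (a n)" "norm (b n)"] by (simp add: mult.assoc)
    moreover have "0 \<le> norm (a n) * norm (b n)" by simp
    ultimately show ?thesis by linarith
  qed
  finally show "norm (a n \<bullet> b n) \<le> (norm (a n))\<^sup>2 + (norm (b n))\<^sup>2" by simp
qed

instantiation l2 :: (real_inner) real_vector
begin
definition "0 = L2 (\<lambda>_. 0)"
definition "x + y = L2 (\<lambda>n. cf x n + cf y n)"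
definition "- x = L2 (\<lambda>n. - cf x n)"
definition "x - y = (x :: 'a l2) + - y"
definition "r *\<^sub>R x = L2 (\<lambda>n. r *\<^sub>R cf x n)"

lemma cf_simps: "cf 0 n = 0" "cf (x + y) n = cf x n + cf y n" "cf (- x) n = - cf x n"
  "cf (x - y) n = cf x n - cf y n" "cf (r *\<^sub>R x) n = r *\<^sub>R cf x n"
proof -
  have a: "cf (x + y) n = cf x n + cf y n" for x y :: "'a l2"
    unfolding plus_l2_def using summable_square_add[OF summable_cf[of x] summable_cf[of y]]
    by (simp add: cf_L2)
  have m: "cf (- x) n = - cf x n" for x :: "'a l2"
    unfolding uminus_l2_def using summable_cf[of x] by (simp add: cf_L2)
  show "cf 0 n = 0" by (simp add: zero_l2_def cf_L2)
  show "cf (x + y) n = cf x n + cf y n" "cf (- x) n = - cf x n" using a m by auto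
  show "cf (x - y) n = cf x n - cf y n" by (simp add: minus_l2_def a m)
  show "cf (r *\<^sub>R x) n = r *\<^sub>R cf x n"
    unfolding scaleR_l2_def using summable_mult[OF summable_cf[of x], of "r\<^sup>2"]
    by (simp add: cf_L2 power_mult_distrib)
qed

instance
  by standard (rule l2_eqI; simp add: cf_simps scaleR_add_right scaleR_add_left)+
end

instantiation l2 :: (real_inner) real_inner
begin
definition "x \<bullet> y = (\<Sum>n. cf x n \<bullet> cf y n)"
definition "norm x = sqrt ((x :: 'a l2) \<bullet> x)"
definition "sgn x = x /\<^sub>R norm (x :: 'a l2)"
definition "dist x y = norm (x - y :: 'a l2)"
definition "(uniformity :: ('a l2 \<times> 'a l2) filter) = (INF e\<in>{0 <..}. principal {(x, y). dist x y < e})"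
definition "open U \<longleftrightarrow> (\<forall>x\<in>U. eventually (\<lambda>(x', y). x' = x \<longrightarrow> y \<in> U) uniformity)"
  for U :: "'a l2 set"
instance
proof
  fix x y z :: "'a l2" and r :: real and U :: "'a l2 set"
  note si = summable_square_inner[OF summable_cf summable_cf]
  show "sgn x = x /\<^sub>R norm x" by (rule sgn_l2_def)
  show "dist x y = norm (x - y)" by (rule dist_l2_def)
  show "(uniformity :: ('a l2 \<times> 'a l2) filter) = (INF e\<in>{0 <..}. principal {(x, y). dist x y < e})"
    by (rule uniformity_l2_def)
  show "open U \<longleftrightarrow> (\<forall>x\<in>U. eventually (\<lambda>(x', y). x' = x \<longrightarrow> y \<in> U) uniformity)"
    by (rule open_l2_def)
  show "x \<bullet> y = y \<bullet> x" by (simp add: inner_l2_def inner_commute)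
  show "(x + y) \<bullet> z = x \<bullet> z + y \<bullet> z"
    unfolding inner_l2_def by (simp add: cf_simps inner_add_left suminf_add si)
  show "(r *\<^sub>R x) \<bullet> y = r * (x \<bullet> y)"
    unfolding inner_l2_def by (simp add: cf_simps suminf_mult si)
  show "0 \<le> x \<bullet> x" unfolding inner_l2_def by (rule suminf_nonneg[OF si]) simp
  show "(x \<bullet> x = 0) = (x = 0)"
  proof
    assume "x \<bullet> x = 0"
    then have "\<forall>n. cf x n \<bullet> cf x n = 0"
      unfolding inner_l2_def by (subst (asm) suminf_eq_zero_iff[OF si]) auto
    then show "x = 0" by (intro l2_eqI) (simp add: cf_simps)
  qed (simp add: inner_l2_def cf_simps)
  show "norm x = sqrt (x \<bullet> x)" by (rule norm_l2_def)
qed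
end

lemma norm_l2_sq: "(norm x)\<^sup>2 = (\<Sum>n. (norm (cf x n))\<^sup>2)"
  unfolding power2_norm_eq_inner inner_l2_def ..

lemma norm_cf_le: "norm (cf x n) \<le> norm x"
proof -
  have "(norm (cf x n))\<^sup>2 \<le> (norm x)\<^sup>2"
    unfolding norm_l2_sq using sum_le_suminf[OF summable_cf[of x], of "{n}"] by simp
  then show ?thesis by (rule power2_le_imp_le) simp
qed

lemma norm_l2_le:
  assumes "\<And>N. (\<Sum>n<N. (norm (cf x n))\<^sup>2) \<le> e\<^sup>2" "0 \<le> e"
  shows "norm x \<le> e"
proof -
  have "(norm x)\<^sup>2 \<le> e\<^sup>2" unfolding norm_l2_sq by (rule suminf_le_const[OF summable_cf assms(1)])
  then show ?thesis using assms(2) by (rule power2_le_imp_le)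
qed

lemma bounded_linear_cf: "bounded_linear (\<lambda>x. cf x n)"
  by (rule bounded_linear_intro[of _ 1]) (auto simp: cf_simps norm_cf_le)

lemmas tendsto_cf = bounded_linear.tendsto[OF bounded_linear_cf]

text \<open>Coordinatewise limits exist. The Cauchy bound on finite partial sums passes to the limit
  and yields both square summability of the limit and convergence in norm.\<close>

instance l2 :: ("{real_inner, banach}") banach
proof
  fix X :: "nat \<Rightarrow> 'a l2" assume X: "Cauchy X"
  have "convergent (\<lambda>j. cf (X j) n)" for n
    using bounded_linear.Cauchy[OF bounded_linear_cf X] by (rule Cauchy_convergent)
  then obtain a where a: "(\<lambda>j. cf (X j) n) \<longlonglongrightarrow> a n" for n unfolding convergent_def by metis
  have bd: "(\<Sum>n<N. (norm (cf (X i) n - a n))\<^sup>2) \<le> e\<^sup>2"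
    if "\<And>m n. J \<le> m \<Longrightarrow> J \<le> n \<Longrightarrow> dist (X m) (X n) < e" "J \<le> i" for e J i N
  proof (rule LIMSEQ_le_const2)
    show "(\<lambda>j. \<Sum>n<N. (norm (cf (X i) n - cf (X j) n))\<^sup>2) \<longlonglongrightarrow> (\<Sum>n<N. (norm (cf (X i) n - a n))\<^sup>2)"
      by (intro tendsto_intros a)
    show "\<exists>M. \<forall>j\<ge>M. (\<Sum>n<N. (norm (cf (X i) n - cf (X j) n))\<^sup>2) \<le> e\<^sup>2"
    proof (intro exI[of _ J] allI impI)
      fix j assume "J \<le> j"
      have "(\<Sum>n<N. (norm (cf (X i) n - cf (X j) n))\<^sup>2) \<le> (norm (X i - X j))\<^sup>2"
        unfolding norm_l2_sq cf_simps[symmetric] by (rule sum_le_suminf[OF summable_cf]) auto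
      also have "\<dots> \<le> e\<^sup>2"
        using that(1)[OF that(2) \<open>J \<le> j\<close>] by (intro power_mono) (auto simp: dist_norm)
      finally show "(\<Sum>n<N. (norm (cf (X i) n - cf (X j) n))\<^sup>2) \<le> e\<^sup>2" .
    qed
  qed
  obtain J where J: "\<And>m n. J \<le> m \<Longrightarrow> J \<le> n \<Longrightarrow> dist (X m) (X n) < 1"
    using metric_CauchyD[OF X, of 1] by auto
  have "summable (\<lambda>n. (norm (a n - cf (X J) n))\<^sup>2)"
    using bd[OF J, of J] by (intro summableI_nonneg_bounded[of _ 1]) (auto simp: norm_minus_commute)
  then have "summable (\<lambda>n. (norm (a n - cf (X J) n + cf (X J) n))\<^sup>2)"
    by (rule summable_square_add[OF _ summable_cf])
  then have cfa: "cf (L2 a) = a" by (intro cf_L2) simp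
  have "X \<longlonglongrightarrow> L2 a"
  proof (rule metric_LIMSEQ_I)
    fix r :: real assume r: "0 < r"
    then obtain J where J: "\<And>m n. J \<le> m \<Longrightarrow> J \<le> n \<Longrightarrow> dist (X m) (X n) < r / 2"
      using metric_CauchyD[OF X, of "r/2"] by auto
    have "dist (X i) (L2 a) \<le> r / 2" if "J \<le> i" for i
      unfolding dist_norm using bd[OF J that] r by (intro norm_l2_le) (auto simp: cf_simps cfa)
    then show "\<exists>no. \<forall>n\<ge>no. dist (X n) (L2 a) < r" using r by (intro exI[of _ J]) force
  qed
  then show "convergent X" by (rule convergentI)
qed

definition l2_shift :: "'a::real_inner l2 \<Rightarrow> 'a l2" where
  "l2_shift x = L2 (\<lambda>n. case n of 0 \<Rightarrow> 0 | Suc m \<Rightarrow> cf x m)"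

lemma cf_l2_shift: "cf (l2_shift x) n = (case n of 0 \<Rightarrow> 0 | Suc m \<Rightarrow> cf x m)"
proof -
  have "summable (\<lambda>n. (norm (case n of 0 \<Rightarrow> 0 | Suc m \<Rightarrow> cf x m))\<^sup>2)"
    using summable_cf[of x] by (subst summable_Suc_iff[symmetric]) simp
  then show ?thesis by (simp add: l2_shift_def cf_L2)
qed

lemma norm_l2_shift: "norm (l2_shift x) = norm x"
proof -
  have "(norm (l2_shift x))\<^sup>2 = (norm x)\<^sup>2"
    unfolding norm_l2_sq using suminf_split_head[OF summable_cf[of "l2_shift x"]] by (simp add: cf_l2_shift)
  then show ?thesis by simp
qed

lemma cf_l2_shift_funpow: "cf ((l2_shift ^^ k) x) n = (if n < k then 0 else cf x (n - k))"
  by (induction k arbitrary: n) (auto simp: cf_l2_shift split: nat.split)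

lemma pure_l2_shift: "(\<And>n. \<exists>y. x = (l2_shift ^^ n) y) \<Longrightarrow> x = 0"
proof (rule l2_eqI)
  fix m assume "\<And>n. \<exists>y. x = (l2_shift ^^ n) y"
  then obtain y where "x = (l2_shift ^^ Suc m) y" by blast
  then show "cf x m = cf 0 m" by (simp add: cf_l2_shift_funpow cf_simps del: funpow.simps)
qed

lemma l2_shift_add: "l2_shift (x + y) = l2_shift x + l2_shift y" and l2_shift_scaleR: "l2_shift (r *\<^sub>R x) = r *\<^sub>R l2_shift x"
  by (rule l2_eqI; simp add: cf_l2_shift cf_simps split: nat.split)+

section \<open>Multiplication of square summable series\<close>

unbundle no vec_syntax
unbundle fps_syntax

lemma qcnj_simps: "qcnj (p + q) = qcnj p + qcnj q" "qcnj (p * q) = qcnj q * qcnj p"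
  "qcnj (qcnj p) = p" "qcnj 0 = 0" "qcnj 1 = 1" "qcnj (of_real r) = of_real r"
  "norm (qcnj p) = norm p" "qcnj (- p) = - qcnj p"
  by (simp_all add: quat_eq_iff quat_mult_sel norm_quat_def algebra_simps)

lemma qcnj_mult_self: "p * qcnj p = of_real ((norm p)\<^sup>2)" "qcnj p * p = of_real ((norm p)\<^sup>2)"
  by (simp_all add: quat_eq_iff quat_mult_sel norm_quat_def power2_eq_square)

lemma qcnj_sum: "qcnj (sum f A) = (\<Sum>a\<in>A. qcnj (f a))"
  by (induction A rule: infinite_finite_induct) (auto simp: qcnj_simps)

text \<open>Formal power series always have a product, whereas the product of two square summable
  series need not be square summable. An equation such as \<open>fp y = fp x * u\<close> therefore
  also asserts that the product on its right is square summable.\<close>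

definition fp :: "quat l2 \<Rightarrow> quat fps" where "fp x = Abs_fps (cf x)"

lemma fp_nth [simp]: "fp x $ n = cf x n" by (simp add: fp_def)

lemma fp_eq_iff: "fp x = fp y \<longleftrightarrow> x = y"
  by (metis fp_nth l2_eqI)

lemma fp_simps: "fp (x + y) = fp x + fp y" "fp (x - y) = fp x - fp y" "fp 0 = 0"
  by (simp_all add: fps_eq_iff cf_simps)

text \<open>The regular conjugate of a series. It reverses products, so every statement about
  multiplication on one side has a mirror image on the other.\<close>

definition fps_cnj :: "quat fps \<Rightarrow> quat fps" where "fps_cnj f = Abs_fps (\<lambda>n. qcnj (f $ n))"

lemma fps_cnj_nth [simp]: "fps_cnj f $ n = qcnj (f $ n)" by (simp add: fps_cnj_def)

lemma fps_cnj_simps: "fps_cnj (f * g) = fps_cnj g * fps_cnj f" "fps_cnj (fps_cnj f) = f" "fps_cnj 1 = 1" "fps_cnj (f + g) = fps_cnj f + fps_cnj g"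
proof -
  show "fps_cnj (f * g) = fps_cnj g * fps_cnj f"
  proof (rule fps_ext)
    fix n
    have "fps_cnj (f * g) $ n = (\<Sum>i=0..n. qcnj (g $ (n - i)) * qcnj (f $ i))"
      by (simp add: fps_mult_nth qcnj_sum qcnj_simps)
    also have "\<dots> = (\<Sum>i=0..n. qcnj (g $ i) * qcnj (f $ (n - i)))"
      by (rule sum.reindex_bij_witness[of _ "\<lambda>i. n - i" "\<lambda>i. n - i"]) auto
    finally show "fps_cnj (f * g) $ n = (fps_cnj g * fps_cnj f) $ n" by (simp add: fps_mult_nth)
  qed
qed (auto simp: fps_eq_iff qcnj_simps)

definition l2_cnj :: "quat l2 \<Rightarrow> quat l2" where "l2_cnj x = L2 (\<lambda>n. qcnj (cf x n))"

lemma cf_l2_cnj: "cf (l2_cnj x) n = qcnj (cf x n)"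
  using summable_cf[of x] by (simp add: l2_cnj_def cf_L2 qcnj_simps)

lemma fp_l2_cnj: "fp (l2_cnj x) = fps_cnj (fp x)" by (simp add: fps_eq_iff cf_l2_cnj)

lemma l2_cnj_simps: "l2_cnj (l2_cnj x) = x" "norm (l2_cnj x) = norm x" "l2_cnj (x - y) = l2_cnj x - l2_cnj y"
proof -
  have "(norm (l2_cnj x))\<^sup>2 = (norm x)\<^sup>2" by (simp add: norm_l2_sq cf_l2_cnj qcnj_simps)
  then show "norm (l2_cnj x) = norm x" by simp
qed (rule l2_eqI; simp add: cf_l2_cnj cf_simps qcnj_simps quat_eq_iff)+

lemma tendsto_l2_cnj: "X \<longlonglongrightarrow> x \<Longrightarrow> (\<lambda>j. l2_cnj (X j)) \<longlonglongrightarrow> l2_cnj x"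
  unfolding tendsto_iff dist_norm l2_cnj_simps(3)[symmetric] l2_cnj_simps(2) .

definition l2_smult :: "quat \<Rightarrow> quat l2 \<Rightarrow> quat l2" where "l2_smult c x = L2 (\<lambda>n. c * cf x n)"

lemma cf_l2_smult: "cf (l2_smult c x) n = c * cf x n"
  using summable_mult[OF summable_cf[of x], of "(norm c)\<^sup>2"]
  by (simp add: l2_smult_def cf_L2 norm_mult power_mult_distrib)

lemma norm_l2_smult: "norm (l2_smult c x) = norm c * norm x"
proof -
  have "(norm (l2_smult c x))\<^sup>2 = (norm c * norm x)\<^sup>2"
    unfolding norm_l2_sq power_mult_distrib
    by (simp add: cf_l2_smult norm_mult power_mult_distrib suminf_mult[OF summable_cf])
  then show ?thesis by (rule power2_eq_imp_eq) auto
qed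

interpretation Q: shift_module l2_shift l2_smult
proof
  show "x = 0" if "\<And>n. \<exists>y. x = (l2_shift ^^ n) y" for x :: "quat l2" using that by (rule pure_l2_shift)
qed (rule l2_eqI; simp add: cf_l2_smult cf_simps cf_l2_shift algebra_simps scaleR_conv_of_real split: nat.split
     | simp add: norm_l2_smult norm_l2_shift l2_shift_add l2_shift_scaleR)+

definition e0 :: "quat l2" where "e0 = L2 (\<lambda>n. if n = 0 then 1 else 0)"

lemma cf_e0: "cf e0 n = (if n = 0 then 1 else 0)"
proof -
  have "summable (\<lambda>n. (norm (if n = 0 then 1 else 0 :: quat))\<^sup>2)"
    by (rule summable_finite[of "{0}"]) auto
  then show ?thesis by (simp add: e0_def cf_L2)
qed

lemma fp_e0: "fp e0 = 1" by (auto simp: fps_eq_iff cf_e0)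
lemma l2_cnj_e0: "l2_cnj e0 = e0" by (rule l2_eqI) (auto simp: cf_l2_cnj cf_e0 qcnj_simps)
lemma norm_e0: "norm e0 = 1"
proof -
  have "(norm e0)\<^sup>2 = 1"
    unfolding norm_l2_sq by (subst suminf_finite[of "{0}"]) (auto simp: cf_e0)
  then show ?thesis by (simp add: power2_eq_1_iff) (use norm_ge_zero[of e0] in linarith)
qed

definition finite_fps :: "quat fps \<Rightarrow> bool" where "finite_fps p \<longleftrightarrow> (\<exists>N. \<forall>n\<ge>N. p $ n = 0)"

definition trunc :: "nat \<Rightarrow> (nat \<Rightarrow> quat) \<Rightarrow> quat fps" where
  "trunc N p = Abs_fps (\<lambda>k. if k < N then p k else 0)"

lemma finite_fps_trunc: "finite_fps (trunc N p)" unfolding finite_fps_def trunc_def by (intro exI[of _ N]) simp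

lemma finE: assumes "finite_fps p" obtains N where "p = trunc N (fps_nth p)"
proof -
  obtain N where "\<forall>n\<ge>N. p $ n = 0" using assms by (auto simp: finite_fps_def)
  then have "p = trunc N (fps_nth p)" by (auto simp: fps_eq_iff trunc_def)
  then show thesis by (rule that)
qed

lemma finite_fps_fps_cnj: "finite_fps p \<Longrightarrow> finite_fps (fps_cnj p)"
  unfolding finite_fps_def fps_cnj_nth using qcnj_simps(4) by metis

lemma cf_comb: "cf (Q.comb N p x) n = (\<Sum>k\<le>n. (if k < N then p k else 0) * cf x (n - k))"
proof -
  have "cf (Q.comb N p x) n = (\<Sum>k<N. if n < k then 0 else p k * cf x (n - k))"
    unfolding Q.comb_def linear_sum[OF bounded_linear.linear[OF bounded_linear_cf]]
    by (intro sum.cong) (auto simp: cf_l2_shift_funpow cf_l2_smult)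
  also have "\<dots> = (\<Sum>k\<in>{..<N} \<inter> {..n}. p k * cf x (n - k))"
    by (rule sum.mono_neutral_cong_right) auto
  also have "\<dots> = (\<Sum>k\<le>n. (if k < N then p k else 0) * cf x (n - k))"
    by (rule sum.mono_neutral_cong_left) auto
  finally show ?thesis .
qed

lemma fp_comb: "fp (Q.comb N p x) = trunc N p * fp x"
  by (simp add: fps_eq_iff cf_comb fps_mult_nth trunc_def atLeast0AtMost)

lemma finite_fps_mult_left: "finite_fps p \<Longrightarrow> \<exists>y. fp y = p * fp x"
  by (erule finE) (metis fp_comb)

lemma finite_fps_mult_right: "finite_fps p \<Longrightarrow> \<exists>y. fp y = fp x * p"
proof -
  assume "finite_fps p"
  from finite_fps_mult_left[OF finite_fps_fps_cnj[OF this], of "l2_cnj x"] obtain y where "fp y = fps_cnj p * fp (l2_cnj x)" by blast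
  then have "fp (l2_cnj y) = fp x * p" by (simp add: fp_l2_cnj fps_cnj_simps)
  then show ?thesis by blast
qed

lemma finite_fps_l2: "finite_fps p \<Longrightarrow> \<exists>y. fp y = p"
  using finite_fps_mult_left[of p e0] by (simp add: fp_e0)

section \<open>Isometric multipliers\<close>

definition right_isometric :: "quat fps \<Rightarrow> bool" where
  "right_isometric u \<longleftrightarrow> (\<forall>x. \<exists>y. fp y = fp x * u \<and> norm y = norm x)"

definition left_isometric :: "quat fps \<Rightarrow> bool" where
  "left_isometric u \<longleftrightarrow> (\<forall>x. \<exists>y. fp y = u * fp x \<and> norm y = norm x)"

lemma left_isometric_iff: "left_isometric u \<longleftrightarrow> right_isometric (fps_cnj u)"
proof
  assume L: "left_isometric u"
  show "right_isometric (fps_cnj u)" unfolding right_isometric_def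
  proof
    fix x
    obtain y where "fp y = u * fp (l2_cnj x)" "norm y = norm (l2_cnj x)" using L unfolding left_isometric_def by blast
    then show "\<exists>y. fp y = fp x * fps_cnj u \<and> norm y = norm x"
      by (intro exI[of _ "l2_cnj y"]) (simp add: fp_l2_cnj fps_cnj_simps l2_cnj_simps)
  qed
next
  assume R: "right_isometric (fps_cnj u)"
  show "left_isometric u" unfolding left_isometric_def
  proof
    fix x
    obtain y where "fp y = fp (l2_cnj x) * fps_cnj u" "norm y = norm (l2_cnj x)" using R unfolding right_isometric_def by blast
    then show "\<exists>y. fp y = u * fp x \<and> norm y = norm x"
      by (intro exI[of _ "l2_cnj y"]) (simp add: fp_l2_cnj fps_cnj_simps l2_cnj_simps)
  qed
qed

lemma right_isometric_norm:
  assumes "right_isometric u" "fp y = fp x * u"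
  shows "norm y = norm x"
proof -
  obtain z where "fp z = fp x * u" "norm z = norm x" using assms(1) unfolding right_isometric_def by blast
  then show ?thesis using assms(2) fp_eq_iff[of y z] by simp
qed

text \<open>Differences are mapped isometrically, so convergence of the products makes the factors
  Cauchy. The limit equation is read off coefficientwise, each coefficient of a product being a
  finite sum. This is the closed range property that makes divisibility by an inner series stable
  under limits.\<close>

lemma right_isometric_closed:
  assumes u: "right_isometric u" and y: "\<And>j. fp (Y j) = fp (X j) * u" and lim: "Y \<longlonglongrightarrow> y"
  shows "\<exists>x. X \<longlonglongrightarrow> x \<and> fp y = fp x * u"
proof -
  have "fp (Y m - Y n) = fp (X m - X n) * u" for m n by (simp add: fp_simps y algebra_simps)
  from right_isometric_norm[OF u this] have "dist (X m) (X n) = dist (Y m) (Y n)" for m n by (simp add: dist_norm)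
  then have "Cauchy X" using LIMSEQ_imp_Cauchy[OF lim] by (simp add: Cauchy_def)
  then obtain x where x: "X \<longlonglongrightarrow> x" using Cauchy_convergent convergent_def by blast
  have "fp y $ n = (fp x * u) $ n" for n
  proof -
    have "(\<lambda>j. \<Sum>i=0..n. cf (X j) i * u $ (n - i)) \<longlonglongrightarrow> (\<Sum>i=0..n. cf x i * u $ (n - i))"
      by (intro tendsto_intros tendsto_cf x)
    moreover have "(\<lambda>j. \<Sum>i=0..n. cf (X j) i * u $ (n - i)) = (\<lambda>j. cf (Y j) n)"
      using y by (auto simp: fps_eq_iff fps_mult_nth)
    ultimately have "(\<lambda>j. cf (Y j) n) \<longlonglongrightarrow> (fp x * u) $ n" by (simp add: fps_mult_nth)
    then show ?thesis using LIMSEQ_unique[OF tendsto_cf[OF lim]] by simp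
  qed
  then show ?thesis using x by (auto simp: fps_eq_iff)
qed

lemma left_isometric_closed:
  assumes u: "left_isometric u" and y: "\<And>j. fp (Y j) = u * fp (X j)" and lim: "Y \<longlonglongrightarrow> y"
  shows "\<exists>x. X \<longlonglongrightarrow> x \<and> fp y = u * fp x"
proof -
  have "fp (l2_cnj (Y j)) = fp (l2_cnj (X j)) * fps_cnj u" for j by (simp add: fp_l2_cnj y fps_cnj_simps)
  from right_isometric_closed[OF u[unfolded left_isometric_iff] this tendsto_l2_cnj[OF lim]]
  obtain x where x: "(\<lambda>j. l2_cnj (X j)) \<longlonglongrightarrow> x" "fp (l2_cnj y) = fp x * fps_cnj u" by blast
  then have "X \<longlonglongrightarrow> l2_cnj x" using tendsto_l2_cnj[OF x(1)] by (simp add: l2_cnj_simps)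
  moreover have "fp y = u * fp (l2_cnj x)" using arg_cong[OF x(2), of fps_cnj] by (simp add: fp_l2_cnj fps_cnj_simps)
  ultimately show ?thesis by blast
qed

lemma right_isometric_tendsto:
  assumes u: "right_isometric u" and y: "\<And>j. fp (Y j) = fp (X j) * u" and lim: "X \<longlonglongrightarrow> x" and "fp y = fp x * u"
  shows "Y \<longlonglongrightarrow> y"
proof -
  have "fp (Y j - y) = fp (X j - x) * u" for j using assms by (simp add: fp_simps algebra_simps)
  from right_isometric_norm[OF u this] show ?thesis using lim by (simp add: tendsto_iff dist_norm)
qed

lemma left_isometric_tendsto:
  assumes u: "left_isometric u" and y: "\<And>j. fp (Y j) = u * fp (X j)" and lim: "X \<longlonglongrightarrow> x" and "fp y = u * fp x"
  shows "Y \<longlonglongrightarrow> y"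
proof -
  have "fp (l2_cnj (Y j)) = fp (l2_cnj (X j)) * fps_cnj u" "fp (l2_cnj y) = fp (l2_cnj x) * fps_cnj u" for j
    using assms by (simp_all add: fp_l2_cnj fps_cnj_simps)
  from tendsto_l2_cnj[OF right_isometric_tendsto[OF u[unfolded left_isometric_iff] this(1) tendsto_l2_cnj[OF lim] this(2)]]
  show ?thesis by (simp add: l2_cnj_simps)
qed

lemma right_isometric_l2: "right_isometric u \<Longrightarrow> \<exists>y. fp y = u \<and> norm y = 1"
  unfolding right_isometric_def by (drule spec[of _ e0]) (simp add: fp_e0 norm_e0)

text \<open>The constant term already exhausts the norm, leaving nothing for the other coefficients.
  This is how inner factors are recognized as constants.\<close>

lemma norm_one_constant:
  assumes "norm y = 1" "1 \<le> norm (cf y 0)"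
  shows "fp y = fps_const (cf y 0)" "norm (cf y 0) = 1"
proof -
  show n0: "norm (cf y 0) = 1" using norm_cf_le[of y 0] assms by simp
  have "cf y n = 0" if "n \<noteq> 0" for n
  proof -
    have "(\<Sum>i\<in>{0, n}. (norm (cf y i))\<^sup>2) \<le> (norm y)\<^sup>2"
      unfolding norm_l2_sq by (rule sum_le_suminf[OF summable_cf]) auto
    then show ?thesis using that n0 assms by simp
  qed
  then show "fp y = fps_const (cf y 0)" by (auto simp: fps_eq_iff)
qed

section \<open>Cyclic series and Beurling's factorization\<close>

definition left_cyclic :: "quat l2 \<Rightarrow> bool" where "left_cyclic g \<longleftrightarrow> e0 \<in> closure (Q.cyc g)"

lemma left_cyclic_iff: "left_cyclic g \<longleftrightarrow> (\<exists>y p. (\<forall>j. finite_fps (p j) \<and> fp (y j) = p j * fp g) \<and> y \<longlonglongrightarrow> e0)"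
proof
  assume "left_cyclic g"
  then obtain y where y: "\<And>j. y j \<in> Q.cyc g" "y \<longlonglongrightarrow> e0"
    unfolding left_cyclic_def closure_sequential by blast
  have "\<exists>p. finite_fps p \<and> fp (y j) = p * fp g" for j
  proof -
    obtain N q where "y j = Q.comb N q g" using y(1)[of j] unfolding Q.cyc_def by blast
    then show ?thesis using finite_fps_trunc fp_comb by (intro exI[of _ "trunc N q"]) simp
  qed
  then show "\<exists>y p. (\<forall>j. finite_fps (p j) \<and> fp (y j) = p j * fp g) \<and> y \<longlonglongrightarrow> e0"
    using y(2) choice[of "\<lambda>j p. finite_fps p \<and> fp (y j) = p * fp g"] by blast
next
  assume "\<exists>y p. (\<forall>j. finite_fps (p j) \<and> fp (y j) = p j * fp g) \<and> y \<longlonglongrightarrow> e0"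
  then obtain y p where yp: "\<And>j. finite_fps (p j)" "\<And>j. fp (y j) = p j * fp g" "y \<longlonglongrightarrow> e0" by blast
  have "y j \<in> Q.cyc g" for j
  proof -
    obtain N where "p j = trunc N (fps_nth (p j))" using finE[OF yp(1)] by blast
    then have "fp (y j) = fp (Q.comb N (fps_nth (p j)) g)" using yp(2) by (simp add: fp_comb)
    then show ?thesis unfolding Q.cyc_def fp_eq_iff by blast
  qed
  then show "left_cyclic g" unfolding left_cyclic_def closure_sequential using yp(3) by blast
qed

lemma fp_comb_limit:
  assumes "(\<lambda>N. Q.comb N p u) \<longlonglongrightarrow> y"
  shows "fp y = Abs_fps p * fp u"
proof (rule fps_ext)
  fix n
  have lim: "(\<lambda>N. cf (Q.comb N p u) n) \<longlonglongrightarrow> cf y n" by (rule tendsto_cf[OF assms])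
  have "\<forall>\<^sub>F N in sequentially. cf (Q.comb N p u) n = (\<Sum>k\<le>n. p k * cf u (n - k))"
    using eventually_gt_at_top[of n] by eventually_elim (auto simp: cf_comb intro!: sum.cong)
  from LIMSEQ_unique[OF lim tendsto_eventually[OF this]]
  show "fp y $ n = (Abs_fps p * fp u) $ n" by (simp add: fps_mult_nth atLeast0AtMost)
qed

text \<open>The wandering vector is the isometric factor and the expansion coefficients of
  \<open>f\<close> are \<open>g\<close>. For cyclicity, \<open>u\<close> is a limit of
  \<open>p * f = p * g * u\<close>; cancelling the isometry, the series \<open>p * g\<close>
  converge to some \<open>x\<close> with \<open>x * u = u\<close>, so \<open>x\<close> is the
  unit.\<close>

theorem left_beurling:
  assumes "f \<noteq> 0"
  shows "\<exists>g u. fp f = fp g * fp u \<and> right_isometric (fp u) \<and> left_cyclic g"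
proof -
  obtain u d where u: "norm u = 1" "u \<in> closure (Q.cyc f)"
    "\<And>n c. u \<bullet> (l2_shift ^^ Suc n) (l2_smult c u) = 0"
    "summable (\<lambda>n. (norm (d n))\<^sup>2)" "(\<lambda>N. Q.comb N d u) \<longlonglongrightarrow> f"
    using Q.wold_beurling[OF assms] by blast
  have iso: "right_isometric (fp u)" unfolding right_isometric_def
  proof
    fix x
    obtain y where y: "(\<lambda>N. Q.comb N (cf x) u) \<longlonglongrightarrow> y" "(norm y)\<^sup>2 = (\<Sum>n. (norm (cf x n))\<^sup>2)"
      using Q.comb_wandering_converges[OF u(1,3) summable_cf] by blast
    have "fp y = fp x * fp u" using fp_comb_limit[OF y(1)] by (simp add: fp_def)
    moreover have "norm y = norm x" using y(2) by (simp flip: norm_l2_sq)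
    ultimately show "\<exists>y. fp y = fp x * fp u \<and> norm y = norm x" by blast
  qed
  define g where "g = L2 d"
  have g: "cf g = d" unfolding g_def using u(4) by (rule cf_L2)
  have fg: "fp f = fp g * fp u" using fp_comb_limit[OF u(5)] by (simp add: fp_def g)
  have "left_cyclic g"
  proof -
    obtain y where y: "\<And>j. y j \<in> Q.cyc f" "y \<longlonglongrightarrow> u" using u(2) unfolding closure_sequential by blast
    have "\<exists>p. finite_fps p \<and> fp (y j) = p * fp f" for j
    proof -
      obtain N q where "y j = Q.comb N q f" using y(1)[of j] unfolding Q.cyc_def by blast
      then show ?thesis using finite_fps_trunc fp_comb by (intro exI[of _ "trunc N q"]) simp
    qed
    then obtain p where p: "\<And>j. finite_fps (p j) \<and> fp (y j) = p j * fp f"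
      using choice[of "\<lambda>j p. finite_fps p \<and> fp (y j) = p * fp f"] by blast
    have "\<forall>j. \<exists>z. fp z = p j * fp g" using finite_fps_mult_left p by blast
    from choice[OF this] obtain z where z: "\<And>j. fp (z j) = p j * fp g" by blast
    have "fp (y j) = fp (z j) * fp u" for j using p z fg by (simp add: mult.assoc)
    from right_isometric_closed[OF iso this y(2)] obtain x where x: "z \<longlonglongrightarrow> x" "fp u = fp x * fp u" by blast
    have "fp (x - e0) * fp u = fp 0" using x(2) by (simp add: fp_simps fp_e0 algebra_simps)
    from right_isometric_norm[OF iso this[symmetric]] have "x = e0" by simp
    then show ?thesis unfolding left_cyclic_iff using x p z by blast
  qed
  then show ?thesis using fg iso by blast
qed

section \<open>Central series and bounded multipliers\<close>

definition real_fps :: "quat fps \<Rightarrow> bool" where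
  "real_fps f \<longleftrightarrow> (\<forall>n. f $ n = of_real (qRe (f $ n)))"

lemma of_real_quat_commute: "of_real r * (q::quat) = q * of_real r"
  by (simp add: quat_eq_iff quat_mult_sel)

lemma real_fps_commute: "real_fps f \<Longrightarrow> f * g = g * f"
proof (rule fps_ext)
  fix n assume f: "real_fps f"
  have "(f * g) $ n = (\<Sum>i=0..n. g $ (n - i) * f $ i)"
    unfolding fps_mult_nth using f unfolding real_fps_def by (metis of_real_quat_commute)
  also have "\<dots> = (\<Sum>i=0..n. g $ i * f $ (n - i))"
    by (rule sum.reindex_bij_witness[of _ "\<lambda>i. n - i" "\<lambda>i. n - i"]) auto
  finally show "(f * g) $ n = (g * f) $ n" by (simp add: fps_mult_nth)
qed

lemma quat_real_iff: "q = of_real (qRe q) \<longleftrightarrow> qcnj q = q"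
  by (auto simp: quat_eq_iff)

lemma real_fps_iff: "real_fps f \<longleftrightarrow> fps_cnj f = f"
  by (simp add: real_fps_def quat_real_iff fps_eq_iff)

text \<open>The symmetrization \<open>f\<^sup>c * f\<close> plays the role of a determinant.\<close>

lemma real_fps_cnj_mult: "real_fps (fps_cnj f * f)"
  by (simp add: real_fps_iff fps_cnj_simps)

text \<open>Operators are maps of formal series whose restriction to square summable series is
  bounded. Composites with products can thus be written down before it is known that the factors
  preserve square summability.\<close>

definition bounded_op :: "(quat fps \<Rightarrow> quat fps) \<Rightarrow> bool" where
  "bounded_op T \<longleftrightarrow> (\<forall>f g. T (f - g) = T f - T g) \<and> (\<exists>M. \<forall>x. \<exists>y. fp y = T (fp x) \<and> norm y \<le> M * norm x)"

lemma bddI: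
  assumes "\<And>f g. T (f - g) = T f - T g" "\<And>x. \<exists>y. fp y = T (fp x) \<and> norm y \<le> M * norm x"
  shows "bounded_op T"
  unfolding bounded_op_def using assms by blast

lemma bddD: "bounded_op T \<Longrightarrow> T (f - g) = T f - T g"
  unfolding bounded_op_def by blast

lemma bounded_op_tendsto:
  assumes T: "bounded_op T" and X: "X \<longlonglongrightarrow> x"
  shows "\<exists>Y y. (\<forall>j. fp (Y j) = T (fp (X j))) \<and> fp y = T (fp x) \<and> Y \<longlonglongrightarrow> y"
proof -
  obtain M where M: "\<forall>x. \<exists>y. fp y = T (fp x) \<and> norm y \<le> M * norm x" using T unfolding bounded_op_def by blast
  obtain t where t: "\<And>x. fp (t x) = T (fp x)" "\<And>x. norm (t x) \<le> M * norm x"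
    using choice[OF M] by blast
  have d: "t a - t b = t (a - b)" for a b
  proof -
    have "fp (t a - t b) = fp (t (a - b))" using T by (simp add: fp_simps t bounded_op_def)
    then show ?thesis by (simp only: fp_eq_iff)
  qed
  have "(\<lambda>j. t (X j)) \<longlonglongrightarrow> t x"
  proof (rule LIM_zero_cancel, rule tendsto_norm_zero_cancel, rule tendsto_sandwich[where f = "\<lambda>_. 0"])
    show "(\<lambda>j. M * norm (X j - x)) \<longlonglongrightarrow> 0"
      using tendsto_mult[OF tendsto_const tendsto_norm_zero[OF LIM_zero[OF X]], of M] by simp
    show "\<forall>\<^sub>F j in sequentially. norm (t (X j) - t x) \<le> M * norm (X j - x)"
      unfolding d using t(2) by simp
  qed (auto intro: tendsto_const)
  then show ?thesis using t(1) by (intro exI[of _ "\<lambda>j. t (X j)"] exI[of _ "t x"]) simp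
qed

lemma bounded_op_comp: "bounded_op S \<Longrightarrow> bounded_op T \<Longrightarrow> bounded_op (\<lambda>f. S (T f))"
proof -
  assume S: "bounded_op S" and T: "bounded_op T"
  obtain M where M: "\<And>x. \<exists>y. fp y = S (fp x) \<and> norm y \<le> M * norm x" using S unfolding bounded_op_def by blast
  obtain N where N: "\<And>x. \<exists>y. fp y = T (fp x) \<and> norm y \<le> N * norm x" using T unfolding bounded_op_def by blast
  have "\<exists>y. fp y = S (T (fp x)) \<and> norm y \<le> (\<bar>M\<bar> * N) * norm x" for x
  proof -
    obtain y where y: "fp y = T (fp x)" "norm y \<le> N * norm x" using N by blast
    obtain z where z: "fp z = S (fp y)" "norm z \<le> M * norm y" using M by blast
    have "M * norm y \<le> \<bar>M\<bar> * norm y" by (intro mult_right_mono) auto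
    also have "\<dots> \<le> \<bar>M\<bar> * (N * norm x)" using y(2) by (intro mult_left_mono) auto
    finally show ?thesis using y(1) z by (intro exI[of _ z]) (auto simp: mult.assoc)
  qed
  then show ?thesis by (intro bddI[of _ "\<bar>M\<bar> * N"]) (simp_all add: bddD[OF S] bddD[OF T])
qed

lemma bounded_op_add: "bounded_op S \<Longrightarrow> bounded_op T \<Longrightarrow> bounded_op (\<lambda>f. S f + T f)"
proof -
  assume S: "bounded_op S" and T: "bounded_op T"
  obtain M where M: "\<And>x. \<exists>y. fp y = S (fp x) \<and> norm y \<le> M * norm x" using S unfolding bounded_op_def by blast
  obtain N where N: "\<And>x. \<exists>y. fp y = T (fp x) \<and> norm y \<le> N * norm x" using T unfolding bounded_op_def by blast
  have "\<exists>y. fp y = S (fp x) + T (fp x) \<and> norm y \<le> (M + N) * norm x" for x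
  proof -
    obtain y where y: "fp y = S (fp x)" "norm y \<le> M * norm x" using M by blast
    obtain z where z: "fp z = T (fp x)" "norm z \<le> N * norm x" using N by blast
    show ?thesis using y z norm_triangle_ineq[of y z]
      by (intro exI[of _ "y + z"]) (auto simp: fp_simps algebra_simps)
  qed
  then show ?thesis by (intro bddI[of _ "M + N"]) (simp_all add: bddD[OF S] bddD[OF T])
qed

definition real_part :: "quat fps \<Rightarrow> quat fps" where
  "real_part f = Abs_fps (\<lambda>n. of_real (qRe (f $ n)))"

lemma bounded_op_real_part: "bounded_op real_part"
proof -
  have "\<exists>y. fp y = real_part (fp x) \<and> norm y \<le> 1 * norm x" for x
  proof -
    have le: "(norm (of_real (qRe (cf x n)) :: quat))\<^sup>2 \<le> (norm (cf x n))\<^sup>2" for n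
      by (simp add: norm_quat_def)
    have sm: "summable (\<lambda>n. (norm (of_real (qRe (cf x n)) :: quat))\<^sup>2)"
      by (rule summable_comparison_test'[OF summable_cf[of x], of 0]) (use le in auto)
    define y where "y = L2 (\<lambda>n. of_real (qRe (cf x n)) :: quat)"
    have y: "cf y n = of_real (qRe (cf x n))" for n unfolding y_def by (simp only: cf_L2[OF sm])
    have "(norm y)\<^sup>2 \<le> (norm x)\<^sup>2"
      unfolding norm_l2_sq y by (rule suminf_le[OF le sm summable_cf])
    then have "norm y \<le> norm x" by (rule power2_le_imp_le) simp
    then show ?thesis using y by (intro exI[of _ y]) (simp add: real_part_def fps_eq_iff)
  qed
  then show ?thesis by (intro bddI[of _ 1]) (auto simp: real_part_def fps_eq_iff)
qed

lemma bounded_op_const_left: "bounded_op (\<lambda>f. fps_const c * f)"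
proof -
  have "\<exists>y. fp y = fps_const c * fp x \<and> norm y \<le> norm c * norm x" for x
    by (intro exI[of _ "l2_smult c x"]) (simp add: fps_eq_iff cf_l2_smult norm_l2_smult)
  then show ?thesis by (intro bddI[of _ "norm c"]) (auto simp: algebra_simps)
qed

lemma bounded_op_const_right: "bounded_op (\<lambda>f. f * fps_const c)"
proof -
  have "\<exists>y. fp y = fp x * fps_const c \<and> norm y \<le> norm c * norm x" for x
    by (intro exI[of _ "l2_cnj (l2_smult (qcnj c) (l2_cnj x))"])
       (simp add: fps_eq_iff cf_l2_smult cf_l2_cnj qcnj_simps l2_cnj_simps norm_l2_smult)
  then show ?thesis by (intro bddI[of _ "norm c"]) (auto simp: algebra_simps)
qed

lemma real_fps_real_part: "real_fps (real_part f)"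
  by (simp add: real_fps_def real_part_def)

text \<open>Each imaginary coordinate is the real part of a product with a unit, so the passage to
  coordinates is composed of constant multiplications and \<open>real_part\<close>, all of them
  bounded.\<close>

lemma quat_expansion:
  "q = of_real (qRe q) + of_real (qRe (- q * Quat 0 1 0 0)) * Quat 0 1 0 0
     + of_real (qRe (- q * Quat 0 0 1 0)) * Quat 0 0 1 0 + of_real (qRe (- q * Quat 0 0 0 1)) * Quat 0 0 0 1"
  by (simp add: quat_eq_iff quat_mult_sel)

lemma fps_expansion:
  "f = real_part f + real_part (fps_const (-1) * (f * fps_const (Quat 0 1 0 0))) * fps_const (Quat 0 1 0 0)
    + real_part (fps_const (-1) * (f * fps_const (Quat 0 0 1 0))) * fps_const (Quat 0 0 1 0)
    + real_part (fps_const (-1) * (f * fps_const (Quat 0 0 0 1))) * fps_const (Quat 0 0 0 1)"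
  (is "f = ?g")
proof (rule fps_ext)
  fix n show "f $ n = ?g $ n"
    using quat_expansion[of "f $ n"] by (simp add: real_part_def)
qed

text \<open>Real series are central, and every series is a combination of four of them.\<close>

lemma bounded_op_mult_of_real:
  assumes "\<exists>M. \<forall>x. real_fps (fp x) \<longrightarrow> (\<exists>y. fp y = fp x * a \<and> norm y \<le> M * norm x)"
  shows "bounded_op (\<lambda>f. f * a)" "bounded_op (\<lambda>f. a * f)"
proof -
  have R: "bounded_op (\<lambda>f. real_part f * a)"
  proof -
    obtain M where M: "\<And>x. real_fps (fp x) \<Longrightarrow> \<exists>y. fp y = fp x * a \<and> norm y \<le> M * norm x" using assms by blast
    obtain N where N: "\<And>x. \<exists>y. fp y = real_part (fp x) \<and> norm y \<le> N * norm x"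
      using bounded_op_real_part unfolding bounded_op_def by blast
    have "\<exists>y. fp y = real_part (fp x) * a \<and> norm y \<le> (\<bar>M\<bar> * N) * norm x" for x
    proof -
      obtain y where y: "fp y = real_part (fp x)" "norm y \<le> N * norm x" using N by blast
      then have "real_fps (fp y)" by (simp add: real_fps_real_part)
      then obtain z where z: "fp z = fp y * a" "norm z \<le> M * norm y" using M by blast
      have "M * norm y \<le> \<bar>M\<bar> * norm y" by (intro mult_right_mono) auto
      also have "\<dots> \<le> \<bar>M\<bar> * (N * norm x)" using y(2) by (intro mult_left_mono) auto
      finally show ?thesis using y(1) z by (intro exI[of _ z]) (auto simp: mult.assoc)
    qed
    then show ?thesis
      by (intro bddI[of _ "\<bar>M\<bar> * N"]) (auto simp: bddD[OF bounded_op_real_part] left_diff_distrib)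
  qed
  let ?i = "fps_const (Quat 0 1 0 0)" and ?j = "fps_const (Quat 0 0 1 0)" and ?k = "fps_const (Quat 0 0 0 1)"
  let ?m = "fps_const (-1) :: quat fps"
  have b: "bounded_op (\<lambda>f. real_part (?m * (f * fps_const c)) * a)" for c
    using bounded_op_comp[OF bounded_op_comp[OF R bounded_op_const_left[of "-1"]] bounded_op_const_right[of c]] .
  \<comment> \<open>The real components commute with everything. For right multiplication by
    \<open>a\<close> the units can therefore stand to the left of the product, and for left
    multiplication, further below, to its right.\<close>
  have "bounded_op (\<lambda>f. real_part f * a + ?i * (real_part (?m * (f * ?i)) * a)
      + ?j * (real_part (?m * (f * ?j)) * a) + ?k * (real_part (?m * (f * ?k)) * a))"
    by (intro bounded_op_add R bounded_op_comp[OF bounded_op_const_left b])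
  moreover have "real_part f * a + ?i * (real_part (?m * (f * ?i)) * a)
      + ?j * (real_part (?m * (f * ?j)) * a) + ?k * (real_part (?m * (f * ?k)) * a) = f * a" for f
  proof -
    have "c * (real_part g * a) = (real_part g * c) * a" for c g
      by (simp only: mult.assoc[symmetric] real_fps_commute[OF real_fps_real_part, of g c])
    then show ?thesis
      by (subst (5) fps_expansion[of f]) (simp only: distrib_right)
  qed
  ultimately show "bounded_op (\<lambda>f. f * a)" by simp
  have "bounded_op (\<lambda>f. real_part f * a + (real_part (?m * (f * ?i)) * a) * ?i
      + (real_part (?m * (f * ?j)) * a) * ?j + (real_part (?m * (f * ?k)) * a) * ?k)"
    by (intro bounded_op_add R bounded_op_comp[OF bounded_op_const_right b])
  moreover have "real_part f * a + (real_part (?m * (f * ?i)) * a) * ?i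
      + (real_part (?m * (f * ?j)) * a) * ?j + (real_part (?m * (f * ?k)) * a) * ?k = a * f" for f
  proof -
    have "(real_part g * a) * c = a * (real_part g * c)" for c g
      by (simp only: mult.assoc real_fps_commute[OF real_fps_real_part, of g a])
    moreover have "real_part f * a = a * real_part f" by (rule real_fps_commute[OF real_fps_real_part])
    ultimately show ?thesis
      by (subst (5) fps_expansion[of f]) (simp only: distrib_left)
  qed
  ultimately show "bounded_op (\<lambda>f. a * f)" by simp
qed

section \<open>Left and right cyclic series\<close>

definition l2_of_real :: "real l2 \<Rightarrow> quat l2" where "l2_of_real x = L2 (\<lambda>n. of_real (cf x n))"

lemma cf_l2_of_real: "cf (l2_of_real x) n = of_real (cf x n)"
  using summable_cf[of x] by (simp add: l2_of_real_def cf_L2)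

lemma norm_l2_of_real: "norm (l2_of_real x) = norm x"
proof -
  have "(norm (l2_of_real x))\<^sup>2 = (norm x)\<^sup>2" by (simp add: norm_l2_sq cf_l2_of_real)
  then show ?thesis by simp
qed

lemma bounded_linear_l2_of_real: "bounded_linear l2_of_real"
  by (rule bounded_linear_intro[of _ 1])
     (auto intro!: l2_eqI simp: cf_l2_of_real cf_simps norm_l2_of_real scaleR_conv_of_real)

lemma l2_of_real_l2_shift: "l2_of_real ((l2_shift ^^ k) x) = (l2_shift ^^ k) (l2_of_real x)"
  by (rule l2_eqI) (simp add: cf_l2_of_real cf_l2_shift_funpow)

lemma map_prod_funpow:
  fixes f :: "'a \<Rightarrow> 'a" and g :: "'b \<Rightarrow> 'b"
  shows "(map_prod f g ^^ n) x = ((f ^^ n) (fst x), (g ^^ n) (snd x))"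
  by (induction n) simp_all

text \<open>Quaternions cannot act on the real second component, hence the real scalars. In return
  the expansion coefficients form a single real, and so central, series that multiplies both
  components.\<close>

interpretation P: shift_module "map_prod l2_shift l2_shift :: quat l2 \<times> real l2 \<Rightarrow> _" "(*\<^sub>R)"
proof
  show "x = 0" if "\<And>n. \<exists>y. x = (map_prod l2_shift l2_shift ^^ n) y" for x :: "quat l2 \<times> real l2"
  proof -
    have "fst x = 0" by (rule pure_l2_shift) (use that in \<open>auto simp: map_prod_funpow, metis fst_conv\<close>)
    moreover have "snd x = 0" by (rule pure_l2_shift) (use that in \<open>auto simp: map_prod_funpow, metis snd_conv\<close>)
    ultimately show ?thesis by (simp add: prod_eq_iff)
  qed
  show "norm (map_prod l2_shift l2_shift x) = norm x" for x :: "quat l2 \<times> real l2"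
    by (cases x) (simp add: norm_l2_shift norm_prod_def)
qed (auto simp: l2_shift_add l2_shift_scaleR scaleR_add_right scaleR_add_left)

lemma P_comb:
  "fst (P.comb N p u) = Q.comb N (\<lambda>k. of_real (p k)) (fst u)"
  "l2_of_real (snd (P.comb N p u)) = Q.comb N (\<lambda>k. of_real (p k)) (l2_of_real (snd u))"
proof -
  have f: "(map_prod l2_shift l2_shift ^^ k) (p k *\<^sub>R u) = ((l2_shift ^^ k) (p k *\<^sub>R fst u), (l2_shift ^^ k) (p k *\<^sub>R snd u))" for k
    by (simp add: map_prod_funpow)
  show "fst (P.comb N p u) = Q.comb N (\<lambda>k. of_real (p k)) (fst u)"
    unfolding P.comb_def Q.comb_def f by (simp add: fst_sum Q.act_of_real)
  show "l2_of_real (snd (P.comb N p u)) = Q.comb N (\<lambda>k. of_real (p k)) (l2_of_real (snd u))"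
    unfolding P.comb_def Q.comb_def f
    by (simp add: snd_sum Q.act_of_real linear_sum[OF bounded_linear.linear[OF bounded_linear_l2_of_real]]
        l2_of_real_l2_shift linear_cmul[OF bounded_linear.linear[OF bounded_linear_l2_of_real]])
qed

text \<open>Beurling's theorem over the real scalars, applied to the pair \<open>(h, 1)\<close>.\<close>

lemma bounded_quotient:
  fixes h :: "quat l2"
  obtains X B a p s t where "real_fps X" "real_fps B" "X * B = 1" "fp h = X * fp a"
    "bounded_op (\<lambda>f. f * fp a)" "bounded_op (\<lambda>f. fp a * f)" "bounded_op (\<lambda>f. f * B)"
    "\<And>N. finite_fps (p N)" "\<And>N. real_fps (p N)"
    "\<And>N. fp (s N) = p N * fp a" "s \<longlonglongrightarrow> h" "\<And>N. fp (t N) = p N * B" "t \<longlonglongrightarrow> e0"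
proof -
  define e :: "real l2" where "e = L2 (\<lambda>n. if n = 0 then 1 else 0)"
  have e: "cf e n = (if n = 0 then 1 else 0)" for n
  proof -
    have "summable (\<lambda>n. (norm (if n = 0 then 1 else 0 :: real))\<^sup>2)"
      by (rule summable_finite[of "{0}"]) auto
    then show ?thesis by (simp add: e_def cf_L2)
  qed
  have rqe: "l2_of_real e = e0" by (rule l2_eqI) (simp add: cf_l2_of_real e cf_e0)
  have "(h, e) \<noteq> 0"
  proof
    assume "(h, e) = 0"
    then have "e = 0" by (simp add: zero_prod_def)
    then have "cf e 0 = cf 0 0" by simp
    then show False by (simp add: e cf_simps)
  qed
  obtain u d where u: "norm u = 1" "u \<in> closure (P.cyc (h, e))"
    "\<And>n c. u \<bullet> (map_prod l2_shift l2_shift ^^ Suc n) (c *\<^sub>R u) = 0"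
    "summable (\<lambda>n. (norm (d n))\<^sup>2)" "(\<lambda>N. P.comb N d u) \<longlonglongrightarrow> (h, e)"
    by (rule P.wold_beurling[OF \<open>(h, e) \<noteq> 0\<close>]) (rule that)
  define X where "X = Abs_fps (\<lambda>k. of_real (d k) :: quat)"
  define q where "q k = (of_real (d k) :: quat)" for k
  define a where "a = fst u"
  define b where "b = l2_of_real (snd u)"
  define B where "B = fp b"
  have s: "(\<lambda>N. Q.comb N q a) \<longlonglongrightarrow> h"
    using tendsto_fst[OF u(5)] by (simp add: P_comb q_def[abs_def] a_def)
  have t: "(\<lambda>N. Q.comb N q b) \<longlonglongrightarrow> e0"
    using bounded_linear.tendsto[OF bounded_linear_l2_of_real tendsto_snd[OF u(5)]]
    by (simp add: P_comb q_def[abs_def] b_def rqe)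
  have Xq: "X = Abs_fps q" by (simp add: X_def q_def[abs_def])
  have rX: "real_fps X" and rB: "real_fps B"
    by (auto simp: real_fps_def X_def B_def b_def cf_l2_of_real)
  \<comment> \<open>Expansion along the wandering pair is isometric on real series, and each
    component of a pair is no larger than the pair. Hence both components multiply real series
    contractively.\<close>
  have mult: "\<exists>y z. fp y = fp x * fp a \<and> norm y \<le> 1 * norm x \<and> fp z = fp x * B \<and> norm z \<le> 1 * norm x"
    if r: "real_fps (fp x)" for x
  proof -
    define p where "p n = qRe (cf x n)" for n
    have p: "cf x n = of_real (p n)" for n using r by (simp add: real_fps_def p_def)
    have sm: "summable (\<lambda>n. (norm (p n))\<^sup>2)" using summable_cf[of x] by (simp add: p)
    obtain y where y: "(\<lambda>N. P.comb N p u) \<longlonglongrightarrow> y" "(norm y)\<^sup>2 = (\<Sum>n. (norm (p n))\<^sup>2)"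
      using P.comb_wandering_converges[OF u(1,3) sm] by blast
    have "(norm y)\<^sup>2 = (norm x)\<^sup>2"
      using y(2) norm_l2_sq[of x] by (simp add: p)
    then have "norm y = norm x" by (rule power2_eq_imp_eq) auto
    then have n: "norm (fst y) \<le> norm x" "norm (l2_of_real (snd y)) \<le> norm x"
      using norm_fst_le[of "fst y" "snd y"] norm_snd_le[of "snd y" "fst y"] by (auto simp: norm_l2_of_real)
    have "(\<lambda>N. Q.comb N (cf x) a) \<longlonglongrightarrow> fst y"
      using tendsto_fst[OF y(1)] by (simp add: P_comb a_def p[abs_def])
    from fp_comb_limit[OF this] have 1: "fp (fst y) = fp x * fp a" by (simp add: fp_def)
    have "(\<lambda>N. Q.comb N (cf x) b) \<longlonglongrightarrow> l2_of_real (snd y)"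
      using bounded_linear.tendsto[OF bounded_linear_l2_of_real tendsto_snd[OF y(1)]] by (simp add: P_comb b_def p[abs_def])
    from fp_comb_limit[OF this] have 2: "fp (l2_of_real (snd y)) = fp x * B" by (simp add: fp_def B_def)
    show ?thesis using 1 2 n by (intro exI[of _ "fst y"] exI[of _ "l2_of_real (snd y)"]) simp
  qed
  have A: "\<exists>M. \<forall>x. real_fps (fp x) \<longrightarrow> (\<exists>y. fp y = fp x * fp a \<and> norm y \<le> M * norm x)"
    using mult by blast
  have B: "\<exists>M. \<forall>x. real_fps (fp x) \<longrightarrow> (\<exists>y. fp y = fp x * B \<and> norm y \<le> M * norm x)"
    using mult by blast
  \<comment> \<open>The second component of the expansion of the pair says that \<open>B\<close> is
    inverse to \<open>X\<close>; with the first component, \<open>h\<close> becomes the quotient of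
    \<open>a\<close> by the central series \<open>B\<close>.\<close>
  have XB: "X * B = 1" using fp_comb_limit[OF t] by (simp add: Xq B_def fp_e0)
  have XA: "fp h = X * fp a" using fp_comb_limit[OF s] by (simp add: Xq)
  show thesis
    by (rule that[OF rX rB XB XA bounded_op_mult_of_real[OF A] bounded_op_mult_of_real(1)[OF B] finite_fps_trunc[of _ q] _ fp_comb s _ t])
       (auto simp: real_fps_def trunc_def q_def fp_comb B_def)
qed

lemma bounded_op_fps_cnj:
  assumes "bounded_op (\<lambda>f. f * a)"
  shows "bounded_op (\<lambda>f. fps_cnj a * f)"
proof -
  obtain M where M: "\<And>x. \<exists>y. fp y = fp x * a \<and> norm y \<le> M * norm x" using assms unfolding bounded_op_def by blast
  have "\<exists>y. fp y = fps_cnj a * fp x \<and> norm y \<le> M * norm x" for x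
  proof -
    obtain y where "fp y = fp (l2_cnj x) * a" "norm y \<le> M * norm (l2_cnj x)" using M by blast
    then show ?thesis by (intro exI[of _ "l2_cnj y"]) (simp add: fp_l2_cnj fps_cnj_simps l2_cnj_simps)
  qed
  then show ?thesis by (intro bddI[of _ M]) (simp_all add: algebra_simps)
qed

definition right_cyclic :: "quat l2 \<Rightarrow> bool" where "right_cyclic g \<longleftrightarrow> left_cyclic (l2_cnj g)"

lemma right_cyclic_iff: "right_cyclic g \<longleftrightarrow> (\<exists>y p. (\<forall>j. finite_fps (p j) \<and> fp (y j) = fp g * p j) \<and> y \<longlonglongrightarrow> e0)"
proof
  assume "right_cyclic g"
  then obtain y p where yp: "\<And>j. finite_fps (p j)" "\<And>j. fp (y j) = p j * fp (l2_cnj g)" "y \<longlonglongrightarrow> e0"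
    unfolding right_cyclic_def left_cyclic_iff by blast
  have "(\<lambda>j. l2_cnj (y j)) \<longlonglongrightarrow> e0" using tendsto_l2_cnj[OF yp(3)] by (simp add: l2_cnj_e0)
  then show "\<exists>y p. (\<forall>j. finite_fps (p j) \<and> fp (y j) = fp g * p j) \<and> y \<longlonglongrightarrow> e0"
    using yp(1,2) by (intro exI[of _ "\<lambda>j. l2_cnj (y j)"] exI[of _ "\<lambda>j. fps_cnj (p j)"]) (auto simp: fp_l2_cnj fps_cnj_simps finite_fps_fps_cnj)
next
  assume "\<exists>y p. (\<forall>j. finite_fps (p j) \<and> fp (y j) = fp g * p j) \<and> y \<longlonglongrightarrow> e0"
  then obtain y p where yp: "\<And>j. finite_fps (p j)" "\<And>j. fp (y j) = fp g * p j" "y \<longlonglongrightarrow> e0" by blast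
  have "(\<lambda>j. l2_cnj (y j)) \<longlonglongrightarrow> e0" using tendsto_l2_cnj[OF yp(3)] by (simp add: l2_cnj_e0)
  then show "right_cyclic g" unfolding right_cyclic_def left_cyclic_iff
    using yp(1,2) by (intro exI[of _ "\<lambda>j. l2_cnj (y j)"] exI[of _ "\<lambda>j. fps_cnj (p j)"]) (auto simp: fp_l2_cnj fps_cnj_simps finite_fps_fps_cnj)
qed

text \<open>With \<open>B * h = a\<close> bounded, \<open>B * g * p \<rightarrow> B\<close> gives \<open>a\<^sup>c * a * \<psi> * p \<rightarrow> a\<^sup>c * B\<close>.  Since \<open>a\<^sup>c * a\<close> is
  central, the limit is divisible by \<open>\<psi>\<close> from the left; hence so is \<open>a\<^sup>c\<close>, and \<open>\<psi>\<^sup>c\<close> divides \<open>h\<close>, which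
  is impossible for cyclic \<open>h\<close> unless \<open>\<psi>\<close> is constant.\<close>

theorem inner_right_factor_constant:
  assumes gh: "fp g = fp h * \<psi>" and R: "right_isometric \<psi>" and L: "left_isometric \<psi>" and "left_cyclic h" "right_cyclic g"
  shows "\<exists>c. norm c = 1 \<and> \<psi> = fps_const c"
proof -
  obtain X B a p s t where q: "real_fps X" "real_fps B" "X * B = 1" "fp h = X * fp a"
    "bounded_op (\<lambda>f. f * fp a)" "bounded_op (\<lambda>f. fp a * f)" "bounded_op (\<lambda>f. f * B)"
    "\<And>N. finite_fps (p N)" "\<And>N. real_fps (p N)"
    "\<And>N. fp (s N) = p N * fp a" "s \<longlonglongrightarrow> h" "\<And>N. fp (t N) = p N * B" "t \<longlonglongrightarrow> e0"
    using bounded_quotient[of h] by blast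
  obtain y P where y: "\<And>j. finite_fps (P j)" "\<And>j. fp (y j) = fp g * P j" "y \<longlonglongrightarrow> e0"
    using \<open>right_cyclic g\<close> unfolding right_cyclic_iff by blast
  have Bh: "fp h * B = fp a"
    by (metis q(1-4) real_fps_commute mult.assoc mult_1)
  have b1: "bounded_op (\<lambda>f. fps_cnj (fp a) * f)" by (rule bounded_op_fps_cnj[OF q(5)])
  have "bounded_op (\<lambda>f. fps_cnj (fp a) * (f * B))" using bounded_op_comp[OF b1 q(7)] .
  from bounded_op_tendsto[OF this y(3)] obtain W w where
    W: "\<And>j. fp (W j) = fps_cnj (fp a) * (fp (y j) * B)" "fp w = fps_cnj (fp a) * (fp e0 * B)" "W \<longlonglongrightarrow> w" by blast
  have bb: "bounded_op (\<lambda>f. fps_cnj (fp a) * (fp a * f))" using bounded_op_comp[OF b1 q(6)] .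
  \<comment> \<open>The central \<open>B\<close> moves next to \<open>h\<close> and turns it into
    \<open>a\<close>; the central symmetrization of \<open>a\<close> then moves past
    \<open>\<psi>\<close>, which comes to stand on the far left.\<close>
  have "\<exists>m. fp (W j) = \<psi> * fp m" for j
  proof -
    obtain z where z: "fp z = P j" using finite_fps_l2[OF y(1)] by blast
    obtain m where m: "fp m = fps_cnj (fp a) * (fp a * fp z)" using bb unfolding bounded_op_def by blast
    have "fp (W j) = fps_cnj (fp a) * (fp h * (\<psi> * P j * B))" by (simp add: W y gh mult.assoc)
    also have "\<psi> * P j * B = B * (\<psi> * P j)" using real_fps_commute[OF q(2), of "\<psi> * P j"] by simp
    also have "fps_cnj (fp a) * (fp h * (B * (\<psi> * P j))) = (fps_cnj (fp a) * fp a) * (\<psi> * P j)"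
      by (simp only: Bh[symmetric] mult.assoc)
    also have "\<dots> = \<psi> * ((fps_cnj (fp a) * fp a) * P j)"
      using real_fps_commute[OF real_fps_cnj_mult, of "fp a" \<psi>] by (simp only: mult.assoc[symmetric])
    also have "\<dots> = \<psi> * fp m" by (simp only: m z mult.assoc)
    finally show ?thesis by blast
  qed
  then have "\<forall>j. \<exists>m. fp (W j) = \<psi> * fp m" by blast
  from choice[OF this] obtain M where "\<And>j. fp (W j) = \<psi> * fp (M j)" by blast
  from left_isometric_closed[OF L this W(3)] obtain m where m: "fp w = \<psi> * fp m" by blast
  \<comment> \<open>The factor \<open>B\<close> is removed by the real polynomials \<open>p\<close>
    with \<open>p * B\<close> tending to 1.\<close>
  from bounded_op_tendsto[OF b1 q(13)] obtain V v where
    V: "\<And>j. fp (V j) = fps_cnj (fp a) * fp (t j)" "fp v = fps_cnj (fp a) * fp e0" "V \<longlonglongrightarrow> v" by blast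
  have "\<exists>n. fp (V j) = \<psi> * fp n" for j
  proof -
    obtain n where n: "fp n = fp m * p j" using finite_fps_mult_right[OF q(8)] by blast
    have "fp (V j) = fps_cnj (fp a) * (B * p j)" by (simp add: V q(12) real_fps_commute[OF q(9)])
    also have "\<dots> = fp w * p j" by (simp add: W fp_e0 mult.assoc)
    also have "\<dots> = \<psi> * fp n" by (simp add: m n mult.assoc)
    finally show ?thesis by blast
  qed
  then have "\<forall>j. \<exists>n. fp (V j) = \<psi> * fp n" by blast
  from choice[OF this] obtain M' where "\<And>j. fp (V j) = \<psi> * fp (M' j)" by blast
  from left_isometric_closed[OF L this V(3)] obtain m' where "fps_cnj (fp a) = \<psi> * fp m'" using V(2) by (auto simp: fp_e0)
  from arg_cong[OF this, of fps_cnj] have am: "fp a = fp (l2_cnj m') * fps_cnj \<psi>" by (simp add: fps_cnj_simps fp_l2_cnj)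
  have R': "right_isometric (fps_cnj \<psi>)" using L by (simp add: left_isometric_iff)
  \<comment> \<open>The same polynomials satisfy \<open>p * a -> h\<close>, which carries the right
    factor \<open>fps_cnj \<psi>\<close> from \<open>a\<close> over to \<open>h\<close>.\<close>
  have "\<forall>j. \<exists>n. fp n = p j * fp (l2_cnj m')" using finite_fps_mult_left[OF q(8)] by blast
  from choice[OF this] obtain S where S: "\<And>j. fp (S j) = p j * fp (l2_cnj m')" by blast
  have "fp (s j) = fp (S j) * fps_cnj \<psi>" for j by (simp add: S q(10) am mult.assoc)
  from right_isometric_closed[OF R' this q(11)] obtain m2 where hm: "fp h = fp m2 * fps_cnj \<psi>" by blast
  obtain z r where z: "\<And>j. finite_fps (r j)" "\<And>j. fp (z j) = r j * fp h" "z \<longlonglongrightarrow> e0"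
    using \<open>left_cyclic h\<close> unfolding left_cyclic_iff by blast
  have "\<forall>j. \<exists>n. fp n = r j * fp m2" using finite_fps_mult_left[OF z(1)] by blast
  from choice[OF this] obtain S' where S': "\<And>j. fp (S' j) = r j * fp m2" by blast
  have "fp (z j) = fp (S' j) * fps_cnj \<psi>" for j by (simp add: S' z(2) hm mult.assoc)
  \<comment> \<open>Left cyclicity of \<open>h\<close> carries the factor on to 1. Comparing
    constant terms, with \<open>m3\<close> of norm 1, bounds the constant term of
    \<open>\<psi>\<close> from below by 1.\<close>
  from right_isometric_closed[OF R' this z(3)] obtain m3 where e: "fp e0 = fp m3 * fps_cnj \<psi>" by blast
  have n3: "norm m3 = 1" using right_isometric_norm[OF R' e] norm_e0 by simp
  obtain k where k: "fp k = \<psi>" "norm k = 1" using right_isometric_l2[OF R] by blast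
  have "1 = cf m3 0 * qcnj (cf k 0)"
    using arg_cong[OF e, of "\<lambda>f. f $ 0"] by (simp add: fp_e0 k(1)[symmetric])
  then have "1 = norm (cf m3 0) * norm (cf k 0)" by (metis norm_one norm_mult qcnj_simps(7))
  also have "\<dots> \<le> 1 * norm (cf k 0)"
    using norm_cf_le[of m3 0] n3 by (intro mult_right_mono) auto
  finally have "1 \<le> norm (cf k 0)" by simp
  from norm_one_constant[OF k(2) this] show ?thesis using k(1) by blast
qed

section \<open>Slices and boundary values\<close>

definition slice :: "quat \<Rightarrow> complex \<Rightarrow> quat" where
  "slice I z = of_real (Re z) + I * of_real (Im z)"

text \<open>Together with \<open>ssum\<close> this separates the imaginary unit from the rest: on
  the slice through \<open>I\<close> the series is \<open>csum a z + I * ssum a z\<close>, with both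
  sums independent of \<open>I\<close>. It is the representation formula for slice
  functions.\<close>

definition csum :: "(nat \<Rightarrow> quat) \<Rightarrow> complex \<Rightarrow> quat" where
  "csum a z = (\<Sum>n. Re (z ^ n) *\<^sub>R a n)"

definition ssum :: "(nat \<Rightarrow> quat) \<Rightarrow> complex \<Rightarrow> quat" where
  "ssum a z = (\<Sum>n. Im (z ^ n) *\<^sub>R a n)"

lemma imag_unitsD: "I \<in> imag_units \<Longrightarrow> I * I = -1"
  by (simp add: imag_units_def power2_eq_square)

lemma norm_imag_unit: "I \<in> imag_units \<Longrightarrow> norm I = 1"
  by (simp add: imag_units_iff norm_quat_def)

lemma slice_alt: "slice I z = Re z *\<^sub>R 1 + Im z *\<^sub>R I"
  unfolding slice_def by (simp add: quat_eq_iff quat_mult_sel)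

lemma slice_mult: "I \<in> imag_units \<Longrightarrow> slice I (z * w) = slice I z * slice I w"
  unfolding slice_alt by (simp add: algebra_simps imag_unitsD)

lemma slice_power: "I \<in> imag_units \<Longrightarrow> slice I (z ^ n) = slice I z ^ n"
  by (induction n) (auto simp: slice_mult, simp add: slice_def)

lemma slice_of_real: "slice I (of_real r) = of_real r"
  by (simp add: slice_def)

lemma slice_cis: "slice I (cis t) = qexp t I"
  by (simp add: slice_def qexp_def)

lemma slice_polar: "I \<in> imag_units \<Longrightarrow> slice I (of_real r * cis t) = of_real r * qexp t I"
  by (simp add: slice_mult slice_of_real slice_cis)

lemma norm_slice: "I \<in> imag_units \<Longrightarrow> norm (slice I z) = norm z"
  unfolding imag_units_iff norm_quat_def cmod_def slice_def
  by (simp add: quat_mult_sel power_mult_distrib add.assoc flip: distrib_right)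

lemma ex_slice: "\<exists>I\<in>imag_units. \<exists>z. q = slice I z"
proof -
  define v where "v = sqrt ((qI q)\<^sup>2 + (qJ q)\<^sup>2 + (qK q)\<^sup>2)"
  have v2: "v\<^sup>2 = (qI q)\<^sup>2 + (qJ q)\<^sup>2 + (qK q)\<^sup>2" by (simp add: v_def)
  show ?thesis
  proof (cases "v = 0")
    case True
    then have "qI q = 0 \<and> qJ q = 0 \<and> qK q = 0"
      using v2 by (simp add: add_nonneg_eq_0_iff)
    then have "q = slice (Quat 0 1 0 0) (of_real (qRe q))"
      by (simp add: quat_eq_iff slice_def)
    moreover have "Quat 0 1 0 0 \<in> imag_units" by (simp add: imag_units_iff)
    ultimately show ?thesis by blast
  next
    case False
    define I where "I = Quat 0 (qI q / v) (qJ q / v) (qK q / v)"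
    have "I \<in> imag_units"
      using False v2[symmetric] by (simp add: I_def imag_units_iff power_divide flip: add_divide_distrib)
    moreover have "q = slice I (Complex (qRe q) v)"
      using False by (simp add: quat_eq_iff slice_def I_def quat_mult_sel)
    ultimately show ?thesis by blast
  qed
qed

lemma summable_coeff:
  assumes "ell2 a" "norm z < 1" "\<And>n. \<bar>c n\<bar> \<le> norm z ^ n"
  shows "summable (\<lambda>n. c n *\<^sub>R a n)"
proof (rule summable_norm_cancel, rule summable_comparison_test'[of _ 0])
  show "summable (\<lambda>n. norm z ^ n * norm (a n))"
    using assms by (intro square_summable_power) (auto simp: ell2_def)
  show "norm (norm (c n *\<^sub>R a n)) \<le> norm z ^ n * norm (a n)" for n
    using assms(3)[of n] by (auto intro: mult_right_mono)
qed

lemma abs_Re_power: "\<bar>Re (z ^ n)\<bar> \<le> norm z ^ n" and abs_Im_power: "\<bar>Im (z ^ n)\<bar> \<le> norm z ^ n"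
  by (metis abs_Re_le_cmod norm_power, metis abs_Im_le_cmod norm_power)

lemma csum_sums: "ell2 a \<Longrightarrow> norm z < 1 \<Longrightarrow> (\<lambda>n. Re (z ^ n) *\<^sub>R a n) sums csum a z"
  unfolding csum_def by (intro summable_sums summable_coeff[of _ z] abs_Re_power)

lemma ssum_sums: "ell2 a \<Longrightarrow> norm z < 1 \<Longrightarrow> (\<lambda>n. Im (z ^ n) *\<^sub>R a n) sums ssum a z"
  unfolding ssum_def by (intro summable_sums summable_coeff[of _ z] abs_Im_power)

lemma slice_mult_left: "slice I z * q = Re z *\<^sub>R q + I * (Im z *\<^sub>R q)"
  by (simp add: slice_def algebra_simps scaleR_conv_of_real)

lemma qseries_sums_slice:
  assumes "ell2 a" "I \<in> imag_units" "norm z < 1"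
  shows "(\<lambda>n. slice I z ^ n * a n) sums (csum a z + I * ssum a z)"
proof -
  have "(\<lambda>n. slice I (z ^ n) * a n) sums (csum a z + I * ssum a z)"
    unfolding slice_mult_left
    by (intro sums_add csum_sums sums_mult ssum_sums assms)
  then show ?thesis by (simp add: slice_power assms)
qed

lemma qseries_slice:
  assumes "ell2 a" "I \<in> imag_units" "norm z < 1"
  shows "qseries a (slice I z) = csum a z + I * ssum a z"
  unfolding qseries_def using sums_unique[OF qseries_sums_slice[OF assms]] by simp

lemma ell2_component:
  assumes "ell2 a"
  shows "summable (\<lambda>n. (qRe (a n))\<^sup>2)" "summable (\<lambda>n. (qI (a n))\<^sup>2)"
    "summable (\<lambda>n. (qJ (a n))\<^sup>2)" "summable (\<lambda>n. (qK (a n))\<^sup>2)"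
  by (rule summable_comparison_test'[of "\<lambda>n. (norm (a n))\<^sup>2" 0];
      use assms in \<open>simp add: ell2_def norm_quat_def\<close>)+

lemma quat_sums_iff:
  "f sums l \<longleftrightarrow> (\<lambda>n. qRe (f n)) sums qRe l \<and> (\<lambda>n. qI (f n)) sums qI l
    \<and> (\<lambda>n. qJ (f n)) sums qJ l \<and> (\<lambda>n. qK (f n)) sums qK l"
proof
  have "bounded_linear qRe" "bounded_linear qI" "bounded_linear qJ" "bounded_linear qK"
    by (rule bounded_linear_intro[of _ 1]; simp add: norm_quat_def real_sqrt_ge_abs1;
        intro real_le_rsqrt; simp)+
  moreover assume "f sums l"
  ultimately show "(\<lambda>n. qRe (f n)) sums qRe l \<and> (\<lambda>n. qI (f n)) sums qI l
    \<and> (\<lambda>n. qJ (f n)) sums qJ l \<and> (\<lambda>n. qK (f n)) sums qK l"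
    using bounded_linear.sums by blast
next
  assume *: "(\<lambda>n. qRe (f n)) sums qRe l \<and> (\<lambda>n. qI (f n)) sums qI l
    \<and> (\<lambda>n. qJ (f n)) sums qJ l \<and> (\<lambda>n. qK (f n)) sums qK l"
  have e: "x = qRe x *\<^sub>R 1 + qI x *\<^sub>R Quat 0 1 0 0 + qJ x *\<^sub>R Quat 0 0 1 0 + qK x *\<^sub>R Quat 0 0 0 1" for x
    by (simp add: quat_eq_iff)
  have "(\<lambda>n. qRe (f n) *\<^sub>R 1 + qI (f n) *\<^sub>R Quat 0 1 0 0 + qJ (f n) *\<^sub>R Quat 0 0 1 0 + qK (f n) *\<^sub>R Quat 0 0 0 1)
    sums (qRe l *\<^sub>R 1 + qI l *\<^sub>R Quat 0 1 0 0 + qJ l *\<^sub>R Quat 0 0 1 0 + qK l *\<^sub>R Quat 0 0 0 1)"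
    using * by (intro sums_add sums_scaleR_left) auto
  then show "f sums l" using e by simp
qed

lemma csum_psum:
  assumes "ell2 a" "norm z < 1"
  shows "csum a z = Quat (Re (psum (\<lambda>n. qRe (a n)) z)) (Re (psum (\<lambda>n. qI (a n)) z))
      (Re (psum (\<lambda>n. qJ (a n)) z)) (Re (psum (\<lambda>n. qK (a n)) z))"
    "ssum a z = Quat (Im (psum (\<lambda>n. qRe (a n)) z)) (Im (psum (\<lambda>n. qI (a n)) z))
      (Im (psum (\<lambda>n. qJ (a n)) z)) (Im (psum (\<lambda>n. qK (a n)) z))"
proof -
  note * = ell2_component[OF assms(1), THEN psum_sums, OF assms(2)]
  show "csum a z = Quat (Re (psum (\<lambda>n. qRe (a n)) z)) (Re (psum (\<lambda>n. qI (a n)) z))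
      (Re (psum (\<lambda>n. qJ (a n)) z)) (Re (psum (\<lambda>n. qK (a n)) z))"
    by (rule sums_unique2[OF csum_sums[OF assms]])
       (use *[THEN sums_Re] in \<open>simp add: quat_sums_iff mult.commute\<close>)
  show "ssum a z = Quat (Im (psum (\<lambda>n. qRe (a n)) z)) (Im (psum (\<lambda>n. qI (a n)) z))
      (Im (psum (\<lambda>n. qJ (a n)) z)) (Im (psum (\<lambda>n. qK (a n)) z))"
    by (rule sums_unique2[OF ssum_sums[OF assms]])
       (use *[THEN sums_Im] in \<open>simp add: quat_sums_iff mult.commute\<close>)
qed

lemma Quat_expand: "Quat a b c d = a *\<^sub>R 1 + b *\<^sub>R Quat 0 1 0 0 + c *\<^sub>R Quat 0 0 1 0 + d *\<^sub>R Quat 0 0 0 1"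
  by (simp add: quat_eq_iff)

lemma tendsto_Quat:
  assumes "(f \<longlongrightarrow> a) F" "(g \<longlongrightarrow> b) F" "(h \<longlongrightarrow> c) F" "(k \<longlongrightarrow> d) F"
  shows "((\<lambda>x. Quat (f x) (g x) (h x) (k x)) \<longlongrightarrow> Quat a b c d) F"
  unfolding Quat_expand[of "f _"] Quat_expand[of a] by (intro tendsto_intros assms)

lemma continuous_on_csum:
  assumes "ell2 a"
  shows "continuous_on (ball 0 1) (csum a)" "continuous_on (ball 0 1) (ssum a)"
proof -
  note * = ell2_component[OF assms, THEN psum_holomorphic, THEN holomorphic_on_imp_continuous_on]
  have "continuous_on (ball 0 1) (\<lambda>z. Quat (Re (psum (\<lambda>n. qRe (a n)) z)) (Re (psum (\<lambda>n. qI (a n)) z))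
      (Re (psum (\<lambda>n. qJ (a n)) z)) (Re (psum (\<lambda>n. qK (a n)) z)))"
    unfolding Quat_expand[of "Re _"] by (intro continuous_intros *)
  then show "continuous_on (ball 0 1) (csum a)"
    by (rule continuous_on_eq) (simp add: csum_psum assms)
  have "continuous_on (ball 0 1) (\<lambda>z. Quat (Im (psum (\<lambda>n. qRe (a n)) z)) (Im (psum (\<lambda>n. qI (a n)) z))
      (Im (psum (\<lambda>n. qJ (a n)) z)) (Im (psum (\<lambda>n. qK (a n)) z)))"
    unfolding Quat_expand[of "Im _"] by (intro continuous_intros *)
  then show "continuous_on (ball 0 1) (ssum a)"
    by (rule continuous_on_eq) (simp add: csum_psum assms)
qed

lemma eventually_at_left_1: "\<forall>\<^sub>F r in at_left (1::real). 0 < r \<and> r < 1"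
  by (rule eventually_at_left_real[of 0, THEN eventually_mono]) auto

theorem radial_limit_exists:
  assumes "ell2 a"
  shows "AE t in lborel. t \<in> {0..2*pi} \<longrightarrow> (\<exists>B C. ((\<lambda>r. csum a (of_real r * cis t)) \<longlongrightarrow> B) (at_left 1) \<and>
     ((\<lambda>r. ssum a (of_real r * cis t)) \<longlongrightarrow> C) (at_left 1))"
  using ell2_component[OF assms, THEN fatou_radial_limit]
proof eventually_elim
  case (elim t)
  show ?case
  proof
    assume t: "t \<in> {0..2*pi}"
    from elim t obtain L1 L2 L3 L4 where L:
      "((\<lambda>r. psum (\<lambda>n. qRe (a n)) (of_real r * cis t)) \<longlongrightarrow> L1) (at_left 1)"
      "((\<lambda>r. psum (\<lambda>n. qI (a n)) (of_real r * cis t)) \<longlongrightarrow> L2) (at_left 1)"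
      "((\<lambda>r. psum (\<lambda>n. qJ (a n)) (of_real r * cis t)) \<longlongrightarrow> L3) (at_left 1)"
      "((\<lambda>r. psum (\<lambda>n. qK (a n)) (of_real r * cis t)) \<longlongrightarrow> L4) (at_left 1)" by blast
    have ev: "\<forall>\<^sub>F r in at_left 1. norm (of_real r * cis t) < 1"
      using eventually_at_left_1 by eventually_elim (auto simp: norm_mult)
    have "((\<lambda>r. csum a (of_real r * cis t)) \<longlongrightarrow> Quat (Re L1) (Re L2) (Re L3) (Re L4)) (at_left 1)"
      by (rule Lim_transform_eventually[OF tendsto_Quat[OF L[THEN tendsto_Re]]])
         (use ev in \<open>eventually_elim, simp add: csum_psum assms\<close>)
    moreover have "((\<lambda>r. ssum a (of_real r * cis t)) \<longlongrightarrow> Quat (Im L1) (Im L2) (Im L3) (Im L4)) (at_left 1)"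
      by (rule Lim_transform_eventually[OF tendsto_Quat[OF L[THEN tendsto_Im]]])
         (use ev in \<open>eventually_elim, simp add: csum_psum assms\<close>)
    ultimately show "\<exists>B C. ((\<lambda>r. csum a (of_real r * cis t)) \<longlongrightarrow> B) (at_left 1) \<and>
     ((\<lambda>r. ssum a (of_real r * cis t)) \<longlongrightarrow> C) (at_left 1)" by blast
  qed
qed

section \<open>Boundary functions and Parseval's identity on the boundary\<close>

text \<open>A fixed sequence of radii in the open unit interval turns radial limits into sequential
  ones. The boundary functions become plain limits of continuous functions and are measurable
  without a case distinction.\<close>

definition radii :: "nat \<Rightarrow> real" where "radii k = 1 - 1 / (real k + 2)"

lemma radii: "0 < radii k" "radii k < 1"
  by (auto simp: radii_def)

lemma radii_lim: "radii \<longlonglongrightarrow> 1"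
proof -
  have "(\<lambda>k. 1 - 1 / (real k + 2)) \<longlonglongrightarrow> 1" by real_asymp
  then show ?thesis by (simp add: radii_def[abs_def])
qed

lemma radii_filterlim: "filterlim radii (at_left 1) sequentially"
  unfolding filterlim_at using radii_lim radii(2) by (auto intro!: always_eventually) (metis less_irrefl)

text \<open>At the boundary point \<open>qexp t I\<close> the radial limit is \<open>bB a t + I * bC a t\<close>, for all
  imaginary units \<open>I\<close> at once.\<close>

definition bB :: "(nat \<Rightarrow> quat) \<Rightarrow> real \<Rightarrow> quat" where
  "bB a t = lim (\<lambda>k. csum a (of_real (radii k) * cis t))"

definition bC :: "(nat \<Rightarrow> quat) \<Rightarrow> real \<Rightarrow> quat" where
  "bC a t = lim (\<lambda>k. ssum a (of_real (radii k) * cis t))"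

definition radial :: "(nat \<Rightarrow> quat) \<Rightarrow> real \<Rightarrow> bool" where
  "radial a t \<longleftrightarrow> ((\<lambda>r. csum a (of_real r * cis t)) \<longlongrightarrow> bB a t) (at_left 1) \<and>
     ((\<lambda>r. ssum a (of_real r * cis t)) \<longlongrightarrow> bC a t) (at_left 1)"

lemma radialI:
  assumes "((\<lambda>r. csum a (of_real r * cis t)) \<longlongrightarrow> B) (at_left 1)"
    "((\<lambda>r. ssum a (of_real r * cis t)) \<longlongrightarrow> C) (at_left 1)"
  shows "radial a t" "bB a t = B" "bC a t = C"
proof -
  have "(\<lambda>k. csum a (of_real (radii k) * cis t)) \<longlonglongrightarrow> B" "(\<lambda>k. ssum a (of_real (radii k) * cis t)) \<longlonglongrightarrow> C"
    using filterlim_compose[OF assms(1) radii_filterlim] filterlim_compose[OF assms(2) radii_filterlim] by auto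
  then show "bB a t = B" "bC a t = C" unfolding bB_def bC_def by (auto dest: limI)
  then show "radial a t" using assms by (simp add: radial_def)
qed

lemma AE_radial:
  assumes "ell2 a"
  shows "AE t in lborel. t \<in> {0..2*pi} \<longrightarrow> radial a t"
  using radial_limit_exists[OF assms] by eventually_elim (use radialI(1) in blast)

lemma radial_diff:
  assumes "ell2 a" "ell2 b" "radial a t" "radial b t"
  shows "radial (\<lambda>n. a n - b n) t" "bB (\<lambda>n. a n - b n) t = bB a t - bB b t" "bC (\<lambda>n. a n - b n) t = bC a t - bC b t"
proof -
  have ev: "\<forall>\<^sub>F r in at_left 1. norm (of_real r * cis t) < 1"
    using eventually_at_left_1 by eventually_elim (auto simp: norm_mult)
  have eq: "csum (\<lambda>n. a n - b n) z = csum a z - csum b z" "ssum (\<lambda>n. a n - b n) z = ssum a z - ssum b z"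
    if "norm z < 1" for z
    using sums_diff[OF csum_sums[OF assms(1) that] csum_sums[OF assms(2) that]]
      sums_diff[OF ssum_sums[OF assms(1) that] ssum_sums[OF assms(2) that]]
    by (simp_all add: csum_def ssum_def sums_iff scaleR_diff_right)
  have 1: "((\<lambda>r. csum (\<lambda>n. a n - b n) (of_real r * cis t)) \<longlongrightarrow> bB a t - bB b t) (at_left 1)"
    by (rule Lim_transform_eventually[OF tendsto_diff[OF conjunct1[OF assms(3)[unfolded radial_def]]
            conjunct1[OF assms(4)[unfolded radial_def]]]])
       (use ev in \<open>eventually_elim, simp add: eq\<close>)
  have 2: "((\<lambda>r. ssum (\<lambda>n. a n - b n) (of_real r * cis t)) \<longlongrightarrow> bC a t - bC b t) (at_left 1)"
    by (rule Lim_transform_eventually[OF tendsto_diff[OF conjunct2[OF assms(3)[unfolded radial_def]]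
            conjunct2[OF assms(4)[unfolded radial_def]]]])
       (use ev in \<open>eventually_elim, simp add: eq\<close>)
  show "radial (\<lambda>n. a n - b n) t" "bB (\<lambda>n. a n - b n) t = bB a t - bB b t" "bC (\<lambda>n. a n - b n) t = bC a t - bC b t"
    using radialI[OF 1 2] by auto
qed

text \<open>The mean of the squared modulus at the points belonging to \<open>I\<close> and
  \<open>- I\<close>, for any imaginary unit \<open>I\<close>; the cross term is odd in
  \<open>I\<close> and cancels.\<close>

definition circle_energy :: "(nat \<Rightarrow> quat) \<Rightarrow> real \<Rightarrow> real \<Rightarrow> real" where
  "circle_energy a r t = (norm (csum a (of_real r * cis t)))\<^sup>2 + (norm (ssum a (of_real r * cis t)))\<^sup>2"

definition boundary_energy :: "(nat \<Rightarrow> quat) \<Rightarrow> real \<Rightarrow> real" where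
  "boundary_energy a t = (norm (bB a t))\<^sup>2 + (norm (bC a t))\<^sup>2"

lemma continuous_circle:
  assumes "ell2 a" "0 \<le> r" "r < 1"
  shows "continuous_on S (\<lambda>t. csum a (of_real r * cis t))" "continuous_on S (\<lambda>t. ssum a (of_real r * cis t))"
  by (rule continuous_on_compose2[OF continuous_on_csum(1)[OF assms(1)]]
        continuous_on_compose2[OF continuous_on_csum(2)[OF assms(1)]];
      use assms in \<open>auto intro!: continuous_intros simp: norm_mult\<close>)+

lemma continuous_circle_energy: "ell2 a \<Longrightarrow> 0 \<le> r \<Longrightarrow> r < 1 \<Longrightarrow> continuous_on S (circle_energy a r)"
  unfolding circle_energy_def[abs_def] by (intro continuous_intros continuous_circle)

lemma measurable_b:
  assumes "ell2 a"
  shows "bB a \<in> borel_measurable borel" "bC a \<in> borel_measurable borel" "boundary_energy a \<in> borel_measurable borel"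
proof -
  show B: "bB a \<in> borel_measurable borel" unfolding bB_def[abs_def]
    using radii by (intro borel_measurable_lim_metric borel_measurable_continuous_onI continuous_circle assms) (auto intro: less_imp_le)
  show C: "bC a \<in> borel_measurable borel" unfolding bC_def[abs_def]
    using radii by (intro borel_measurable_lim_metric borel_measurable_continuous_onI continuous_circle assms) (auto intro: less_imp_le)
  show "boundary_energy a \<in> borel_measurable borel" unfolding boundary_energy_def[abs_def]
    using B C by measurable
qed

lemma ell2_weight:
  assumes "ell2 a" "\<And>n. \<bar>c n\<bar> \<le> 1"
  shows "ell2 (\<lambda>n. c n *\<^sub>R a n)" "(\<Sum>n. (norm (c n *\<^sub>R a n))\<^sup>2) \<le> (\<Sum>n. (norm (a n))\<^sup>2)"
proof -
  have *: "(norm (c n *\<^sub>R a n))\<^sup>2 \<le> (norm (a n))\<^sup>2" for n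
    using assms(2)[of n] by (intro power_mono) (auto intro: mult_left_le_one_le)
  show e: "ell2 (\<lambda>n. c n *\<^sub>R a n)"
    unfolding ell2_def by (rule summable_comparison_test'[OF assms(1)[unfolded ell2_def], of 0]) (use * in auto)
  show "(\<Sum>n. (norm (c n *\<^sub>R a n))\<^sup>2) \<le> (\<Sum>n. (norm (a n))\<^sup>2)"
    using * e assms(1) unfolding ell2_def by (intro suminf_le)
qed

lemma csum_circle:
  "csum a (of_real r * cis t) = (\<Sum>n. cos (real n * t) *\<^sub>R (r ^ n *\<^sub>R a n))"
  "ssum a (of_real r * cis t) = (\<Sum>n. sin (real n * t) *\<^sub>R (r ^ n *\<^sub>R a n))"
  unfolding csum_def ssum_def
  by (simp_all add: power_mult_distrib Complex.DeMoivre mult.commute flip: of_real_power)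

lemma parseval_circle:
  assumes "ell2 a" "0 \<le> r" "r < 1"
  shows "(\<integral>\<^sup>+ t. ennreal (circle_energy a r t) * indicator {0..pi} t \<partial>lborel) = ennreal (pi * (\<Sum>n. (norm (r ^ n *\<^sub>R a n))\<^sup>2))"
proof -
  have "summable (\<lambda>n. norm (r ^ n *\<^sub>R a n))"
    using square_summable_power[of a r] assms by (simp add: ell2_def)
  from trig_parseval[OF this, of 1]
  have "(circle_energy a r has_integral (pi * (\<Sum>n. (norm (r ^ n *\<^sub>R a n))\<^sup>2))) {0..pi}"
    by (simp add: circle_energy_def[abs_def] csum_circle)
  then show ?thesis
    by (subst nn_integral_interval[OF continuous_circle_energy[OF assms]]) (auto simp: circle_energy_def integral_unique)
qed

text \<open>Fatou's lemma along \<open>radii\<close>: the circle energies converge almost everywhere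
  to the boundary energy, and on each circle Parseval applies to coefficients that have only been
  made smaller.\<close>

lemma parseval_boundary_le:
  assumes "ell2 a"
  shows "(\<integral>\<^sup>+ t. ennreal (boundary_energy a t) * indicator {0..pi} t \<partial>lborel) \<le> ennreal (pi * (\<Sum>n. (norm (a n))\<^sup>2))"
proof -
  have "(\<integral>\<^sup>+ t. ennreal (boundary_energy a t) * indicator {0..pi} t \<partial>lborel)
      = (\<integral>\<^sup>+ t. liminf (\<lambda>k. ennreal (circle_energy a (radii k) t) * indicator {0..pi} t) \<partial>lborel)"
  proof (rule nn_integral_cong_AE)
    show "AE t in lborel. ennreal (boundary_energy a t) * indicator {0..pi} t = liminf (\<lambda>k. ennreal (circle_energy a (radii k) t) * indicator {0..pi} t)"
      using AE_radial[OF assms]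
    proof eventually_elim
      case (elim t)
      show ?case
      proof (cases "t \<in> {0..pi}")
        case True
        then have "radial a t" using elim by auto
        then have "((\<lambda>r. circle_energy a r t) \<longlongrightarrow> boundary_energy a t) (at_left 1)"
          unfolding circle_energy_def boundary_energy_def radial_def by (intro tendsto_intros) auto
        then have "(\<lambda>k. circle_energy a (radii k) t) \<longlonglongrightarrow> boundary_energy a t" by (rule filterlim_compose[OF _ radii_filterlim])
        then have "(\<lambda>k. ennreal (circle_energy a (radii k) t)) \<longlonglongrightarrow> ennreal (boundary_energy a t)" by (rule tendsto_ennrealI)
        from lim_imp_Liminf[OF trivial_limit_sequentially this] show ?thesis using True by simp
      qed (simp add: Liminf_const)
    qed
  qed
  also have "\<dots> \<le> liminf (\<lambda>k. \<integral>\<^sup>+ t. ennreal (circle_energy a (radii k) t) * indicator {0..pi} t \<partial>lborel)"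
    using radii by (intro nn_integral_liminf borel_measurable_times_ennreal measurable_compose[OF _ measurable_ennreal])
      (auto intro!: borel_measurable_continuous_onI continuous_circle_energy assms less_imp_le)
  also have "\<dots> \<le> liminf (\<lambda>k. ennreal (pi * (\<Sum>n. (norm (a n))\<^sup>2)))"
  proof (rule Liminf_mono, rule always_eventually, rule allI)
    fix k
    have "\<bar>radii k ^ n\<bar> \<le> 1" for n using radii[of k] by (simp add: power_le_one less_imp_le)
    then show "(\<integral>\<^sup>+ t. ennreal (circle_energy a (radii k) t) * indicator {0..pi} t \<partial>lborel) \<le> ennreal (pi * (\<Sum>n. (norm (a n))\<^sup>2))"
      using radii[of k] ell2_weight(2)[OF assms, of "\<lambda>n. radii k ^ n"]
      by (subst parseval_circle) (auto intro!: ennreal_leI mult_left_mono assms)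
  qed
  finally show ?thesis by (simp add: Liminf_const)
qed

lemma weighted_limit:
  assumes "ell2 a" "\<And>k n. \<bar>c k n\<bar> \<le> 1" "\<And>n. (\<lambda>k. c k n) \<longlonglongrightarrow> l"
  shows "(\<lambda>k. \<Sum>n. (norm (c k n *\<^sub>R a n))\<^sup>2) \<longlonglongrightarrow> (\<Sum>n. (norm (l *\<^sub>R a n))\<^sup>2)"
proof (rule tannerys_theorem[THEN conjunct2, THEN conjunct2])
  show "(\<lambda>k. (norm (c k n *\<^sub>R a n))\<^sup>2) \<longlonglongrightarrow> (norm (l *\<^sub>R a n))\<^sup>2" for n
    by (intro tendsto_intros assms)
  have "norm ((norm (c k n *\<^sub>R a n))\<^sup>2) \<le> (norm (a n))\<^sup>2" for k n
    using assms(2)[of k n] by (auto intro!: power_mono mult_left_le_one_le)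
  then show "\<forall>\<^sub>F (n, k) in at_top \<times>\<^sub>F sequentially. norm ((norm (c k n *\<^sub>R a n))\<^sup>2) \<le> (norm (a n))\<^sup>2"
    by (intro always_eventually) auto
  show "summable (\<lambda>n. (norm (a n))\<^sup>2)" using assms(1) by (simp add: ell2_def)
qed simp

text \<open>For the reverse inequality the series is compared with its dilate. The dilate has known
  boundary energy, and the difference has small coefficients, so the inequality already proved makes
  its boundary energy small. First \<open>k\<close> tends to infinity, then
  \<open>\<epsilon>\<close> to 0.\<close>

theorem parseval_boundary:
  assumes a: "ell2 a"
  shows "(\<integral>\<^sup>+ t. ennreal (boundary_energy a t) * indicator {0..pi} t \<partial>lborel) = ennreal (pi * (\<Sum>n. (norm (a n))\<^sup>2))"
proof -
  define J where "J b = (\<integral>\<^sup>+ t. ennreal (boundary_energy b t) * indicator {0..pi} t \<partial>lborel)" for b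
  define e2 where "e2 b = (\<Sum>n. (norm (b n))\<^sup>2)" for b :: "nat \<Rightarrow> quat"
  have e2_0: "0 \<le> e2 b" if "ell2 b" for b using that unfolding e2_def ell2_def by (intro suminf_nonneg) auto
  define j where "j = enn2real (J a)"
  have Ja: "J a \<le> ennreal (pi * e2 a)" unfolding J_def e2_def by (rule parseval_boundary_le[OF a])
  then have j: "J a = ennreal j" "0 \<le> j" unfolding j_def
    by (auto simp: ennreal_enn2real_if top_unique)
  define d where "d k n = (1 - radii k ^ n) *\<^sub>R a n" for k n
  have pw: "0 \<le> radii k ^ n" "radii k ^ n \<le> 1" for k n using radii[of k] by (auto simp: power_le_one less_imp_le)
  have d: "ell2 (d k)" for k unfolding d_def using pw by (intro ell2_weight(1)[OF a]) (auto simp: abs_le_iff intro: order_trans[OF _ pw(2)])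
  define w where "w k n = radii k ^ n *\<^sub>R a n" for k n
  have w: "ell2 (w k)" for k unfolding w_def using pw by (intro ell2_weight(1)[OF a]) auto
  have dw: "d k = (\<lambda>n. a n - w k n)" for k by (auto simp: d_def w_def algebra_simps)
  have csw: "csum (w k) z = csum a (of_real (radii k) * z)" "ssum (w k) z = ssum a (of_real (radii k) * z)" for k z
    by (simp_all add: csum_def ssum_def w_def power_mult_distrib mult.commute flip: of_real_power)
  \<comment> \<open>The dilate is continuous across the unit circle, so its boundary functions are
    the values of the original sums on a smaller circle.\<close>
  have wl: "radial (w k) t" "bB (w k) t = csum a (of_real (radii k) * cis t)" "bC (w k) t = ssum a (of_real (radii k) * cis t)" for k t
  proof -
    have l: "((\<lambda>r. of_real (radii k) * (of_real r * cis t)) \<longlongrightarrow> of_real (radii k) * (of_real 1 * cis t)) (at_left 1)"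
      by (intro tendsto_intros)
    have b: "of_real (radii k) * cis t \<in> ball 0 1" using radii[of k] by (simp add: norm_mult)
    have c: "isCont (csum a) (of_real (radii k) * cis t)" "isCont (ssum a) (of_real (radii k) * cis t)"
      using continuous_on_csum[OF a] b by (auto simp: continuous_on_eq_continuous_at)
    have 1: "((\<lambda>r. csum (w k) (of_real r * cis t)) \<longlongrightarrow> csum a (of_real (radii k) * cis t)) (at_left 1)"
      unfolding csw using isCont_tendsto_compose[OF c(1)] l by simp
    have 2: "((\<lambda>r. ssum (w k) (of_real r * cis t)) \<longlongrightarrow> ssum a (of_real (radii k) * cis t)) (at_left 1)"
      unfolding csw using isCont_tendsto_compose[OF c(2)] l by simp
    show "radial (w k) t" "bB (w k) t = csum a (of_real (radii k) * cis t)" "bC (w k) t = ssum a (of_real (radii k) * cis t)"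
      using radialI[OF 1 2] by auto
  qed
  \<comment> \<open>A pointwise substitute for the triangle inequality in the space of square
    integrable functions, integrated afterwards.\<close>
  have sq: "(norm y)\<^sup>2 \<le> (1 + \<epsilon>) * (norm x)\<^sup>2 + (1 + 1 / \<epsilon>) * (norm (x - y))\<^sup>2" if "0 < \<epsilon>" for x y :: quat and \<epsilon> :: real
  proof -
    have "norm y \<le> norm x + norm (x - y)" using norm_triangle_ineq2[of y x] by (simp add: norm_minus_commute)
    then have "(norm y)\<^sup>2 \<le> (norm x + norm (x - y))\<^sup>2" by (intro power_mono) auto
    also have "\<dots> \<le> (1 + \<epsilon>) * (norm x)\<^sup>2 + (1 + 1 / \<epsilon>) * (norm (x - y))\<^sup>2"
    proof -
      define p q where "p = norm x" and "q = norm (x - y)"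
      have "0 \<le> (\<epsilon> * p - q)\<^sup>2 / \<epsilon>" using that by simp
      also have "(\<epsilon> * p - q)\<^sup>2 / \<epsilon> = \<epsilon> * p\<^sup>2 - 2 * p * q + q\<^sup>2 / \<epsilon>"
        using that by (simp add: power2_eq_square field_simps)
      finally show ?thesis unfolding p_def[symmetric] q_def[symmetric] by (simp add: power2_sum algebra_simps)
    qed
    finally show ?thesis .
  qed
  have key: "pi * e2 (w k) \<le> (1 + \<epsilon>) * j + (1 + 1 / \<epsilon>) * (pi * e2 (d k))" if e: "0 < \<epsilon>" for k \<epsilon>
  proof -
    have "ennreal (pi * e2 (w k)) = (\<integral>\<^sup>+ t. ennreal (circle_energy a (radii k) t) * indicator {0..pi} t \<partial>lborel)"
      unfolding e2_def w_def using radii[of k] by (subst parseval_circle[OF a]) auto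
    also have "\<dots> \<le> (\<integral>\<^sup>+ t. ennreal (1 + \<epsilon>) * (ennreal (boundary_energy a t) * indicator {0..pi} t)
        + ennreal (1 + 1 / \<epsilon>) * (ennreal (boundary_energy (d k) t) * indicator {0..pi} t) \<partial>lborel)"
    proof (rule nn_integral_mono_AE)
      show "AE t in lborel. ennreal (circle_energy a (radii k) t) * indicator {0..pi} t \<le> ennreal (1 + \<epsilon>) * (ennreal (boundary_energy a t) * indicator {0..pi} t)
        + ennreal (1 + 1 / \<epsilon>) * (ennreal (boundary_energy (d k) t) * indicator {0..pi} t)"
        using AE_radial[OF a]
      proof eventually_elim
        case (elim t)
        show ?case
        proof (cases "t \<in> {0..pi}")
          case True
          then have ra: "radial a t" using elim by auto
          note dd = radial_diff[OF a w[of k] ra wl(1), folded dw, unfolded wl(2,3)]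
          have "circle_energy a (radii k) t \<le> (1 + \<epsilon>) * boundary_energy a t + (1 + 1 / \<epsilon>) * boundary_energy (d k) t"
            using sq[OF e, of "csum a (of_real (radii k) * cis t)" "bB a t"] sq[OF e, of "ssum a (of_real (radii k) * cis t)" "bC a t"]
            unfolding circle_energy_def boundary_energy_def dd by (simp add: algebra_simps)
          then have "ennreal (circle_energy a (radii k) t) \<le> ennreal ((1 + \<epsilon>) * boundary_energy a t + (1 + 1 / \<epsilon>) * boundary_energy (d k) t)" by (rule ennreal_leI)
          also have "\<dots> = ennreal (1 + \<epsilon>) * ennreal (boundary_energy a t) + ennreal (1 + 1 / \<epsilon>) * ennreal (boundary_energy (d k) t)"
            using e by (subst ennreal_plus) (auto simp: boundary_energy_def ennreal_mult)
          finally show ?thesis using True by simp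
        qed simp
      qed
    qed
    also have "\<dots> = ennreal (1 + \<epsilon>) * J a + ennreal (1 + 1 / \<epsilon>) * J (d k)"
      unfolding J_def using measurable_b(3)[OF a] measurable_b(3)[OF d[of k]]
      by (subst nn_integral_add, simp, simp) (subst nn_integral_cmult, simp, subst nn_integral_cmult, simp, simp)
    also have "\<dots> \<le> ennreal (1 + \<epsilon>) * ennreal j + ennreal (1 + 1 / \<epsilon>) * ennreal (pi * e2 (d k))"
      using parseval_boundary_le[OF d[of k]] unfolding j J_def[symmetric] e2_def[symmetric]
      by (intro add_left_mono mult_left_mono) auto
    also have "\<dots> = ennreal ((1 + \<epsilon>) * j + (1 + 1 / \<epsilon>) * (pi * e2 (d k)))"
      using e j e2_0[OF d[of k]] by (subst ennreal_plus) (auto simp: ennreal_mult)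
    finally show ?thesis
      using e j e2_0[OF d[of k]] by (subst (asm) ennreal_le_iff) auto
  qed
  have lim1: "(\<lambda>k. e2 (w k)) \<longlonglongrightarrow> e2 a"
  proof -
    have "(\<lambda>k. \<Sum>n. (norm (radii k ^ n *\<^sub>R a n))\<^sup>2) \<longlonglongrightarrow> (\<Sum>n. (norm (1 *\<^sub>R a n))\<^sup>2)"
      using pw tendsto_power[OF radii_lim] by (intro weighted_limit[OF a]) auto
    then show ?thesis by (simp add: e2_def w_def)
  qed
  have lim2: "(\<lambda>k. e2 (d k)) \<longlonglongrightarrow> 0"
  proof -
    have "(\<lambda>k. 1 - radii k ^ n) \<longlonglongrightarrow> 0" for n
      using tendsto_diff[OF tendsto_const tendsto_power[OF radii_lim], of 1 n] by simp
    then have "(\<lambda>k. \<Sum>n. (norm ((1 - radii k ^ n) *\<^sub>R a n))\<^sup>2) \<longlonglongrightarrow> (\<Sum>n. (norm (0 *\<^sub>R a n))\<^sup>2)"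
      using pw by (intro weighted_limit[OF a]) (auto simp: abs_le_iff intro: order_trans[OF _ pw(2)])
    then show ?thesis by (simp add: e2_def d_def)
  qed
  have le: "pi * e2 a \<le> (1 + \<epsilon>) * j" if e: "0 < \<epsilon>" for \<epsilon>
  proof (rule LIMSEQ_le)
    show "(\<lambda>k. pi * e2 (w k)) \<longlonglongrightarrow> pi * e2 a" by (intro tendsto_intros lim1)
    have "(\<lambda>k. (1 + \<epsilon>) * j + (1 + 1 / \<epsilon>) * (pi * e2 (d k))) \<longlonglongrightarrow> (1 + \<epsilon>) * j + (1 + 1 / \<epsilon>) * (pi * 0)"
      by (intro tendsto_intros lim2)
    then show "(\<lambda>k. (1 + \<epsilon>) * j + (1 + 1 / \<epsilon>) * (pi * e2 (d k))) \<longlonglongrightarrow> (1 + \<epsilon>) * j" by simp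
  qed (use key[OF e] in auto)
  have "pi * e2 a \<le> j"
  proof (rule LIMSEQ_le_const)
    have "(\<lambda>k. (1 + 1 / real (Suc k)) * j) \<longlonglongrightarrow> (1 + 0) * j"
      by (intro tendsto_intros LIMSEQ_Suc[OF lim_1_over_n])
    then show "(\<lambda>k. (1 + 1 / real (Suc k)) * j) \<longlonglongrightarrow> j" by simp
    show "\<exists>N. \<forall>n\<ge>N. pi * e2 a \<le> (1 + 1 / real (Suc n)) * j" using le by auto
  qed
  then have "ennreal (pi * e2 a) \<le> J a" unfolding j by (rule ennreal_leI)
  with Ja show ?thesis unfolding J_def e2_def by (rule antisym)
qed

section \<open>The boundary measure\<close>

lemma AE_boundaryD:
  assumes "AE q in boundary_measure. P q"
  shows "AE t in lborel. t \<in> {0..2*pi} \<longrightarrow> (AE I in sphere_area. P (qexp t I))"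
proof -
  interpret S: prob_space sphere_area by (rule prob_space_sphere_area)
  interpret T: prob_space "uniform_measure lborel {0..2 * pi}"
    by (rule prob_space_uniform_measure) auto
  interpret Pr: pair_prob_space "uniform_measure lborel {0..2 * pi}" sphere_area ..
  have "AE x in uniform_measure lborel {0..2 * pi} \<Otimes>\<^sub>M sphere_area. P ((\<lambda>(t, I). qexp t I) x)"
    using AE_distrD[OF measurable_qexp assms[unfolded boundary_measure_def]] .
  from Pr.AE_pair[OF this]
  have "AE t in uniform_measure lborel {0..2 * pi}. AE I in sphere_area. P (qexp t I)" by simp
  then show ?thesis by (subst (asm) AE_uniform_measure) auto
qed

lemma AE_lborelD: "AE x in lborel. P x \<Longrightarrow> \<exists>N\<in>null_sets lborel. {x. \<not> P x} \<subseteq> N"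
  unfolding eventually_ae_filter by simp

text \<open>Inside the open coordinate rectangle the area density is positive and the set where
  \<open>w\<close> does not vanish is open; a null open set is empty. The poles and the meridian
  with azimuth 0 lie outside this chart.\<close>

lemma AE_sphere_continuous:
  fixes w :: "quat \<Rightarrow> 'b::real_normed_vector"
  assumes cont: "continuous_on UNIV w" and ae: "AE I in sphere_area. w I = 0"
    and "0 < \<theta>" "\<theta> < pi" "0 < \<phi>" "\<phi> < 2 * pi"
  shows "w (spherical (\<theta>, \<phi>)) = 0"
proof -
  let ?h = "\<lambda>(\<theta>, \<phi>). ennreal (indicator ({0..pi} \<times> {0..2 * pi}) (\<theta>, \<phi>) * (sin \<theta> / (4 * pi)))"
  have m: "?h \<in> borel_measurable (lborel \<Otimes>\<^sub>M lborel)"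
    unfolding case_prod_beta by measurable
  have "AE x in density (lborel \<Otimes>\<^sub>M lborel) ?h. w (spherical x) = 0"
    using AE_distrD[OF measurable_spherical ae[unfolded sphere_area_def]] .
  then have "AE x in lborel \<Otimes>\<^sub>M lborel. 0 < ?h x \<longrightarrow> w (spherical x) = 0"
    unfolding AE_density[OF m] .
  then have ae2: "AE x in lborel. 0 < ?h x \<longrightarrow> w (spherical x) = 0"
    unfolding lborel_prod .
  define U where "U = {0<..<pi} \<times> {0<..<2*pi}"
  define D where "D = U \<inter> (\<lambda>x. w (spherical x)) -` (- {0})"
  have sph: "continuous_on UNIV spherical"
  proof -
    have eq: "spherical = (\<lambda>x. (sin (fst x) * cos (snd x)) *\<^sub>R Quat 0 1 0 0
        + (sin (fst x) * sin (snd x)) *\<^sub>R Quat 0 0 1 0 + cos (fst x) *\<^sub>R Quat 0 0 0 1)"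
      by (auto simp: spherical_def fun_eq_iff quat_eq_iff)
    show ?thesis unfolding eq by (intro continuous_intros)
  qed
  have "continuous_on UNIV (\<lambda>x. w (spherical x))"
    by (rule continuous_on_compose2[OF cont sph]) auto
  then have "open ((\<lambda>x. w (spherical x)) -` (- {0}))"
    by (intro open_vimage) auto
  then have oD: "open D" unfolding D_def U_def by (intro open_Int open_Times) auto
  have pos: "0 < ?h x" if "x \<in> U" for x
    using that by (auto simp: U_def sin_gt_zero)
  obtain N where N: "{x. \<not> (0 < ?h x \<longrightarrow> w (spherical x) = 0)} \<subseteq> N" "N \<in> null_sets lborel"
    using AE_lborelD[OF ae2] by blast
  have "negligible N" unfolding negligible_iff_null_sets using N(2) by (rule null_sets_completionI)
  moreover have "D \<subseteq> N"
  proof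
    fix x assume "x \<in> D"
    then have "x \<in> U" "w (spherical x) \<noteq> 0" by (simp_all add: D_def)
    then show "x \<in> N" using N(1) pos by blast
  qed
  ultimately have "negligible D" by (rule negligible_subset)
  then have "D = {}" using open_not_negligible[OF oD] by blast
  moreover have "(\<theta>, \<phi>) \<in> U" using assms by (simp add: U_def)
  ultimately show ?thesis by (auto simp: D_def)
qed

text \<open>Sample points in the interior of the chart. The units i and k lie on its boundary, so -i
  and a point midway between -i and k replace them.\<close>

lemma spherical_points:
  "spherical (pi/2, pi/2) = Quat 0 0 1 0" "spherical (pi/2, pi) = Quat 0 (-1) 0 0"
  "spherical (pi/2, 3*pi/2) = Quat 0 0 (-1) 0"
  "spherical (pi/4, pi) = Quat 0 (- sqrt 2 / 2) 0 (sqrt 2 / 2)"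
proof -
  have "cos (3*pi/2) = cos (pi + pi/2)" "sin (3*pi/2) = sin (pi + pi/2)" by (simp_all add: field_simps)
  then have c: "cos (3*pi/2) = 0" "sin (3*pi/2) = -1" by (simp_all only: cos_add sin_add) simp_all
  show "spherical (pi/2, pi/2) = Quat 0 0 1 0" "spherical (pi/2, pi) = Quat 0 (-1) 0 0"
    "spherical (pi/4, pi) = Quat 0 (- sqrt 2 / 2) 0 (sqrt 2 / 2)"
    by (simp_all add: spherical_def sin_45 cos_45)
  show "spherical (pi/2, 3*pi/2) = Quat 0 0 (-1) 0"
    unfolding spherical_def prod.case c by simp
qed

text \<open>Evaluation at the antipodal points j and -j separates \<open>x\<close> from
  \<open>y\<close>.\<close>

lemma sphere_affine_zero:
  assumes "AE I in sphere_area. x + I * y = 0"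
  shows "x = 0" "y = 0"
proof -
  have c: "continuous_on UNIV (\<lambda>I. x + I * y)" by (intro continuous_intros)
  have "x + spherical (pi/2, pi/2) * y = 0" "x + spherical (pi/2, 3*pi/2) * y = 0"
    by (rule AE_sphere_continuous[OF c assms]; simp)+
  then have *: "x + Quat 0 0 1 0 * y = 0" "x + Quat 0 0 (-1) 0 * y = 0" by (simp_all add: spherical_points)
  then have "Quat 0 0 1 0 * y = Quat 0 0 (-1) 0 * y" by (metis add_left_cancel)
  then show y: "y = 0" by (simp add: quat_eq_iff quat_mult_sel)
  then show "x = 0" using * by simp
qed

lemma norm_affine_sphere:
  assumes "I \<in> imag_units"
  shows "(norm (x + I * y))\<^sup>2 = (norm x)\<^sup>2 + (norm y)\<^sup>2 + 2 * (x \<bullet> (I * y))"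
proof -
  have "norm (I * y) = norm y" using norm_imag_unit[OF assms] by (simp add: norm_mult)
  then have "(I * y) \<bullet> (I * y) = y \<bullet> y" by (simp add: norm_eq)
  then show ?thesis
    unfolding power2_norm_eq_inner by (simp add: inner_add_left inner_add_right inner_commute)
qed

text \<open>The squared modulus is a real affine function of \<open>I\<close>, hence determined by four points.\<close>

lemma sphere_modulus:
  assumes "AE I in sphere_area. norm (x + I * y) = norm (x' + I * y')" and I: "I \<in> imag_units"
  shows "norm (x + I * y) = norm (x' + I * y')"
proof -
  define w where "w I = (norm (x + I * y))\<^sup>2 - (norm (x' + I * y'))\<^sup>2" for I
  have c: "continuous_on UNIV w" unfolding w_def[abs_def] by (intro continuous_intros)
  have ae: "AE I in sphere_area. w I = 0" using assms(1) by eventually_elim (simp add: w_def)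
  define A where "A = (norm x)\<^sup>2 + (norm y)\<^sup>2 - (norm x')\<^sup>2 - (norm y')\<^sup>2"
  define L where "L I = 2 * (x \<bullet> (I * y)) - 2 * (x' \<bullet> (I * y'))" for I
  have wL: "w I = A + L I" if "I \<in> imag_units" for I
    unfolding w_def norm_affine_sphere[OF that] by (simp add: A_def L_def)
  define p q r where "p = L (Quat 0 1 0 0)" and "q = L (Quat 0 0 1 0)" and "r = L (Quat 0 0 0 1)"
  have lin: "L (Quat 0 a b c) = a * p + b * q + c * r" for a b c
    by (simp add: L_def p_def q_def r_def inner_quat_def quat_mult_sel algebra_simps)
  have pt: "A + L (spherical (\<theta>, \<phi>)) = 0" if "0 < \<theta>" "\<theta> < pi" "0 < \<phi>" "\<phi> < 2 * pi" for \<theta> \<phi>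
    using AE_sphere_continuous[OF c ae that] wL[OF spherical_in, of "(\<theta>, \<phi>)"] by simp
  \<comment> \<open>The points j and -j give \<open>A = 0\<close> and \<open>q = 0\<close>, then -i
    gives \<open>p = 0\<close>, and the oblique point gives \<open>r = 0\<close>.\<close>
  have "A + q = 0" "A - p = 0" "A - q = 0" "A + (- sqrt 2 / 2 * p + sqrt 2 / 2 * r) = 0"
    using pt[of "pi/2" "pi/2"] pt[of "pi/2" "pi"] pt[of "pi/2" "3*pi/2"] pt[of "pi/4" "pi"]
    by (simp_all add: spherical_points lin)
  then have "A = 0" "q = 0" "p = 0" "r = 0" by auto
  moreover have "I = Quat 0 (qI I) (qJ I) (qK I)" using I by (simp add: quat_eq_iff imag_units_iff)
  ultimately have "L I = 0" using lin by (metis mult_zero_right add_0)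
  then have "w I = 0" using wL[OF I] \<open>A = 0\<close> by simp
  then show ?thesis unfolding w_def by (simp add: power2_eq_iff_nonneg)
qed

lemma imag_units_uminus: "I \<in> imag_units \<Longrightarrow> - I \<in> imag_units"
  by (simp add: imag_units_iff)

lemma qexp_upper_half:
  assumes "I \<in> imag_units"
  shows "\<exists>J\<in>imag_units. qexp t I = qexp (arccos (cos t)) J"
proof -
  define s where "s = arccos (cos t)"
  have c: "cos s = cos t" unfolding s_def by (rule cos_arccos) auto
  have "(sin s)\<^sup>2 = (sin t)\<^sup>2" using c sin_squared_eq by metis
  then have "sin s = sin t \<or> sin s = - sin t" by (simp add: power2_eq_iff)
  then have "qexp t I = qexp s I \<or> qexp t I = qexp s (- I)"
    using c by (auto simp: qexp_def)
  then show ?thesis using assms imag_units_uminus unfolding s_def by blast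
qed

text \<open>The angle in the upper half circle is a measurable function of the boundary point,
  namely the arc cosine of its real part. The exceptional points lie in the preimage of a null set
  of angles, so \<open>P\<close> itself may be arbitrary.\<close>

lemma AE_boundaryI:
  assumes "AE t in lborel. t \<in> {0..pi} \<longrightarrow> (\<forall>I\<in>imag_units. P (qexp t I))"
  shows "AE q in boundary_measure. P q"
proof -
  interpret S: prob_space sphere_area by (rule prob_space_sphere_area)
  interpret T: prob_space "uniform_measure lborel {0..2 * pi}"
    by (rule prob_space_uniform_measure) auto
  interpret Pr: pair_prob_space "uniform_measure lborel {0..2 * pi}" sphere_area ..
  obtain N where N: "{t. \<not> (t \<in> {0..pi} \<longrightarrow> (\<forall>I\<in>imag_units. P (qexp t I)))} \<subseteq> N" "N \<in> null_sets lborel"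
    using AE_lborelD[OF assms] by blast
  have Nb: "N \<in> sets borel" using N(2) by auto
  have a1: "AE t in lborel. t \<notin> N" by (rule AE_not_in[OF N(2)])
  \<comment> \<open>The lower half circle is reached by reflection, which preserves null
    sets.\<close>
  have a2: "AE t in lborel. 2 * pi + (-1) * t \<notin> N"
    using a1 Nb by (intro AE_borel_affine[of "-1" "\<lambda>t. t \<notin> N"]) auto
  \<comment> \<open>Clamping to the interval from -1 to 1 makes the arc cosine continuous on all
    quaternions; on the boundary it changes nothing.\<close>
  define R where "R q = arccos (max (-1) (min 1 (qRe q)))" for q
  have "continuous_on UNIV qRe"
  proof -
    have "continuous_on UNIV (\<lambda>q. q \<bullet> (1::quat))" by (intro continuous_intros)
    then show ?thesis by (simp add: inner_quat_def)
  qed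
  then have "continuous_on UNIV (\<lambda>q. max (-1) (min 1 (qRe q)))" by (intro continuous_intros)
  then have "continuous_on UNIV R" unfolding R_def[abs_def] by (rule continuous_on_arccos) auto
  then have Rm: "R \<in> borel_measurable borel" by (rule borel_measurable_continuous_onI)
  have Rq: "R (qexp t I) = arccos (cos t)" if "I \<in> imag_units" for t I
  proof -
    have "qRe (qexp t I) = cos t" using that by (simp add: qexp_def quat_mult_sel imag_units_iff)
    then show ?thesis by (simp add: R_def)
  qed
  have "(\<lambda>q. R q) \<in> borel_measurable (restrict_space borel qboundary)"
    using Rm by (rule measurable_restrict_space1)
  from measurable_sets[OF this, of "- N"]
  have meas: "{q \<in> space (restrict_space borel qboundary). R q \<notin> N} \<in> sets (restrict_space borel qboundary)"
    using Nb by (auto simp: vimage_def Int_def conj_commute)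
  have spS: "space sphere_area = imag_units" by (simp add: sphere_area_def space_restrict_space)
  have "AE q in boundary_measure. R q \<notin> N"
    unfolding boundary_measure_def
  proof (subst AE_distr_iff[OF measurable_qexp meas], rule Pr.AE_pair_measure)
    show "{x \<in> space (uniform_measure lborel {0..2 * pi} \<Otimes>\<^sub>M sphere_area). R (case x of (t, I) \<Rightarrow> qexp t I) \<notin> N}
       \<in> sets (uniform_measure lborel {0..2 * pi} \<Otimes>\<^sub>M sphere_area)"
    proof -
      have eq: "{x \<in> space (uniform_measure lborel {0..2 * pi} \<Otimes>\<^sub>M sphere_area). R (case x of (t, I) \<Rightarrow> qexp t I) \<notin> N}
        = (\<lambda>(t, I). qexp t I) -` {q \<in> space (restrict_space borel qboundary). R q \<notin> N} \<inter> space (uniform_measure lborel {0..2 * pi} \<Otimes>\<^sub>M sphere_area)"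
        using measurable_space[OF measurable_qexp] by (auto split: prod.splits)
      show ?thesis unfolding eq by (rule measurable_sets[OF measurable_qexp meas])
    qed
    have "AE t in lborel. t \<in> {0..2*pi} \<longrightarrow> arccos (cos t) \<notin> N"
      using a1 a2
    proof eventually_elim
      case (elim t)
      show ?case
      proof
        assume t: "t \<in> {0..2*pi}"
        show "arccos (cos t) \<notin> N"
        proof (cases "t \<le> pi")
          case True
          then have "arccos (cos t) = t" using t by (intro arccos_cos) auto
          then show ?thesis using elim by simp
        next
          case False
          have "arccos (cos (2 * pi - t)) = 2 * pi - t" using t False by (intro arccos_cos) auto
          moreover have "cos (2 * pi - t) = cos t" by (simp add: cos_diff)
          ultimately have "arccos (cos t) = 2 * pi - t" by (simp only:)
          then show ?thesis using elim by simp
        qed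
      qed
    qed
    then have "AE t in uniform_measure lborel {0..2 * pi}. arccos (cos t) \<notin> N"
      by (intro AE_uniform_measureI) auto
    then show "AE x in uniform_measure lborel {0..2 * pi}. AE y in sphere_area. R (case (x, y) of (t, I) \<Rightarrow> qexp t I) \<notin> N"
    proof eventually_elim
      case (elim t)
      show ?case using AE_space by eventually_elim (use elim spS Rq in auto)
    qed
  qed
  moreover have "AE q in boundary_measure. q \<in> qboundary"
    using AE_space[of boundary_measure] by (simp add: boundary_measure_def space_restrict_space)
  ultimately show ?thesis
  proof eventually_elim
    case (elim q)
    then obtain t I where "I \<in> imag_units" "q = qexp t I" unfolding qboundary_def by blast
    moreover from this obtain J where J: "J \<in> imag_units" "qexp t I = qexp (arccos (cos t)) J" using qexp_upper_half by blast
    ultimately have "arccos (cos t) \<notin> N" using elim Rq by auto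
    moreover have "arccos (cos t) \<in> {0..pi}" by (auto intro: arccos_lbound arccos_ubound)
    ultimately have "P (qexp (arccos (cos t)) J)" using N(1) J(1) by blast
    then show ?case using J \<open>q = qexp t I\<close> by simp
  qed
qed

lemma radial_qseries:
  assumes "ell2 a" "radial a t" "I \<in> imag_units"
  shows "((\<lambda>r. qseries a (of_real r * qexp t I)) \<longlongrightarrow> bB a t + I * bC a t) (at_left 1)"
proof (rule Lim_transform_eventually)
  show "((\<lambda>r. csum a (of_real r * cis t) + I * ssum a (of_real r * cis t)) \<longlongrightarrow> bB a t + I * bC a t) (at_left 1)"
    using assms(2) unfolding radial_def by (intro tendsto_intros) auto
  show "\<forall>\<^sub>F r in at_left 1. csum a (of_real r * cis t) + I * ssum a (of_real r * cis t) = qseries a (of_real r * qexp t I)"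
    using eventually_at_left_1
  proof eventually_elim
    case (elim r)
    then show ?case using qseries_slice[OF assms(1,3), of "of_real r * cis t"]
      by (simp add: slice_polar assms norm_mult)
  qed
qed

lemma AE_radial_pi: "ell2 a \<Longrightarrow> AE t in lborel. t \<in> {0..pi} \<longrightarrow> radial a t"
  using AE_radial[of a] by (auto elim: eventually_mono)

lemma has_boundary_value_qseries:
  assumes "ell2 a"
  shows "has_boundary_value (qseries a) (boundary_value (qseries a))"
  unfolding has_boundary_value_def
proof (rule AE_boundaryI)
  show "AE t in lborel. t \<in> {0..pi} \<longrightarrow> (\<forall>I\<in>imag_units.
     ((\<lambda>r. qseries a (of_real r * qexp t I)) \<longlongrightarrow> boundary_value (qseries a) (qexp t I)) (at_left 1))"
    using AE_radial_pi[OF assms]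
  proof eventually_elim
    case (elim t)
    show ?case
    proof (intro impI ballI)
      fix I assume "t \<in> {0..pi}" "I \<in> imag_units"
      then have l: "((\<lambda>r. qseries a (of_real r * qexp t I)) \<longlongrightarrow> bB a t + I * bC a t) (at_left 1)"
        using elim by (intro radial_qseries assms) auto
      then have "boundary_value (qseries a) (qexp t I) = bB a t + I * bC a t"
        unfolding boundary_value_def by (intro tendsto_Lim) auto
      then show "((\<lambda>r. qseries a (of_real r * qexp t I)) \<longlongrightarrow> boundary_value (qseries a) (qexp t I)) (at_left 1)"
        using l by simp
    qed
  qed
qed

lemma boundary_value_slices:
  assumes "ell2 a" "has_boundary_value (qseries a) f"
  shows "AE t in lborel. t \<in> {0..2*pi} \<longrightarrow> radial a t \<and> (AE I in sphere_area. f (qexp t I) = bB a t + I * bC a t)"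
  using AE_radial[OF assms(1)] AE_boundaryD[OF assms(2)[unfolded has_boundary_value_def]]
proof eventually_elim
  case (elim t)
  show ?case
  proof
    assume t: "t \<in> {0..2*pi}"
    have spS: "space sphere_area = imag_units" by (simp add: sphere_area_def space_restrict_space)
    have "AE I in sphere_area. ((\<lambda>r. qseries a (of_real r * qexp t I)) \<longlongrightarrow> f (qexp t I)) (at_left 1)"
      using elim t by blast
    then have "AE I in sphere_area. f (qexp t I) = bB a t + I * bC a t"
      using AE_space
    proof eventually_elim
      case (elim I)
      have "((\<lambda>r. qseries a (of_real r * qexp t I)) \<longlongrightarrow> bB a t + I * bC a t) (at_left 1)"
        using elim \<open>t \<in> {0..2*pi} \<longrightarrow> radial a t\<close> t spS by (intro radial_qseries assms) auto
      then show ?case using elim tendsto_unique[of "at_left (1::real)"] by (metis trivial_limit_at_left_real)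
    qed
    then show "radial a t \<and> (AE I in sphere_area. f (qexp t I) = bB a t + I * bC a t)" using elim t by blast
  qed
qed

text \<open>The passage from almost every \<open>I\<close> to every \<open>I\<close> matters: left
  multiplication replaces \<open>I\<close> by a conjugate over which there is no control.\<close>

lemma boundary_moduli:
  assumes a: "ell2 a" "has_boundary_value (qseries a) f" and b: "ell2 b" "has_boundary_value (qseries b) g"
    and "AE q in boundary_measure. norm (f q) = norm (g q)"
  shows "AE t in lborel. t \<in> {0..2*pi} \<longrightarrow> radial a t \<and> radial b t \<and>
    (\<forall>I\<in>imag_units. norm (bB a t + I * bC a t) = norm (bB b t + I * bC b t))"
  using boundary_value_slices[OF a] boundary_value_slices[OF b] AE_boundaryD[OF assms(5)]
proof eventually_elim
  case (elim t)
  show ?case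
  proof
    assume t: "t \<in> {0..2*pi}"
    have "AE I in sphere_area. f (qexp t I) = bB a t + I * bC a t"
      "AE I in sphere_area. g (qexp t I) = bB b t + I * bC b t"
      "AE I in sphere_area. norm (f (qexp t I)) = norm (g (qexp t I))" using elim t by blast+
    then have "AE I in sphere_area. norm (bB a t + I * bC a t) = norm (bB b t + I * bC b t)"
      by eventually_elim simp
    from sphere_modulus[OF this] elim t
    show "radial a t \<and> radial b t \<and> (\<forall>I\<in>imag_units. norm (bB a t + I * bC a t) = norm (bB b t + I * bC b t))"
      by blast
  qed
qed

lemma ell2_diff: "ell2 a \<Longrightarrow> ell2 b \<Longrightarrow> ell2 (\<lambda>n. a n - b n)"
  unfolding ell2_def using summable_square_add[of a "\<lambda>n. - b n"] by simp

lemma boundary_energy_AE_zero: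
  assumes "ell2 a" "AE t in lborel. t \<in> {0..pi} \<longrightarrow> boundary_energy a t = 0"
  shows "a = (\<lambda>n. 0)"
proof -
  have "(\<integral>\<^sup>+ t. ennreal (boundary_energy a t) * indicator {0..pi} t \<partial>lborel) = (\<integral>\<^sup>+ (t::real). 0 \<partial>lborel)"
  proof (rule nn_integral_cong_AE)
    show "AE t in lborel. ennreal (boundary_energy a t) * indicator {0..pi} t = 0"
      using assms(2) by eventually_elim (auto simp: indicator_def)
  qed
  then have "pi * (\<Sum>n. (norm (a n))\<^sup>2) \<le> 0"
    unfolding parseval_boundary[OF assms(1)] by (simp add: ennreal_eq_0_iff)
  then have "(\<Sum>n. (norm (a n))\<^sup>2) = 0"
    using suminf_nonneg[OF assms(1)[unfolded ell2_def]] pi_gt_zero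
    by (auto simp: mult_le_0_iff simp del: pi_gt_zero)
  then show ?thesis
    using suminf_eq_zero_iff[OF assms(1)[unfolded ell2_def]] by auto
qed

text \<open>Parseval applied to the difference of the coefficients. This makes the definite
  description in \<open>coeffs\<close> legitimate.\<close>

theorem boundary_value_unique:
  assumes a: "ell2 a" "has_boundary_value (qseries a) f" and b: "ell2 b" "has_boundary_value (qseries b) g"
    and "f \<doteq> g"
  shows "a = b"
proof -
  have "AE t in lborel. t \<in> {0..pi} \<longrightarrow> boundary_energy (\<lambda>n. a n - b n) t = 0"
    using boundary_value_slices[OF a] boundary_value_slices[OF b] AE_boundaryD[OF assms(5)]
  proof eventually_elim
    case (elim t)
    show ?case
    proof
      assume "t \<in> {0..pi}"
      then have t: "t \<in> {0..2*pi}" by auto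
      have "AE I in sphere_area. f (qexp t I) = bB a t + I * bC a t"
        "AE I in sphere_area. g (qexp t I) = bB b t + I * bC b t"
        "AE I in sphere_area. f (qexp t I) = g (qexp t I)" using elim t by blast+
      then have "AE I in sphere_area. (bB a t - bB b t) + I * (bC a t - bC b t) = 0"
        by eventually_elim (simp add: algebra_simps)
      from sphere_affine_zero[OF this] show "boundary_energy (\<lambda>n. a n - b n) t = 0"
        using radial_diff(2,3)[OF a(1) b(1), of t] elim t by (simp add: boundary_energy_def)
    qed
  qed
  from boundary_energy_AE_zero[OF ell2_diff[OF a(1) b(1)] this] show ?thesis
    by (metis eq_iff_diff_eq_0 ext)
qed

lemma coeffs_eq:
  assumes "ell2 a" "has_boundary_value (qseries a) f"
  shows "coeffs f = a"
  unfolding coeffs_def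
proof (rule the_equality)
  show "b = a" if "ell2 b \<and> has_boundary_value (qseries b) f" for b
    using that by (intro boundary_value_unique[OF _ _ assms]) auto
qed (use assms in simp)

lemma H2_coeffs:
  assumes "f \<in> H2"
  shows "ell2 (coeffs f)" "has_boundary_value (qseries (coeffs f)) f"
  using assms coeffs_eq unfolding H2_def by auto

lemma coeffs_boundary_value: "ell2 a \<Longrightarrow> coeffs (boundary_value (qseries a)) = a"
  by (rule coeffs_eq[OF _ has_boundary_value_qseries])

section \<open>Multiplicative structure of boundary values\<close>

lemma ell2_cf [simp]: "ell2 (cf x)"
  using summable_cf by (simp add: ell2_def)

lemma ell2E: assumes "ell2 a" obtains x where "a = cf x"
  using cf_L2[OF assms[unfolded ell2_def]] that by metis

text \<open>On a slice the \<open>*\<close>-product becomes a pointwise product up to conjugation of the imaginary unit.\<close>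

lemma star_product_slice:
  assumes a: "ell2 a" and b: "ell2 b" and I: "I \<in> imag_units" and z: "norm z < 1"
  shows "(\<lambda>n. slice I z ^ n * (\<Sum>k\<le>n. a k * b (n - k))) sums
    (qseries a (slice I z) * csum b z + I * (qseries a (slice I z) * ssum b z))"
proof -
  let ?q = "slice I z"
  have nq: "norm ?q = norm z" by (rule norm_slice[OF I])
  have sa: "summable (\<lambda>k. norm (?q ^ k * a k))"
    using square_summable_power[of a "norm z"] a z by (simp add: ell2_def norm_mult norm_power nq)
  have sc: "summable (\<lambda>k. norm (c k *\<^sub>R b k))" if "\<And>k. \<bar>c k\<bar> \<le> norm z ^ k" for c
  proof (rule summable_comparison_test'[of _ 0])
    show "summable (\<lambda>n. norm z ^ n * norm (b n))"
      using b z by (intro square_summable_power) (auto simp: ell2_def)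
    show "norm (norm (c n *\<^sub>R b n)) \<le> norm z ^ n * norm (b n)" for n
      using that[of n] by (auto intro: mult_right_mono)
  qed
  have C: "(\<lambda>n. \<Sum>k\<le>n. (?q ^ k * a k) * (Re (z ^ (n - k)) *\<^sub>R b (n - k))) sums (qseries a ?q * csum b z)"
    unfolding qseries_def csum_def by (rule Cauchy_product_sums[OF sa sc[OF abs_Re_power]])
  have S: "(\<lambda>n. \<Sum>k\<le>n. (?q ^ k * a k) * (Im (z ^ (n - k)) *\<^sub>R b (n - k))) sums (qseries a ?q * ssum b z)"
    unfolding qseries_def ssum_def by (rule Cauchy_product_sums[OF sa sc[OF abs_Im_power]])
  have eq: "?q ^ n * (\<Sum>k\<le>n. a k * b (n - k)) =
      (\<Sum>k\<le>n. (?q ^ k * a k) * (Re (z ^ (n - k)) *\<^sub>R b (n - k)))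
      + I * (\<Sum>k\<le>n. (?q ^ k * a k) * (Im (z ^ (n - k)) *\<^sub>R b (n - k)))" for n
  proof -
    have "?q ^ n * (a k * b (n - k)) = (?q ^ k * a k) * (Re (z ^ (n - k)) *\<^sub>R b (n - k))
        + I * ((?q ^ k * a k) * (Im (z ^ (n - k)) *\<^sub>R b (n - k)))" if "k \<le> n" for k
    proof -
      have "?q ^ n = ?q ^ (n - k) * ?q ^ k" using that by (simp flip: power_add)
      also have "?q ^ (n - k) = slice I (z ^ (n - k))" by (simp add: slice_power[OF I])
      finally show ?thesis by (simp add: mult.assoc slice_alt distrib_right)
    qed
    then show ?thesis by (simp add: sum_distrib_left sum.distrib)
  qed
  show ?thesis unfolding eq by (intro sums_add sums_mult C S)
qed

lemma qseries_star:
  assumes "ell2 a" "ell2 b" "I \<in> imag_units" "norm z < 1"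
  shows "qseries (\<lambda>n. \<Sum>k\<le>n. a k * b (n - k)) (slice I z)
    = qseries a (slice I z) * csum b z + I * (qseries a (slice I z) * ssum b z)"
  using sums_unique[OF star_product_slice[OF assms]] by (simp add: qseries_def)

lemma fp_mult_cf: "fp y = fp x * fp u \<Longrightarrow> cf y = (\<lambda>n. \<Sum>k\<le>n. cf x k * cf u (n - k))"
  by (auto simp: fps_eq_iff fps_mult_nth atLeast0AtMost)

lemma qseries_mult:
  assumes "fp y = fp x * fp u" "I \<in> imag_units" "norm z < 1"
  shows "qseries (cf y) (slice I z) = qseries (cf x) (slice I z) * csum (cf u) z
    + I * (qseries (cf x) (slice I z) * ssum (cf u) z)"
  unfolding fp_mult_cf[OF assms(1)] by (rule qseries_star) (use assms in auto)

lemma conj_imag_unit: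
  assumes "I \<in> imag_units" "P \<noteq> 0"
  shows "inverse P * I * P \<in> imag_units"
proof -
  have "(inverse P * I * P)\<^sup>2 = inverse P * I * (P * inverse P) * I * P"
    by (simp only: power2_eq_square mult.assoc)
  also have "\<dots> = inverse P * (I * I) * P" using assms by (simp add: mult.assoc)
  also have "\<dots> = - 1" using assms by (simp add: imag_unitsD)
  finally show ?thesis by (simp add: imag_units_def)
qed

text \<open>Pulling \<open>P\<close> out to the left costs a conjugation, as
  \<open>I * P = P * (inverse P * I * P)\<close>. With \<open>P\<close> the value of the left factor
  this is the pointwise formula for the \<open>*\<close>-product, in terms of moduli.\<close>

lemma norm_conj_affine:
  fixes P I x y :: quat
  assumes "P \<noteq> 0"
  shows "norm (P * x + I * (P * y)) = norm P * norm (x + (inverse P * I * P) * y)"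
proof -
  have "P * x + I * (P * y) = P * (x + (inverse P * I * P) * y)"
  proof -
    have "P * (inverse P * I * P * y) = (P * inverse P) * (I * (P * y))" by (simp only: mult.assoc)
    then show ?thesis using assms by (simp add: distrib_left)
  qed
  then show ?thesis by (simp add: norm_mult)
qed

lemma norm_qseries_mult:
  assumes "fp y = fp x * fp u" "I \<in> imag_units" "norm z < 1" "qseries (cf x) (slice I z) \<noteq> 0"
  shows "\<exists>J\<in>imag_units. norm (qseries (cf y) (slice I z)) = norm (qseries (cf x) (slice I z)) * norm (qseries (cf u) (slice J z))"
proof -
  let ?P = "qseries (cf x) (slice I z)"
  let ?J = "inverse ?P * I * ?P"
  have J: "?J \<in> imag_units" using conj_imag_unit[OF assms(2,4)] .
  have "norm (qseries (cf y) (slice I z)) = norm ?P * norm (qseries (cf u) (slice ?J z))"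
    unfolding qseries_mult[OF assms(1-3)] norm_conj_affine[OF assms(4)] using J assms(3) by (simp add: qseries_slice)
  then show ?thesis using J by blast
qed

lemma radial_mult:
  assumes "fp y = fp x * fp u" "radial (cf x) t" "radial (cf u) t" "radial (cf y) t" "I \<in> imag_units"
  shows "bB (cf y) t + I * bC (cf y) t = (bB (cf x) t + I * bC (cf x) t) * bB (cf u) t
    + I * ((bB (cf x) t + I * bC (cf x) t) * bC (cf u) t)"
proof (rule tendsto_unique)
  show "((\<lambda>r. qseries (cf y) (of_real r * qexp t I)) \<longlongrightarrow> bB (cf y) t + I * bC (cf y) t) (at_left 1)"
    by (rule radial_qseries) (use assms in auto)
  have x: "((\<lambda>r. qseries (cf x) (of_real r * qexp t I)) \<longlongrightarrow> bB (cf x) t + I * bC (cf x) t) (at_left 1)"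
    by (rule radial_qseries) (use assms in auto)
  show "((\<lambda>r. qseries (cf y) (of_real r * qexp t I)) \<longlongrightarrow> (bB (cf x) t + I * bC (cf x) t) * bB (cf u) t
    + I * ((bB (cf x) t + I * bC (cf x) t) * bC (cf u) t)) (at_left 1)"
  proof (rule Lim_transform_eventually)
    show "((\<lambda>r. qseries (cf x) (of_real r * qexp t I) * csum (cf u) (of_real r * cis t)
        + I * (qseries (cf x) (of_real r * qexp t I) * ssum (cf u) (of_real r * cis t)))
      \<longlongrightarrow> (bB (cf x) t + I * bC (cf x) t) * bB (cf u) t
       + I * ((bB (cf x) t + I * bC (cf x) t) * bC (cf u) t)) (at_left 1)"
      using assms(3) unfolding radial_def by (intro tendsto_intros x) auto
    show "\<forall>\<^sub>F r in at_left 1. qseries (cf x) (of_real r * qexp t I) * csum (cf u) (of_real r * cis t)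
        + I * (qseries (cf x) (of_real r * qexp t I) * ssum (cf u) (of_real r * cis t))
        = qseries (cf y) (of_real r * qexp t I)"
      using eventually_at_left_1
    proof eventually_elim
      case (elim r)
      then show ?case using qseries_mult[OF assms(1,5), of "of_real r * cis t"]
        by (simp add: slice_polar assms norm_mult)
    qed
  qed
qed simp

lemma boundary_energy_average:
  assumes "I \<in> imag_units"
  shows "2 * ((norm x)\<^sup>2 + (norm y)\<^sup>2) = (norm (x + I * y))\<^sup>2 + (norm (x + (- I) * y))\<^sup>2"
  unfolding norm_affine_sphere[OF assms] norm_affine_sphere[OF imag_units_uminus[OF assms]] by simp

lemma i_imag_unit: "Quat 0 1 0 0 \<in> imag_units"
  by (simp add: imag_units_iff)

lemma boundary_energy_eqI:
  assumes "\<And>I. I \<in> imag_units \<Longrightarrow> norm (bB a t + I * bC a t) = norm (bB b t + I * bC b t)"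
  shows "boundary_energy a t = boundary_energy b t"
  using boundary_energy_average[OF i_imag_unit, of "bB a t" "bC a t"] boundary_energy_average[OF i_imag_unit, of "bB b t" "bC b t"]
    assms[OF i_imag_unit] assms[OF imag_units_uminus[OF i_imag_unit]]
  unfolding boundary_energy_def by simp

lemma norm_eq_if_boundary_energy:
  assumes "AE t in lborel. t \<in> {0..pi} \<longrightarrow> boundary_energy (cf x) t = boundary_energy (cf y) t"
  shows "norm x = norm y"
proof -
  have "(\<integral>\<^sup>+ t. ennreal (boundary_energy (cf x) t) * indicator {0..pi} t \<partial>lborel) = (\<integral>\<^sup>+ t. ennreal (boundary_energy (cf y) t) * indicator {0..pi} t \<partial>lborel)"
  proof (rule nn_integral_cong_AE)
    show "AE t in lborel. ennreal (boundary_energy (cf x) t) * indicator {0..pi} t = ennreal (boundary_energy (cf y) t) * indicator {0..pi} t"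
      using assms by eventually_elim (auto simp: indicator_def)
  qed
  then have "pi * (norm x)\<^sup>2 = pi * (norm y)\<^sup>2"
    unfolding parseval_boundary[OF ell2_cf] norm_l2_sq[symmetric] by simp
  then show ?thesis by simp
qed

text \<open>Left multiplication by \<open>x\<close> only rotates each boundary sphere, by \<open>I \<mapsto> inverse P * I * P\<close>
  with \<open>P\<close> the value of \<open>x\<close>.\<close>

lemma norm_left_mult_eq:
  assumes m: "AE t in lborel. t \<in> {0..pi} \<longrightarrow> (radial (cf f) t \<and> radial (cf g) t \<and>
      (\<forall>I\<in>imag_units. norm (bB (cf f) t + I * bC (cf f) t) = norm (bB (cf g) t + I * bC (cf g) t)))"
    and y: "fp y = fp x * fp f" and z: "fp z = fp x * fp g"
  shows "norm y = norm z"
    and "AE t in lborel. t \<in> {0..pi} \<longrightarrow> (radial (cf y) t \<and> radial (cf z) t \<and>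
      (\<forall>I\<in>imag_units. norm (bB (cf y) t + I * bC (cf y) t) = norm (bB (cf z) t + I * bC (cf z) t)))"
proof -
  show *: "AE t in lborel. t \<in> {0..pi} \<longrightarrow> (radial (cf y) t \<and> radial (cf z) t \<and>
      (\<forall>I\<in>imag_units. norm (bB (cf y) t + I * bC (cf y) t) = norm (bB (cf z) t + I * bC (cf z) t)))"
    using m AE_radial_pi[OF ell2_cf[of x]] AE_radial_pi[OF ell2_cf[of y]] AE_radial_pi[OF ell2_cf[of z]]
  proof eventually_elim
    case (elim t)
    show ?case
    proof (intro impI conjI ballI)
      assume t: "t \<in> {0..pi}"
      then show "radial (cf y) t" "radial (cf z) t" using elim by auto
      fix I assume I: "I \<in> imag_units"
      let ?P = "bB (cf x) t + I * bC (cf x) t"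
      have ey: "bB (cf y) t + I * bC (cf y) t = ?P * bB (cf f) t + I * (?P * bC (cf f) t)"
        and ez: "bB (cf z) t + I * bC (cf z) t = ?P * bB (cf g) t + I * (?P * bC (cf g) t)"
        using elim t I by (intro radial_mult[OF y] radial_mult[OF z]; simp)+
      show "norm (bB (cf y) t + I * bC (cf y) t) = norm (bB (cf z) t + I * bC (cf z) t)"
      proof (cases "?P = 0")
        case False
        have "inverse ?P * I * ?P \<in> imag_units" by (rule conj_imag_unit[OF I False])
        then show ?thesis unfolding ey ez norm_conj_affine[OF False] using elim t by simp
      qed (simp add: ey ez)
    qed
  qed
  show "norm y = norm z"
  proof (rule norm_eq_if_boundary_energy)
    show "AE t in lborel. t \<in> {0..pi} \<longrightarrow> boundary_energy (cf y) t = boundary_energy (cf z) t"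
      using * by eventually_elim (auto intro: boundary_energy_eqI)
  qed
qed

lemma comb_e0_tendsto: "(\<lambda>N. Q.comb N (cf x) e0) \<longlonglongrightarrow> x"
proof -
  have o: "e0 \<bullet> (l2_shift ^^ Suc n) (l2_smult c e0) = 0" for n c
    unfolding inner_l2_def cf_e0 cf_l2_shift_funpow by (subst suminf_finite[of "{0}"]) auto
  obtain y where y: "(\<lambda>N. Q.comb N (cf x) e0) \<longlonglongrightarrow> y"
    using Q.comb_wandering_converges[OF norm_e0 o summable_cf] by blast
  have "fp y = fp x" using fp_comb_limit[OF y] by (simp only: fp_e0 fp_def[symmetric] mult_1_right)
  then show ?thesis using y unfolding fp_eq_iff by simp
qed

text \<open>Truncations approximate \<open>x\<close>, and differences of truncations are again
  polynomials, so the products form a Cauchy sequence whose limit is the product with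
  \<open>x\<close>.\<close>

lemma right_isometric_from_poly:
  assumes "\<And>p x y. finite_fps p \<Longrightarrow> fp x = p \<Longrightarrow> fp y = p * fp u \<Longrightarrow> norm y = norm x"
  shows "right_isometric (fp u)"
  unfolding right_isometric_def
proof
  fix x
  define X where "X N = Q.comb N (cf x) e0" for N
  define Y where "Y N = Q.comb N (cf x) u" for N
  have fX: "fp (X N) = trunc N (cf x)" "fp (Y N) = trunc N (cf x) * fp u" for N
    by (simp_all add: X_def Y_def fp_comb fp_e0)
  have Xl: "X \<longlonglongrightarrow> x" unfolding X_def by (rule comb_e0_tendsto)
  have d: "norm (Y m - Y n) = norm (X m - X n)" for m n
  proof (rule assms)
    have "\<exists>M. \<forall>k\<ge>M. (trunc m (cf x) - trunc n (cf x)) $ k = 0"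
      by (intro exI[of _ "max m n"]) (simp add: trunc_def)
    then show "finite_fps (trunc m (cf x) - trunc n (cf x))" unfolding finite_fps_def .
  qed (simp_all add: fp_simps fX algebra_simps)
  then have "Cauchy Y" using LIMSEQ_imp_Cauchy[OF Xl] by (simp add: Cauchy_def dist_norm)
  then obtain y where y: "Y \<longlonglongrightarrow> y" using Cauchy_convergent convergent_def by blast
  have "fp y = fp x * fp u"
    using fp_comb_limit[OF y[unfolded Y_def]] by (simp only: fp_def[symmetric])
  moreover have "norm y = norm x"
  proof (rule LIMSEQ_unique)
    show "(\<lambda>N. norm (Y N)) \<longlonglongrightarrow> norm y" by (intro tendsto_intros y)
    have "norm (Y N) = norm (X N)" for N by (rule assms[OF finite_fps_trunc fX])
    then show "(\<lambda>N. norm (Y N)) \<longlonglongrightarrow> norm x" by (simp add: tendsto_norm[OF Xl])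
  qed
  ultimately show "\<exists>y. fp y = fp x * fp u \<and> norm y = norm x" by blast
qed

section \<open>Unimodular series and isometric multipliers\<close>

text \<open>Modulus 1 on the boundary in terms of the boundary functions. Quantifying over every
  \<open>I\<close> makes the property immune to the rotation of spheres by left factors.\<close>

definition unimodular :: "(nat \<Rightarrow> quat) \<Rightarrow> bool" where
  "unimodular a \<longleftrightarrow> (AE t in lborel. t \<in> {0..pi} \<longrightarrow> radial a t \<and> (\<forall>I\<in>imag_units. norm (bB a t + I * bC a t) = 1))"

lemma csum_e0: "csum (cf e0) z = 1" "ssum (cf e0) z = 0"
proof -
  have "(\<Sum>n. Re (z ^ n) *\<^sub>R cf e0 n) = (\<Sum>n\<in>{0}. Re (z ^ n) *\<^sub>R cf e0 n)"
    "(\<Sum>n. Im (z ^ n) *\<^sub>R cf e0 n) = (\<Sum>n\<in>{0}. Im (z ^ n) *\<^sub>R cf e0 n)"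
    by (rule suminf_finite; simp add: cf_e0)+
  then show "csum (cf e0) z = 1" "ssum (cf e0) z = 0" by (simp_all add: csum_def ssum_def cf_e0)
qed

lemma radial_e0: "radial (cf e0) t" "bB (cf e0) t = 1" "bC (cf e0) t = 0"
  using radialI[of "cf e0" t 1 0] by (auto simp: csum_e0)

text \<open>The series \<open>k\<close> and 1 have equal boundary moduli, and left multiplication by
  a polynomial keeps the resulting norms equal.\<close>

lemma unimodular_right_isometric:
  assumes "unimodular (cf k)"
  shows "right_isometric (fp k)"
proof (rule right_isometric_from_poly)
  fix p x y assume p: "fp x = p" "fp y = p * fp k"
  have "AE t in lborel. t \<in> {0..pi} \<longrightarrow> (radial (cf k) t \<and> radial (cf e0) t \<and>
      (\<forall>I\<in>imag_units. norm (bB (cf k) t + I * bC (cf k) t) = norm (bB (cf e0) t + I * bC (cf e0) t)))"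
    using assms unfolding unimodular_def by eventually_elim (auto simp: radial_e0)
  from norm_left_mult_eq(1)[OF this, of y x x] p show "norm y = norm x" by (simp add: fp_e0)
qed

lemma unimodular_mult:
  assumes "unimodular (cf k)" "fp y = fp x * fp k"
  shows "AE t in lborel. t \<in> {0..pi} \<longrightarrow> (radial (cf y) t \<and> radial (cf x) t \<and>
      (\<forall>I\<in>imag_units. norm (bB (cf y) t + I * bC (cf y) t) = norm (bB (cf x) t + I * bC (cf x) t)))"
proof -
  have "AE t in lborel. t \<in> {0..pi} \<longrightarrow> (radial (cf k) t \<and> radial (cf e0) t \<and>
      (\<forall>I\<in>imag_units. norm (bB (cf k) t + I * bC (cf k) t) = norm (bB (cf e0) t + I * bC (cf e0) t)))"
    using assms(1) unfolding unimodular_def by eventually_elim (auto simp: radial_e0)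
  from norm_left_mult_eq(2)[OF this assms(2), of x] show ?thesis by (simp add: fp_e0)
qed

text \<open>Test the isometry on the reproducing kernel at \<open>q\<close>, whose value at \<open>q\<close> is real.\<close>

lemma right_isometric_bounded:
  assumes iso: "right_isometric (fp k)" and q: "norm q < 1"
  shows "norm (qseries (cf k) q) \<le> 1"
proof -
  define \<kappa> where "\<kappa> = (\<Sum>n. (norm q ^ n)\<^sup>2)"
  have q2: "(norm q)\<^sup>2 < 1" using q by (simp add: abs_square_less_1)
  have s\<kappa>: "summable (\<lambda>n. (norm q ^ n)\<^sup>2)"
    using summable_geometric[of "(norm q)\<^sup>2"] q2 by (simp add: power_mult[symmetric] mult.commute)
  have \<kappa>1: "1 \<le> \<kappa>" unfolding \<kappa>_def using sum_le_suminf[OF s\<kappa>, of "{0}"] by simp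
  define x where "x = L2 (\<lambda>n. qcnj q ^ n)"
  have x: "cf x n = qcnj q ^ n" for n
    unfolding x_def using s\<kappa> by (subst cf_L2) (simp_all add: norm_power qcnj_simps)
  have nx: "(norm x)\<^sup>2 = \<kappa>" unfolding norm_l2_sq x \<kappa>_def by (simp add: norm_power qcnj_simps)
  have com: "q ^ n * qcnj q ^ n = of_real ((norm q ^ n)\<^sup>2)" for n
  proof -
    have "q ^ n * qcnj q ^ n = of_real (((norm q)\<^sup>2) ^ n)"
    proof (induction n)
      case (Suc n)
      have "q ^ Suc n * qcnj q ^ Suc n = q ^ n * (q * qcnj q) * qcnj q ^ n"
        by (simp only: power_Suc2[of q] power_Suc[of "qcnj q"] mult.assoc)
      also have "\<dots> = of_real ((norm q)\<^sup>2) * (q ^ n * qcnj q ^ n)"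
        using of_real_quat_commute[of "(norm q)\<^sup>2" "q ^ n"] by (simp only: qcnj_mult_self mult.assoc[symmetric])
      finally show ?case unfolding Suc.IH by simp
    qed simp
    then show ?thesis by (simp add: power_mult[symmetric] mult.commute)
  qed
  \<comment> \<open>The kernel takes a real value at \<open>q\<close>, so the sphere through
    \<open>q\<close> is not rotated and the product with \<open>k\<close> has the value
    \<open>\<kappa>\<close> times that of \<open>k\<close>.\<close>
  have qx: "qseries (cf x) q = of_real \<kappa>"
    unfolding qseries_def x com \<kappa>_def by (rule suminf_of_real[OF s\<kappa>, symmetric])
  obtain y where y: "fp y = fp x * fp k" "norm y = norm x" using iso unfolding right_isometric_def by blast
  obtain I z where Iz: "I \<in> imag_units" "q = slice I z" using ex_slice by blast
  have nz: "norm z < 1" using q Iz norm_slice by simp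
  have "qseries (cf y) q = of_real \<kappa> * csum (cf k) z + I * (of_real \<kappa> * ssum (cf k) z)"
    using qseries_mult[OF y(1) Iz(1) nz] qx Iz by simp
  also have "\<dots> = of_real \<kappa> * qseries (cf k) q"
  proof -
    have "I * (of_real \<kappa> * ssum (cf k) z) = of_real \<kappa> * (I * ssum (cf k) z)"
      using of_real_quat_commute[of \<kappa> I] by (simp only: mult.assoc[symmetric])
    then show ?thesis
      unfolding Iz(2) qseries_slice[OF ell2_cf Iz(1) nz] by (simp add: distrib_left)
  qed
  finally have e: "norm (qseries (cf y) q) = \<kappa> * norm (qseries (cf k) q)"
    using \<kappa>1 by (simp add: norm_mult)
  \<comment> \<open>Cauchy-Schwarz for the moduli: both real sequences have squared norm
    \<open>\<kappa>\<close>, hence \<open>\<kappa> * |k(q)| <= \<kappa>\<close>.\<close>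
  define u where "u = L2 (\<lambda>n. norm q ^ n)"
  define v where "v = L2 (\<lambda>n. norm (cf y n))"
  have u: "cf u n = norm q ^ n" for n unfolding u_def using s\<kappa> by (subst cf_L2) auto
  have v: "cf v n = norm (cf y n)" for n unfolding v_def using summable_cf[of y] by (subst cf_L2) auto
  have "norm (qseries (cf y) q) \<le> (\<Sum>n. norm (q ^ n * cf y n))"
    unfolding qseries_def using square_summable_power[OF summable_cf[of y], of "norm q"] q
    by (intro summable_norm) (simp add: norm_mult norm_power)
  also have "\<dots> = u \<bullet> v" by (simp add: inner_l2_def u v norm_mult norm_power)
  also have "\<dots> \<le> norm u * norm v" by (rule norm_cauchy_schwarz)
  also have "\<dots> = \<kappa>"
  proof -
    have "(norm u)\<^sup>2 = \<kappa>" "(norm v)\<^sup>2 = \<kappa>"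
      using nx unfolding y(2)[symmetric] norm_l2_sq u v \<kappa>_def by simp_all
    then have "norm u = sqrt \<kappa>" "norm v = sqrt \<kappa>" by (metis norm_ge_zero real_sqrt_unique)+
    then show ?thesis using \<kappa>1 by simp
  qed
  finally show ?thesis unfolding e using \<kappa>1 by simp
qed

text \<open>The boundary moduli are at most 1 by the interior bound, while Parseval and
  \<open>norm k = 1\<close> give the boundary energy mean value 1; so it equals 1 almost everywhere.
  Being the mean of two squared moduli that are at most 1, it forces both to be 1.\<close>

lemma right_isometric_unimodular:
  assumes iso: "right_isometric (fp k)"
  shows "unimodular (cf k)"
proof -
  have n1: "norm k = 1" using right_isometric_l2[OF iso] fp_eq_iff by metis
  have le: "norm (bB (cf k) t + I * bC (cf k) t) \<le> 1" if "radial (cf k) t" "I \<in> imag_units" for t I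
  proof (rule tendsto_upperbound)
    show "((\<lambda>r. norm (qseries (cf k) (of_real r * qexp t I))) \<longlongrightarrow> norm (bB (cf k) t + I * bC (cf k) t)) (at_left 1)"
      by (intro tendsto_norm radial_qseries that) simp
    show "\<forall>\<^sub>F r in at_left 1. norm (qseries (cf k) (of_real r * qexp t I)) \<le> 1"
      using eventually_at_left_1
    proof eventually_elim
      case (elim r)
      have "norm (of_real r * qexp t I) < 1"
        using elim that norm_slice[of I "of_real r * cis t"] by (simp add: slice_polar norm_mult)
      then show ?case by (rule right_isometric_bounded[OF iso])
    qed
  qed simp
  have en1: "boundary_energy (cf k) t \<le> 1" if "radial (cf k) t" for t
  proof -
    have s: "(norm (bB (cf k) t + I * bC (cf k) t))\<^sup>2 \<le> 1" if "I \<in> imag_units" for I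
      using le[OF \<open>radial (cf k) t\<close> that] by (simp add: power_le_one)
    have "2 * boundary_energy (cf k) t \<le> 1 + 1"
      unfolding boundary_energy_def boundary_energy_average[OF i_imag_unit, of "bB (cf k) t" "bC (cf k) t"]
      by (intro add_mono s i_imag_unit imag_units_uminus)
    then show ?thesis by simp
  qed
  let ?D = "\<lambda>t. ennreal (1 - boundary_energy (cf k) t) * indicator {0..pi} t"
  have m: "boundary_energy (cf k) \<in> borel_measurable borel" by (rule measurable_b) simp
  have "(\<integral>\<^sup>+ t. ?D t \<partial>lborel) + (\<integral>\<^sup>+ t. ennreal (boundary_energy (cf k) t) * indicator {0..pi} t \<partial>lborel)
     = (\<integral>\<^sup>+ t. ?D t + ennreal (boundary_energy (cf k) t) * indicator {0..pi} t \<partial>lborel)"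
    using m by (subst nn_integral_add) auto
  also have "\<dots> = (\<integral>\<^sup>+ t. indicator {0..pi} t \<partial>lborel)"
  proof (rule nn_integral_cong_AE)
    show "AE t in lborel. ?D t + ennreal (boundary_energy (cf k) t) * indicator {0..pi} t = indicator {0..pi} t"
      using AE_radial_pi[OF ell2_cf[of k]]
    proof eventually_elim
      case (elim t)
      show ?case
      proof (cases "t \<in> {0..pi}")
        case True
        then have "boundary_energy (cf k) t \<le> 1" using elim en1 by blast
        then show ?thesis using True by (simp add: boundary_energy_def flip: ennreal_plus)
      qed simp
    qed
  qed
  also have "\<dots> = ennreal pi" by simp
  finally have total: "(\<integral>\<^sup>+ t. ?D t \<partial>lborel) + (\<integral>\<^sup>+ t. ennreal (boundary_energy (cf k) t) * indicator {0..pi} t \<partial>lborel) = ennreal pi" .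
  have "(\<integral>\<^sup>+ t. ennreal (boundary_energy (cf k) t) * indicator {0..pi} t \<partial>lborel) = ennreal pi"
    unfolding parseval_boundary[OF ell2_cf] norm_l2_sq[symmetric] by (simp add: n1)
  with total have "ennreal pi + (\<integral>\<^sup>+ t. ?D t \<partial>lborel) = ennreal pi + 0" by (simp add: add.commute)
  then have "(\<integral>\<^sup>+ t. ?D t \<partial>lborel) = 0" by (simp only: ennreal_add_left_cancel) auto
  then have "AE t in lborel. ?D t = 0" using m by (subst (asm) nn_integral_0_iff_AE) auto
  then show ?thesis unfolding unimodular_def using AE_radial_pi[OF ell2_cf[of k]]
  proof eventually_elim
    case (elim t)
    show ?case
    proof (intro impI conjI ballI)
      assume t: "t \<in> {0..pi}"
      then show r: "radial (cf k) t" using elim by blast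
      have "1 - boundary_energy (cf k) t \<le> 0" using elim(1) t by (simp add: ennreal_eq_0_iff)
      then have e: "boundary_energy (cf k) t = 1" using en1[OF r] by simp
      fix I assume I: "I \<in> imag_units"
      let ?p = "norm (bB (cf k) t + I * bC (cf k) t)" and ?m = "norm (bB (cf k) t + (- I) * bC (cf k) t)"
      have "?p\<^sup>2 + ?m\<^sup>2 = 2" using boundary_energy_average[OF I, of "bB (cf k) t" "bC (cf k) t"] e by (simp add: boundary_energy_def)
      moreover have "?m\<^sup>2 \<le> 1" using le[OF r imag_units_uminus[OF I]] by (simp add: power_le_one)
      moreover have "?p\<^sup>2 \<le> 1" using le[OF r I] by (simp add: power_le_one)
      ultimately have "?p\<^sup>2 = 1" by linarith
      then show "?p = 1" by (simp add: power2_eq_1_iff) (use norm_ge_zero[of "bB (cf k) t + I * bC (cf k) t"] in linarith)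
    qed
  qed
qed

text \<open>A constant modulus on the sphere makes \<open>x\<close> orthogonal to
  \<open>I * y\<close> for every \<open>I\<close>, that is, \<open>x * qcnj y\<close> is real. For
  nonzero \<open>y\<close> it follows that \<open>x\<close> is a real multiple of \<open>y\<close>,
  a relation that conjugation preserves.\<close>

lemma unit_affine_conj:
  assumes "\<And>I. I \<in> imag_units \<Longrightarrow> norm (x + I * y) = 1" "I \<in> imag_units"
  shows "norm (qcnj x + I * qcnj y) = 1"
proof -
  have *: "x \<bullet> (J * y) = 0" if "J \<in> imag_units" for J
    using norm_affine_sphere[OF that, of x y] norm_affine_sphere[OF imag_units_uminus[OF that], of x y]
      assms(1)[OF that] assms(1)[OF imag_units_uminus[OF that]] by simp
  have A: "(norm x)\<^sup>2 + (norm y)\<^sup>2 = 1"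
    using norm_affine_sphere[OF assms(2), of x y] assms(1)[OF assms(2)] *[OF assms(2)] by simp
  have "x \<bullet> (Quat 0 1 0 0 * y) = 0" "x \<bullet> (Quat 0 0 1 0 * y) = 0" "x \<bullet> (Quat 0 0 0 1 * y) = 0"
    by (rule *; simp add: imag_units_iff)+
  then have r: "x * qcnj y = of_real (qRe (x * qcnj y))"
    by (simp add: quat_eq_iff quat_mult_sel inner_quat_def algebra_simps)
  have "qcnj x \<bullet> (I * qcnj y) = 0"
  proof (cases "y = 0")
    case False
    have "(norm y)\<^sup>2 *\<^sub>R x = x * qcnj y * y"
      using of_real_quat_commute[of "(norm y)\<^sup>2" x] by (simp add: mult.assoc qcnj_mult_self scaleR_conv_of_real)
    also have "\<dots> = qRe (x * qcnj y) *\<^sub>R y" by (subst r) (simp add: scaleR_conv_of_real)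
    finally have eq: "(norm y)\<^sup>2 *\<^sub>R x = qRe (x * qcnj y) *\<^sub>R y" .
    have "x = (1 / (norm y)\<^sup>2) *\<^sub>R ((norm y)\<^sup>2 *\<^sub>R x)" using False by simp
    also have "\<dots> = (qRe (x * qcnj y) / (norm y)\<^sup>2) *\<^sub>R y" unfolding eq by simp
    finally obtain s where s: "x = s *\<^sub>R y" by blast
    have "qcnj x \<bullet> (I * qcnj y) = s * (qRe I * (norm y)\<^sup>2)"
      by (simp add: s inner_quat_def quat_mult_sel norm_quat_def power2_eq_square algebra_simps)
    then show ?thesis using assms(2) by (simp add: imag_units_iff)
  qed (simp add: qcnj_simps)
  then have "(norm (qcnj x + I * qcnj y))\<^sup>2 = 1"
    unfolding norm_affine_sphere[OF assms(2)] qcnj_simps using A by simp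
  then show ?thesis by (simp add: power2_eq_1_iff) (use norm_ge_zero[of "qcnj x + I * qcnj y"] in linarith)
qed

lemma bounded_linear_qcnj: "bounded_linear qcnj"
  by (rule bounded_linear_intro[of _ 1]) (auto simp: qcnj_simps quat_eq_iff)

lemma radial_l2_cnj:
  assumes "radial (cf k) t"
  shows "radial (cf (l2_cnj k)) t" "bB (cf (l2_cnj k)) t = qcnj (bB (cf k) t)" "bC (cf (l2_cnj k)) t = qcnj (bC (cf k) t)"
proof -
  have scal: "qcnj (r *\<^sub>R q) = r *\<^sub>R qcnj q" for r q by (simp add: quat_eq_iff)
  have ev: "\<forall>\<^sub>F r in at_left 1. norm (of_real r * cis t) < 1"
    using eventually_at_left_1 by eventually_elim (auto simp: norm_mult)
  have e: "csum (cf (l2_cnj k)) z = qcnj (csum (cf k) z)" "ssum (cf (l2_cnj k)) z = qcnj (ssum (cf k) z)" if "norm z < 1" for z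
    using bounded_linear.sums[OF bounded_linear_qcnj csum_sums[OF ell2_cf[of k] that]]
      bounded_linear.sums[OF bounded_linear_qcnj ssum_sums[OF ell2_cf[of k] that]]
    by (simp_all add: csum_def ssum_def cf_l2_cnj scal sums_iff)
  have 1: "((\<lambda>r. csum (cf (l2_cnj k)) (of_real r * cis t)) \<longlongrightarrow> qcnj (bB (cf k) t)) (at_left 1)"
    by (rule Lim_transform_eventually[OF bounded_linear.tendsto[OF bounded_linear_qcnj conjunct1[OF assms[unfolded radial_def]]]])
       (use ev in \<open>eventually_elim, simp add: e\<close>)
  have 2: "((\<lambda>r. ssum (cf (l2_cnj k)) (of_real r * cis t)) \<longlongrightarrow> qcnj (bC (cf k) t)) (at_left 1)"
    by (rule Lim_transform_eventually[OF bounded_linear.tendsto[OF bounded_linear_qcnj conjunct2[OF assms[unfolded radial_def]]]])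
       (use ev in \<open>eventually_elim, simp add: e\<close>)
  show "radial (cf (l2_cnj k)) t" "bB (cf (l2_cnj k)) t = qcnj (bB (cf k) t)" "bC (cf (l2_cnj k)) t = qcnj (bC (cf k) t)"
    using radialI[OF 1 2] by auto
qed

lemma unimodular_l2_cnj: "unimodular (cf k) \<Longrightarrow> unimodular (cf (l2_cnj k))"
  unfolding unimodular_def
proof (erule eventually_mono)
  fix t
  assume *: "t \<in> {0..pi} \<longrightarrow> radial (cf k) t \<and> (\<forall>I\<in>imag_units. norm (bB (cf k) t + I * bC (cf k) t) = 1)"
  show "t \<in> {0..pi} \<longrightarrow> radial (cf (l2_cnj k)) t \<and> (\<forall>I\<in>imag_units. norm (bB (cf (l2_cnj k)) t + I * bC (cf (l2_cnj k)) t) = 1)"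
  proof
    assume "t \<in> {0..pi}"
    with * have r: "radial (cf k) t" and u: "\<forall>I\<in>imag_units. norm (bB (cf k) t + I * bC (cf k) t) = 1" by blast+
    show "radial (cf (l2_cnj k)) t \<and> (\<forall>I\<in>imag_units. norm (bB (cf (l2_cnj k)) t + I * bC (cf (l2_cnj k)) t) = 1)"
      unfolding radial_l2_cnj(2,3)[OF r] using radial_l2_cnj(1)[OF r] unit_affine_conj u by blast
  qed
qed

text \<open>Both properties amount to unimodularity: conjugating the coefficients preserves it and
  exchanges the two sides of multiplication.\<close>

theorem right_isometric_iff_left_isometric: "right_isometric (fp k) \<longleftrightarrow> left_isometric (fp k)"
proof
  assume "right_isometric (fp k)"
  from unimodular_right_isometric[OF unimodular_l2_cnj[OF right_isometric_unimodular[OF this]]] have "right_isometric (fp (l2_cnj k))" .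
  then show "left_isometric (fp k)" by (simp add: left_isometric_iff fp_l2_cnj)
next
  assume "left_isometric (fp k)"
  then have "right_isometric (fp (l2_cnj k))" by (simp add: left_isometric_iff fp_l2_cnj)
  from unimodular_right_isometric[OF unimodular_l2_cnj[OF right_isometric_unimodular[OF this]]] have "right_isometric (fp (l2_cnj (l2_cnj k)))" .
  then show "right_isometric (fp k)" by (simp add: l2_cnj_simps)
qed

section \<open>Slice regular functions and power series\<close>

lemma bounded_linear_slice: "bounded_linear (slice I)"
proof (rule bounded_linear_intro[of _ "1 + norm I"])
  fix z
  have "norm (slice I z) \<le> \<bar>Re z\<bar> + norm I * \<bar>Im z\<bar>"
    unfolding slice_alt by (rule order_trans[OF norm_triangle_ineq]) (simp add: mult.commute)
  also have "\<dots> \<le> norm z + norm I * norm z"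
    by (intro add_mono mult_left_mono abs_Re_le_cmod abs_Im_le_cmod) auto
  finally show "norm (slice I z) \<le> norm z * (1 + norm I)" by (simp add: algebra_simps)
qed (auto simp: slice_alt algebra_simps)

lemma bounded_linear_slice_mult: "bounded_linear (\<lambda>z. slice I z * p)"
  by (rule bounded_linear_compose[OF bounded_linear_mult_left bounded_linear_slice])

lemma slice_Complex: "slice I (Complex x y) = of_real x + of_real y * I"
  by (simp add: slice_def of_real_quat_commute)

lemma slice_components:
  "slice I w0 * 1 + slice I w1 * Quat 0 1 0 0 + slice I w2 * Quat 0 0 1 0 + slice I w3 * Quat 0 0 0 1
   = Quat (Re w0) (Re w1) (Re w2) (Re w3) + I * Quat (Im w0) (Im w1) (Im w2) (Im w3)"
  by (simp add: slice_def quat_eq_iff quat_mult_sel algebra_simps)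

lemma qseries_psum:
  assumes "ell2 a" "I \<in> imag_units" "norm z < 1"
  shows "qseries a (slice I z) = slice I (psum (\<lambda>n. qRe (a n)) z) * 1 + slice I (psum (\<lambda>n. qI (a n)) z) * Quat 0 1 0 0
    + slice I (psum (\<lambda>n. qJ (a n)) z) * Quat 0 0 1 0 + slice I (psum (\<lambda>n. qK (a n)) z) * Quat 0 0 0 1"
  unfolding qseries_slice[OF assms] csum_psum[OF assms(1,3)] slice_components ..

lemma norm_Complex: "norm (Complex x y) = norm (x, y)"
  by (simp add: cmod_def norm_prod_def)

lemma holomorphic_partials:
  assumes "g holomorphic_on ball 0 1" "norm (Complex x y) < 1"
  shows "((\<lambda>s. g (Complex s y)) has_vector_derivative deriv g (Complex x y)) (at x)"
    "((\<lambda>s. g (Complex x s)) has_vector_derivative \<i> * deriv g (Complex x y)) (at y)"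
proof -
  have d: "(g has_field_derivative deriv g (Complex x y)) (at (Complex x y))"
    by (rule holomorphic_derivI[OF assms(1)]) (use assms(2) in auto)
  have e: "(\<lambda>s. Complex s y) = (\<lambda>s. of_real s + \<i> * of_real y)" "(\<lambda>s. Complex x s) = (\<lambda>s. of_real x + \<i> * of_real s)"
    by (auto simp: complex_eq_iff)
  have 1: "((\<lambda>s. Complex s y) has_vector_derivative 1) (at x)"
    unfolding e by (auto intro!: derivative_eq_intros has_vector_derivative_real_field simp: has_vector_derivative_of_real)
  have 2: "((\<lambda>s. Complex x s) has_vector_derivative \<i>) (at y)"
    unfolding e by (auto intro!: derivative_eq_intros simp: has_vector_derivative_of_real)
  show "((\<lambda>s. g (Complex s y)) has_vector_derivative deriv g (Complex x y)) (at x)"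
    using field_vector_diff_chain_at[OF 1 d] by (simp add: comp_def)
  show "((\<lambda>s. g (Complex x s)) has_vector_derivative \<i> * deriv g (Complex x y)) (at y)"
    using field_vector_diff_chain_at[OF 2 d] by (simp add: comp_def)
qed

text \<open>On each slice the series combines four holomorphic functions, carried into the slice and
  multiplied by constant quaternions on the right. Multiplication by the complex unit becomes left
  multiplication by \<open>I\<close>, which relates the two partial derivatives.\<close>

theorem slice_regular_qseries:
  assumes a: "ell2 a"
  shows "slice_regular (qseries a)"
  unfolding slice_regular_def
proof
  fix I assume I: "I \<in> imag_units"
  define A0 A1 A2 A3 where "A0 = psum (\<lambda>n. qRe (a n))" and "A1 = psum (\<lambda>n. qI (a n))"
    and "A2 = psum (\<lambda>n. qJ (a n))" and "A3 = psum (\<lambda>n. qK (a n))"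
  have hol: "A0 holomorphic_on ball 0 1" "A1 holomorphic_on ball 0 1" "A2 holomorphic_on ball 0 1" "A3 holomorphic_on ball 0 1"
    unfolding A0_def A1_def A2_def A3_def using ell2_component[OF a, THEN psum_holomorphic] by auto
  define T where "T w0 w1 w2 w3 = slice I w0 * 1 + slice I w1 * Quat 0 1 0 0 + slice I w2 * Quat 0 0 1 0 + slice I w3 * Quat 0 0 0 1" for w0 w1 w2 w3
  define Fx where "Fx = (\<lambda>(x, y). T (deriv A0 (Complex x y)) (deriv A1 (Complex x y)) (deriv A2 (Complex x y)) (deriv A3 (Complex x y)))"
  define Fy where "Fy = (\<lambda>(x, y). T (\<i> * deriv A0 (Complex x y)) (\<i> * deriv A1 (Complex x y)) (\<i> * deriv A2 (Complex x y)) (\<i> * deriv A3 (Complex x y)))"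
  have eq: "qseries a (of_real x + of_real y * I) = T (A0 (Complex x y)) (A1 (Complex x y)) (A2 (Complex x y)) (A3 (Complex x y))"
    if "norm (x, y) < 1" for x y
    unfolding T_def A0_def A1_def A2_def A3_def slice_Complex[symmetric]
    by (rule qseries_psum[OF a I]) (simp add: norm_Complex that)
  have cC: "continuous_on (ball 0 1) (\<lambda>p. deriv A (Complex (fst p) (snd p)))" if "A holomorphic_on ball 0 1" for A
  proof (rule continuous_on_compose2[of "ball 0 1" "deriv A"])
    show "continuous_on (ball 0 1) (deriv A)"
      using that by (intro holomorphic_on_imp_continuous_on holomorphic_deriv) auto
    show "continuous_on (ball 0 1) (\<lambda>p. Complex (fst p) (snd p))"
      unfolding Complex_eq by (intro continuous_intros)
  qed (auto simp: norm_Complex)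
  have Fxc: "continuous_on (ball 0 1) Fx"
    unfolding Fx_def case_prod_beta T_def
    by (intro continuous_intros bounded_linear.continuous_on[OF bounded_linear_slice] cC hol)
  have Fyc: "continuous_on (ball 0 1) Fy"
    unfolding Fy_def case_prod_beta T_def
    by (intro continuous_intros bounded_linear.continuous_on[OF bounded_linear_slice] cC hol)
  have FF: "Fy p = I * Fx p" for p
  proof -
    have "slice I \<i> = I" by (simp add: slice_def)
    then show ?thesis by (cases p) (simp add: Fx_def Fy_def T_def slice_mult[OF I] distrib_left mult.assoc)
  qed
  show "\<exists>Fx Fy. continuous_on (ball 0 1) Fx \<and> continuous_on (ball 0 1) Fy \<and>
        (\<forall>(x, y) \<in> ball (0 :: real \<times> real) 1.
           ((\<lambda>s. qseries a (of_real s + of_real y * I)) has_vector_derivative Fx (x, y)) (at x) \<and>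
           ((\<lambda>s. qseries a (of_real x + of_real s * I)) has_vector_derivative Fy (x, y)) (at y) \<and>
           (1 / 2) *\<^sub>R (Fx (x, y) + I * Fy (x, y)) = 0)"
  proof (rule exI[of _ Fx], rule exI[of _ Fy], intro conjI ballI)
    show "continuous_on (ball 0 1) Fx" "continuous_on (ball 0 1) Fy" by (rule Fxc, rule Fyc)
  next
    fix p :: "real \<times> real" assume p: "p \<in> ball 0 1"
    obtain x y where xy: "p = (x, y)" by fastforce
    have n: "norm (x, y) < 1" "norm (Complex x y) < 1" using p xy by (auto simp: norm_Complex)
    have "((\<lambda>s. T (A0 (Complex s y)) (A1 (Complex s y)) (A2 (Complex s y)) (A3 (Complex s y))) has_vector_derivative Fx (x, y)) (at x)"
      unfolding Fx_def prod.case T_def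
      by (intro has_vector_derivative_add bounded_linear.has_vector_derivative[OF bounded_linear_slice_mult]
          holomorphic_partials hol n)
    then have 1: "((\<lambda>s. qseries a (of_real s + of_real y * I)) has_vector_derivative Fx (x, y)) (at x)"
    proof (rule has_vector_derivative_transform_within_open)
      have "open ((\<lambda>s::real. (s, y)) -` ball 0 1)" by (intro open_vimage continuous_intros) auto
      then show "open {s::real. norm (s, y) < 1}" by (simp only: vimage_def mem_ball_0)
    qed (use n eq in auto)
    have "((\<lambda>s. T (A0 (Complex x s)) (A1 (Complex x s)) (A2 (Complex x s)) (A3 (Complex x s))) has_vector_derivative Fy (x, y)) (at y)"
      unfolding Fy_def prod.case T_def
      by (intro has_vector_derivative_add bounded_linear.has_vector_derivative[OF bounded_linear_slice_mult]
          holomorphic_partials hol n)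
    then have 2: "((\<lambda>s. qseries a (of_real x + of_real s * I)) has_vector_derivative Fy (x, y)) (at y)"
    proof (rule has_vector_derivative_transform_within_open)
      have "open ((\<lambda>s::real. (x, s)) -` ball 0 1)" by (intro open_vimage continuous_intros) auto
      then show "open {s::real. norm (x, s) < 1}" by (simp only: vimage_def mem_ball_0)
    qed (use n eq in auto)
    have 3: "(1 / 2) *\<^sub>R (Fx (x, y) + I * Fy (x, y)) = 0"
      using imag_unitsD[OF I] by (simp add: FF mult.assoc[symmetric])
    show "case p of (x, y) \<Rightarrow> ((\<lambda>s. qseries a (of_real s + of_real y * I)) has_vector_derivative Fx (x, y)) (at x) \<and>
           ((\<lambda>s. qseries a (of_real x + of_real s * I)) has_vector_derivative Fy (x, y)) (at y) \<and>
           (1 / 2) *\<^sub>R (Fx (x, y) + I * Fy (x, y)) = 0"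
      using 1 2 3 xy by simp
  qed
qed

section \<open>From slice regular functions to power series\<close>

text \<open>Projects to the plane of the slice through \<open>I\<close> and reads it as the complex
  plane. Left multiplication by \<open>I\<close> becomes multiplication by the complex unit, so
  slice regularity becomes holomorphy; a right factor placed before projecting gives access to the
  remaining components.\<close>

definition cproj :: "quat \<Rightarrow> quat \<Rightarrow> complex" where
  "cproj I q = Complex (qRe q) (q \<bullet> I)"

lemma cproj_I: "I \<in> imag_units \<Longrightarrow> cproj I (I * q) = \<i> * cproj I q"
proof -
  assume "I \<in> imag_units"
  then have r: "qRe I = 0" and n: "(qI I)\<^sup>2 + (qJ I)\<^sup>2 + (qK I)\<^sup>2 = 1" by (auto simp: imag_units_iff)
  have "(I * q) \<bullet> I = qRe q * ((qI I)\<^sup>2 + (qJ I)\<^sup>2 + (qK I)\<^sup>2)"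
    by (simp add: r inner_quat_def quat_mult_sel power2_eq_square algebra_simps)
  then show ?thesis by (simp add: cproj_def complex_eq_iff n) (simp add: r inner_quat_def quat_mult_sel algebra_simps)
qed

lemma bounded_linear_cproj: "bounded_linear (cproj I)"
proof -
  have "bounded_linear (\<lambda>q. of_real (q \<bullet> 1) + \<i> * of_real (q \<bullet> I))"
    by (intro bounded_linear_add bounded_linear_compose[OF bounded_linear_mult_right]
        bounded_linear_compose[OF bounded_linear_of_real] bounded_linear_inner_left)
  moreover have "(\<lambda>q. of_real (q \<bullet> 1) + \<i> * of_real (q \<bullet> I)) = cproj I"
    by (auto simp: cproj_def complex_eq_iff inner_quat_def)
  ultimately show ?thesis by simp
qed

lemma cproj_diff: "cproj I (p - q) = cproj I p - cproj I q"
  by (rule linear_diff[OF bounded_linear.linear[OF bounded_linear_cproj]])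

text \<open>Continuity of the partial derivatives, part of slice regularity, gives real
  differentiability; the slice equation then makes the derivative complex linear.\<close>

lemma slice_regular_holomorphic:
  assumes F: "slice_regular F" and I: "I \<in> imag_units"
  shows "(\<lambda>z. cproj I (F (slice I z) * p)) holomorphic_on ball 0 1"
proof -
  obtain Fx Fy where c: "continuous_on (ball 0 1) Fx" "continuous_on (ball 0 1) Fy" and
    d: "\<And>x y. norm (x, y) < 1 \<Longrightarrow>
      ((\<lambda>s. F (of_real s + of_real y * I)) has_vector_derivative Fx (x, y)) (at x) \<and>
      ((\<lambda>s. F (of_real x + of_real s * I)) has_vector_derivative Fy (x, y)) (at y) \<and>
      (1 / 2) *\<^sub>R (Fx (x, y) + I * Fy (x, y)) = 0"
    using F I unfolding slice_regular_def by fastforce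
  define g where "g x y = cproj I (F (of_real x + of_real y * I) * p)" for x y
  have bl: "bounded_linear (\<lambda>q. cproj I (q * p))"
    by (rule bounded_linear_compose[OF bounded_linear_cproj bounded_linear_mult_left])
  define gx gy where "gx v = cproj I (Fx v * p)" and "gy v = cproj I (Fy v * p)" for v
  have gd: "((\<lambda>s. g s y) has_vector_derivative gx (x, y)) (at x)" "((\<lambda>s. g x s) has_vector_derivative gy (x, y)) (at y)"
    "gy (x, y) = \<i> * gx (x, y)" if "norm (x, y) < 1" for x y
  proof -
    show "((\<lambda>s. g s y) has_vector_derivative gx (x, y)) (at x)" "((\<lambda>s. g x s) has_vector_derivative gy (x, y)) (at y)"
      unfolding g_def gx_def gy_def using d[OF that] by (auto intro: bounded_linear.has_vector_derivative[OF bl])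
    have "Fx (x, y) = - (I * Fy (x, y))" using d[OF that] by (simp add: add_eq_0_iff)
    then have "Fy (x, y) = I * Fx (x, y)" using imag_unitsD[OF I] by (simp add: mult.assoc[symmetric])
    then have "Fy (x, y) * p = I * (Fx (x, y) * p)" by (simp add: mult.assoc)
    then show "gy (x, y) = \<i> * gx (x, y)" unfolding gx_def gy_def using cproj_I[OF I] by simp
  qed
  have "((\<lambda>z. cproj I (F (slice I z) * p)) has_field_derivative gx (Re w, Im w)) (at w)" if w: "w \<in> ball 0 1" for w
  proof -
    obtain x y where xy: "w = Complex x y" by (cases w)
    have n: "(x, y) \<in> ball 0 1" using w by (simp add: xy norm_Complex)
    \<comment> \<open>The criterion for differentiability from partial derivatives works on a
      product with a convex second factor, so a box is chosen inside the disc.\<close>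
    obtain X Y where XY: "open X" "open Y" "x \<in> X" "y \<in> Y" "convex Y" "X \<times> Y \<subseteq> ball 0 1"
    proof -
      obtain A B where AB: "open A" "open B" "x \<in> A" "y \<in> B" "A \<times> B \<subseteq> ball 0 1"
        using open_prod_elim[OF open_ball n] by (metis mem_Sigma_iff)
      obtain e where "0 < e" "ball y e \<subseteq> B" using AB(2,4) open_contains_ball by blast
      then show thesis using AB by (intro that[of A "ball y e"]) auto
    qed
    have "((\<lambda>(x, y). g x y) has_derivative (\<lambda>(tx, ty). tx *\<^sub>R gx (x, y) + blinfun_apply (blinfun_scaleR_left (gy (x, y))) ty))
        (at (x, y) within X \<times> Y)"
    proof (rule has_derivative_partialsI)
      show "((\<lambda>x. g x y) has_derivative (\<lambda>tx. tx *\<^sub>R gx (x, y))) (at x within X)"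
        using gd(1)[of x y] n by (auto simp: has_vector_derivative_def intro: has_derivative_at_withinI)
      show "((\<lambda>y. g x y) has_derivative blinfun_apply (blinfun_scaleR_left (gy (x, y)))) (at y within Y)"
        if "x \<in> X" "y \<in> Y" for x y
      proof -
        have "norm (x, y) < 1" using that XY(6) by auto
        then show ?thesis using gd(2)[of x y] by (auto simp: has_vector_derivative_def intro: has_derivative_at_withinI)
      qed
      have "continuous_on (X \<times> Y) gy"
        unfolding gy_def by (intro bounded_linear.continuous_on[OF bl] continuous_on_subset[OF c(2) XY(6)])
      then have "continuous_on (X \<times> Y) (\<lambda>v. blinfun_scaleR_left (gy v))"
        by (rule bounded_linear.continuous_on[OF bounded_linear_blinfun_scaleR_left])
      then show "continuous (at (x, y) within X \<times> Y) (\<lambda>(x, y). blinfun_scaleR_left (gy (x, y)))"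
        using XY by (simp add: continuous_on_eq_continuous_within case_prod_unfold)
    qed (use XY in auto)
    then have D: "((\<lambda>v. g (fst v) (snd v)) has_derivative (\<lambda>v. fst v *\<^sub>R gx (x, y) + snd v *\<^sub>R gy (x, y))) (at (x, y))"
      using XY by (simp add: at_within_open[OF _ open_Times] case_prod_unfold)
    have "((\<lambda>z. (Re z, Im z)) has_derivative (\<lambda>z. (Re z, Im z))) (at w)"
      by (intro bounded_linear_imp_has_derivative bounded_linear_Pair bounded_linear_Re bounded_linear_Im)
    moreover have "((\<lambda>v. g (fst v) (snd v)) has_derivative (\<lambda>v. fst v *\<^sub>R gx (x, y) + snd v *\<^sub>R gy (x, y))) (at (Re w, Im w))"
      using D by (simp add: xy)
    ultimately have "(((\<lambda>v. g (fst v) (snd v)) \<circ> (\<lambda>z. (Re z, Im z))) has_derivative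
        ((\<lambda>v. fst v *\<^sub>R gx (x, y) + snd v *\<^sub>R gy (x, y)) \<circ> (\<lambda>z. (Re z, Im z)))) (at w)"
      by (rule diff_chain_at)
    then have "((\<lambda>z. g (Re z) (Im z)) has_derivative (\<lambda>h. Re h *\<^sub>R gx (x, y) + Im h *\<^sub>R gy (x, y))) (at w)"
      by (simp add: comp_def xy)
    moreover have "(\<lambda>h. Re h *\<^sub>R gx (x, y) + Im h *\<^sub>R gy (x, y)) = (*) (gx (x, y))"
      using gd(3)[of x y] n by (auto simp: complex_eq_iff algebra_simps)
    moreover have "(\<lambda>z. g (Re z) (Im z)) = (\<lambda>z. cproj I (F (slice I z) * p))"
      by (simp add: g_def slice_def of_real_quat_commute)
    ultimately show ?thesis by (simp add: has_field_derivative_def xy)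
  qed
  then show ?thesis unfolding holomorphic_on_open[OF open_ball] by blast
qed

text \<open>The quaternions split as two copies of the complex plane of i, the second multiplied by
  j on the right; a slice regular function becomes a pair of holomorphic functions.\<close>

lemma slice_splitting:
  "q = slice (Quat 0 1 0 0) (cproj (Quat 0 1 0 0) q) * 1
     + slice (Quat 0 1 0 0) (cproj (Quat 0 1 0 0) (q * Quat 0 0 (-1) 0)) * Quat 0 0 1 0"
  by (simp add: quat_eq_iff slice_def cproj_def inner_quat_def quat_mult_sel)

lemma cproj_zero: "(\<And>p. cproj I (q * p) = 0) \<Longrightarrow> q = 0"
proof -
  assume "\<And>p. cproj I (q * p) = 0"
  from this[of "qcnj q"] have "(norm q)\<^sup>2 = 0" by (simp add: cproj_def qcnj_mult_self complex_eq_iff del: of_real_power)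
  then show "q = 0" by simp
qed

text \<open>A bound on one slice bounds the values at a point and at its complex conjugate, whose
  mean square is the circle energy. Parseval on the circle of radius \<open>r\<close> bounds the
  weighted square sums by the square of \<open>M\<close>, and \<open>r\<close> tends to 1.\<close>

lemma bounded_series_ell2:
  fixes a :: "nat \<Rightarrow> quat"
  assumes sums: "\<And>z. norm z < 1 \<Longrightarrow> (\<lambda>n. slice I z ^ n * a n) sums G (slice I z)" and I: "I \<in> imag_units"
    and bd: "\<And>z. norm z < 1 \<Longrightarrow> norm (G (slice I z)) \<le> M"
  shows "ell2 a"
proof -
  \<comment> \<open>The hypothesis is mere convergence. Convergence at the larger radius
    \<open>s\<close> bounds the terms there, and comparison with a geometric series gives absolute
    convergence at \<open>r\<close>.\<close>
  have abs: "summable (\<lambda>n. r ^ n * norm (a n))" if "0 \<le> r" "r < 1" for r :: real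
  proof -
    define s where "s = (r + 1) / 2"
    have s: "r < s" "0 < s" "s < 1" using that by (auto simp: s_def)
    have "(\<lambda>n. slice I (of_real s) ^ n * a n) \<longlonglongrightarrow> 0"
      using sums[of "of_real s"] s by (intro summable_LIMSEQ_zero sums_summable) auto
    then have "(\<lambda>n. norm (slice I (of_real s) ^ n * a n)) \<longlonglongrightarrow> 0" by (rule tendsto_norm_zero)
    then have "(\<lambda>n. s ^ n * norm (a n)) \<longlonglongrightarrow> 0"
      using s by (simp add: slice_of_real norm_mult norm_power)
    then have "Bseq (\<lambda>n. s ^ n * norm (a n))" using convergent_imp_Bseq convergent_def by blast
    then obtain K where K: "\<And>n. norm (s ^ n * norm (a n)) \<le> K" unfolding Bseq_def by blast
    show ?thesis
    proof (rule summable_comparison_test'[of _ 0])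
      show "summable (\<lambda>n. K * (r / s) ^ n)" using that s by (intro summable_mult summable_geometric) auto
      fix n
      have "r ^ n * norm (a n) = (r / s) ^ n * (s ^ n * norm (a n))" using s by (simp add: power_divide)
      also have "\<dots> \<le> (r / s) ^ n * K" using K[of n] s that by (intro mult_left_mono) auto
      finally show "norm (r ^ n * norm (a n)) \<le> K * (r / s) ^ n" using that by (simp add: mult.commute)
    qed
  qed
  have split: "norm (csum a z + I * ssum a z) \<le> M" if z: "norm z < 1" for z
  proof -
    have sm: "summable (\<lambda>n. c n *\<^sub>R a n)" if "\<And>n. \<bar>c n\<bar> \<le> norm z ^ n" for c
      by (rule summable_norm_cancel, rule summable_comparison_test'[OF abs[of "norm z"], of 0])
         (use that z in \<open>auto intro: mult_right_mono\<close>)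
    have "(\<lambda>n. slice I (z ^ n) * a n) sums (csum a z + I * ssum a z)"
      unfolding slice_mult_left csum_def ssum_def
      by (intro sums_add sums_mult summable_sums sm abs_Re_power abs_Im_power)
    then have "(\<lambda>n. slice I z ^ n * a n) sums (csum a z + I * ssum a z)" by (simp add: slice_power I)
    from sums_unique2[OF this sums[OF z]] show ?thesis using bd[OF z] by simp
  qed
  have M0: "0 \<le> M" using order_trans[OF norm_ge_zero bd[of 0]] by simp
  \<comment> \<open>Passing to the conjugate point keeps \<open>csum\<close> and negates
    \<open>ssum\<close>, which has the same effect as replacing \<open>I\<close> by its
    negative.\<close>
  have E: "circle_energy a r t \<le> M\<^sup>2" if "0 \<le> r" "r < 1" for r t
  proof -
    have n: "norm (of_real r * cis t) < 1" "norm (of_real r * cis (- t)) < 1" using that by (auto simp: norm_mult)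
    have cn: "cis (- t) ^ n = cnj (cis t ^ n)" for n by (simp only: cis_cnj complex_cnj_power)
    have "Re ((of_real r * cis (- t)) ^ n) = Re ((of_real r * cis t) ^ n)"
      "Im ((of_real r * cis (- t)) ^ n) = - Im ((of_real r * cis t) ^ n)" for n
      by (simp_all add: power_mult_distrib cn del: complex_cnj_power flip: of_real_power)
    then have "csum a (of_real r * cis (- t)) = csum a (of_real r * cis t)"
      "ssum a (of_real r * cis (- t)) = (\<Sum>n. - (Im ((of_real r * cis t) ^ n) *\<^sub>R a n))"
      by (simp_all add: csum_def ssum_def)
    moreover have "summable (\<lambda>n. Im ((of_real r * cis t) ^ n) *\<^sub>R a n)"
      by (rule summable_norm_cancel, rule summable_comparison_test'[OF abs[of r], of 0])
         (use that abs_Im_power[of "of_real r * cis t"] in \<open>auto intro!: mult_right_mono simp: norm_mult\<close>)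
    ultimately have c: "csum a (of_real r * cis (- t)) = csum a (of_real r * cis t)"
      "ssum a (of_real r * cis (- t)) = - ssum a (of_real r * cis t)"
      by (simp_all add: ssum_def suminf_minus)
    have "(norm (csum a (of_real r * cis t) + I * ssum a (of_real r * cis t)))\<^sup>2 \<le> M\<^sup>2"
      "(norm (csum a (of_real r * cis t) + (- I) * ssum a (of_real r * cis t)))\<^sup>2 \<le> M\<^sup>2"
      using split[OF n(1)] split[OF n(2)] by (auto simp: c intro!: power_mono)
    then have "2 * circle_energy a r t \<le> M\<^sup>2 + M\<^sup>2" unfolding circle_energy_def boundary_energy_average[OF I] by (rule add_mono)
    then show ?thesis by simp
  qed
  have le: "(\<Sum>n<N. (norm (r ^ n *\<^sub>R a n))\<^sup>2) \<le> M\<^sup>2" if r: "0 \<le> r" "r < 1" for r N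
  proof -
    have sm: "summable (\<lambda>n. norm (r ^ n *\<^sub>R a n))" using abs[OF r] r by simp
    have P: "(circle_energy a r has_integral (pi * (\<Sum>n. (norm (r ^ n *\<^sub>R a n))\<^sup>2))) {0..pi}"
      using trig_parseval[OF sm, of 1] by (simp add: circle_energy_def[abs_def] csum_circle)
    have "pi * (\<Sum>n. (norm (r ^ n *\<^sub>R a n))\<^sup>2) \<le> pi * M\<^sup>2"
      using has_integral_le[OF P has_integral_const_real[of "M\<^sup>2" 0 pi]] E[OF r] by simp
    then have "(\<Sum>n. (norm (r ^ n *\<^sub>R a n))\<^sup>2) \<le> M\<^sup>2" by simp
    moreover have "summable (\<lambda>n. (norm (r ^ n *\<^sub>R a n))\<^sup>2)"
    proof (rule summable_comparison_test_ev)
      have "(\<lambda>n. norm (r ^ n *\<^sub>R a n)) \<longlonglongrightarrow> 0" by (rule summable_LIMSEQ_zero[OF sm])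
      then have "\<forall>\<^sub>F n in sequentially. norm (r ^ n *\<^sub>R a n) < 1" by (rule order_tendstoD) simp
      then show "\<forall>\<^sub>F n in sequentially. norm ((norm (r ^ n *\<^sub>R a n))\<^sup>2) \<le> norm (r ^ n *\<^sub>R a n)"
      proof eventually_elim
        case (elim n)
        have "norm (x\<^sup>2) \<le> x" if "0 \<le> x" "x < 1" for x :: real
          using that by (simp add: power2_eq_square mult_left_le_one_le)
        from this[OF norm_ge_zero elim] show ?case .
      qed
    qed (rule sm)
    ultimately show ?thesis using sum_le_suminf[of "\<lambda>n. (norm (r ^ n *\<^sub>R a n))\<^sup>2" "{..<N}"] by auto
  qed
  have "(\<Sum>n<N. (norm (a n))\<^sup>2) \<le> M\<^sup>2" for N
  proof (rule LIMSEQ_le_const2)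
    have "(\<lambda>k. \<Sum>n<N. (norm (radii k ^ n *\<^sub>R a n))\<^sup>2) \<longlonglongrightarrow> (\<Sum>n<N. (norm (1 ^ n *\<^sub>R a n))\<^sup>2)"
      by (intro tendsto_intros radii_lim)
    then show "(\<lambda>k. \<Sum>n<N. (norm (radii k ^ n *\<^sub>R a n))\<^sup>2) \<longlonglongrightarrow> (\<Sum>n<N. (norm (a n))\<^sup>2)" by simp
    show "\<exists>K. \<forall>k\<ge>K. (\<Sum>n<N. (norm (radii k ^ n *\<^sub>R a n))\<^sup>2) \<le> M\<^sup>2"
      using le radii by (meson less_imp_le)
  qed
  then show ?thesis unfolding ell2_def by (intro summableI_nonneg_bounded) auto
qed

text \<open>The coefficients come from the slice of i. The real axis lies in every slice, so
  agreement there extends by the identity theorem to each slice in turn.\<close>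

theorem slice_regular_bounded_series:
  assumes F: "slice_regular F" and bd: "bounded (F ` ball 0 1)"
  shows "\<exists>a. ell2 a \<and> (\<forall>q\<in>ball 0 1. F q = qseries a q)"
proof -
  let ?i = "Quat 0 1 0 0" and ?j = "Quat 0 0 1 0"
  define \<alpha> where "\<alpha> z = cproj ?i (F (slice ?i z) * 1)" for z
  define \<beta> where "\<beta> z = cproj ?i (F (slice ?i z) * Quat 0 0 (-1) 0)" for z
  have hol: "\<alpha> holomorphic_on ball 0 1" "\<beta> holomorphic_on ball 0 1"
    unfolding \<alpha>_def \<beta>_def by (intro slice_regular_holomorphic[OF F i_imag_unit])+
  define an where "an n = (deriv ^^ n) \<alpha> 0 / fact n" for n
  define bn where "bn n = (deriv ^^ n) \<beta> 0 / fact n" for n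
  define a where "a n = slice ?i (an n) * 1 + slice ?i (bn n) * ?j" for n
  have sums: "(\<lambda>n. slice ?i z ^ n * a n) sums F (slice ?i z)" if z: "norm z < 1" for z
  proof -
    have "(\<lambda>n. an n * z ^ n) sums \<alpha> z" "(\<lambda>n. bn n * z ^ n) sums \<beta> z"
      using holomorphic_power_series[OF hol(1), of z] holomorphic_power_series[OF hol(2), of z] z
      by (simp_all add: an_def bn_def)
    then have "(\<lambda>n. slice ?i (an n * z ^ n) * 1 + slice ?i (bn n * z ^ n) * ?j) sums (slice ?i (\<alpha> z) * 1 + slice ?i (\<beta> z) * ?j)"
      by (intro sums_add bounded_linear.sums[OF bounded_linear_slice_mult])
    moreover have "slice ?i (\<alpha> z) * 1 + slice ?i (\<beta> z) * ?j = F (slice ?i z)"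
      using slice_splitting[of "F (slice ?i z)"] by (simp add: \<alpha>_def \<beta>_def)
    moreover have "slice ?i (an n * z ^ n) * 1 + slice ?i (bn n * z ^ n) * ?j = slice ?i z ^ n * a n" for n
      unfolding a_def distrib_left mult.assoc[symmetric] slice_power[OF i_imag_unit, symmetric] slice_mult[OF i_imag_unit, symmetric]
      by (simp add: mult.commute)
    ultimately show ?thesis by simp
  qed
  obtain M where M: "\<And>q. q \<in> ball 0 1 \<Longrightarrow> norm (F q) \<le> M" using bd unfolding bounded_iff by blast
  have ell: "ell2 a"
    by (rule bounded_series_ell2[OF sums i_imag_unit]) (auto intro!: M simp: norm_slice[OF i_imag_unit])
  have onreal: "F (of_real r) = qseries a (of_real r)" if "\<bar>r\<bar> < 1" for r :: real
    using sums_unique[OF sums[of "of_real r"]] that by (simp add: slice_of_real qseries_def)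
  have "F q = qseries a q" if q: "q \<in> ball 0 1" for q
  proof -
    obtain I w where Iw: "I \<in> imag_units" "q = slice I w" using ex_slice by blast
    have w: "w \<in> ball 0 1" using q Iw norm_slice by simp
    have "cproj I ((F q - qseries a q) * p) = 0" for p
    proof -
      define g where "g z = cproj I (F (slice I z) * p) - cproj I (qseries a (slice I z) * p)" for z
      \<comment> \<open>The identity theorem with the positive real points, which accumulate at
        0.\<close>
      have "g w = 0"
      proof (rule analytic_continuation[of g "ball 0 1" "of_real ` {0<..<1}" 0])
        show "g holomorphic_on ball 0 1"
          unfolding g_def by (intro holomorphic_on_diff slice_regular_holomorphic F slice_regular_qseries ell Iw)
        show "(0::complex) islimpt of_real ` {0<..<1}"
          unfolding islimpt_approachable
        proof (intro allI impI)
          fix e :: real assume e: "0 < e"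
          have "0 < min (1/2) (e/2)" "min (1/2) (e/2) < 1" "min (1/2) (e/2) < e" using e by (auto simp: min_def)
          then show "\<exists>x'\<in>complex_of_real ` {0<..<1}. x' \<noteq> 0 \<and> dist x' 0 < e"
            by (intro bexI[of _ "of_real (min (1/2) (e/2))"]) auto
        qed
        show "g z = 0" if "z \<in> of_real ` {0<..<1}" for z
          using that onreal by (auto simp: g_def slice_of_real)
      qed (use w in auto)
      then show ?thesis by (simp add: g_def Iw left_diff_distrib cproj_diff)
    qed
    then have "F q - qseries a q = 0" by (rule cproj_zero)
    then show ?thesis by simp
  qed
  then show ?thesis using ell by blast
qed

section \<open>Inner-outer factorization\<close>

lemma coeffs_l2:
  assumes "f \<in> H2"
  obtains x where "cf x = coeffs f" "has_boundary_value (qseries (cf x)) f"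
  using H2_coeffs[OF assms] ell2E[OF H2_coeffs(1)[OF assms]] by metis

lemma boundary_value_H2: "ell2 a \<Longrightarrow> boundary_value (qseries a) \<in> H2"
  unfolding H2_def using has_boundary_value_qseries by blast

lemma coeffs_cf: "coeffs (boundary_value (qseries (cf x))) = cf x"
  by (rule coeffs_boundary_value) simp

lemma has_boundary_value_cong:
  assumes "\<And>q. q \<in> ball 0 1 \<Longrightarrow> F q = G q" "has_boundary_value F f"
  shows "has_boundary_value G f"
proof -
  have "AE q in boundary_measure. q \<in> qboundary"
    using AE_space[of boundary_measure] by (simp add: boundary_measure_def space_restrict_space)
  then show ?thesis using assms(2) unfolding has_boundary_value_def
  proof eventually_elim
    case (elim q)
    then obtain t I where I: "I \<in> imag_units" "q = qexp t I" unfolding qboundary_def by blast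
    show ?case
    proof (rule Lim_transform_eventually[OF elim(2)])
      show "\<forall>\<^sub>F r in at_left 1. F (of_real r * q) = G (of_real r * q)"
        using eventually_at_left_1
      proof eventually_elim
        case (elim r)
        then have "norm (of_real r * q) < 1"
          using norm_slice[OF I(1), of "of_real r * cis t"] by (simp add: slice_polar I norm_mult)
        then show ?case by (intro assms) simp
      qed
    qed
  qed
qed

lemma Hinf_l2:
  assumes "f \<in> Hinf"
  obtains x where "cf x = coeffs f" "has_boundary_value (qseries (cf x)) f"
proof -
  obtain F where F: "slice_regular F" "bounded (F ` ball 0 1)" "has_boundary_value F f"
    using assms unfolding Hinf_def by blast
  from slice_regular_bounded_series[OF F(1,2)] obtain a where a: "ell2 a" "\<And>q. q \<in> ball 0 1 \<Longrightarrow> F q = qseries a q" by blast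
  have h: "has_boundary_value (qseries a) f" by (rule has_boundary_value_cong[OF a(2) F(3)])
  obtain x where "a = cf x" using ell2E[OF a(1)] .
  then show thesis using that[of x] coeffs_eq[OF a(1) h] h by simp
qed

lemma moduli_pi:
  assumes "has_boundary_value (qseries (cf x)) f" "has_boundary_value (qseries (cf y)) g"
    "AE q in boundary_measure. norm (f q) = norm (g q)"
  shows "AE t in lborel. t \<in> {0..pi} \<longrightarrow> (radial (cf x) t \<and> radial (cf y) t \<and>
      (\<forall>I\<in>imag_units. norm (bB (cf x) t + I * bC (cf x) t) = norm (bB (cf y) t + I * bC (cf y) t)))"
  using boundary_moduli[OF ell2_cf assms(1) ell2_cf assms(2,3)]
  by eventually_elim auto

lemma norm_boundary_eqI:
  assumes x: "has_boundary_value (qseries (cf x)) f" and y: "has_boundary_value (qseries (cf y)) g"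
    and "AE t in lborel. t \<in> {0..pi} \<longrightarrow> (radial (cf x) t \<and> radial (cf y) t \<and>
      (\<forall>I\<in>imag_units. norm (bB (cf x) t + I * bC (cf x) t) = norm (bB (cf y) t + I * bC (cf y) t)))"
  shows "AE q in boundary_measure. norm (f q) = norm (g q)"
proof -
  have *: "AE q in boundary_measure. norm (boundary_value (qseries (cf x)) q) = norm (boundary_value (qseries (cf y)) q)"
  proof (rule AE_boundaryI)
    show "AE t in lborel. t \<in> {0..pi} \<longrightarrow> (\<forall>I\<in>imag_units.
      norm (boundary_value (qseries (cf x)) (qexp t I)) = norm (boundary_value (qseries (cf y)) (qexp t I)))"
      using assms(3)
    proof eventually_elim
      case (elim t)
      have "boundary_value (qseries (cf z)) (qexp t I) = bB (cf z) t + I * bC (cf z) t"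
        if "radial (cf z) t" "I \<in> imag_units" for z I
        unfolding boundary_value_def using radial_qseries[OF ell2_cf that] by (intro tendsto_Lim) auto
      then show ?case using elim by simp
    qed
  qed
  have bv: "AE q in boundary_measure. f q = boundary_value (qseries (cf z)) q" if "has_boundary_value (qseries (cf z)) f" for z f
    using that unfolding has_boundary_value_def
  proof eventually_elim
    case (elim q)
    then show ?case unfolding boundary_value_def by (intro tendsto_Lim[symmetric]) auto
  qed
  show ?thesis using * bv[OF x] bv[OF y] by eventually_elim simp
qed

lemma has_boundary_value_eq:
  assumes "has_boundary_value F f"
  shows "f \<doteq> boundary_value F"
  using assms unfolding has_boundary_value_def
proof eventually_elim
  case (elim q)
  then show ?case unfolding boundary_value_def by (intro tendsto_Lim[symmetric]) auto
qed

lemma const_boundary: "has_boundary_value (qseries (cf (l2_smult c e0))) (\<lambda>_. c)"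
proof -
  have "qseries (cf (l2_smult c e0)) q = c" for q
  proof -
    have "(\<Sum>n. q ^ n * cf (l2_smult c e0) n) = (\<Sum>n\<in>{0}. q ^ n * cf (l2_smult c e0) n)"
      by (rule suminf_finite) (auto simp: cf_l2_smult cf_e0)
    then show ?thesis by (simp add: qseries_def cf_l2_smult cf_e0)
  qed
  then show ?thesis unfolding has_boundary_value_def by simp
qed

lemma coeffs_const: "coeffs (\<lambda>_. c) = cf (l2_smult c e0)"
  by (rule coeffs_eq[OF ell2_cf const_boundary])

lemma fp_l2_smult: "fp (l2_smult c x) = fps_const c * fp x"
  by (simp add: fps_eq_iff cf_l2_smult)

lemma star_prod_eq:
  assumes "coeffs f = cf x" "coeffs g = cf y" "fp z = fp x * fp y"
  shows "f \<star> g = boundary_value (qseries (cf z))"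
  unfolding star_prod_def assms(1,2) fp_mult_cf[OF assms(3)] ..

text \<open>The boundary condition is unimodularity, which is equivalent to the isometric property,
  and the interior bound is the kernel estimate.\<close>

lemma inner_iff:
  assumes "has_boundary_value (qseries (cf k)) \<phi>"
  shows "inner_function \<phi> \<longleftrightarrow> \<phi> \<in> Hinf \<and> right_isometric (fp k)"
proof -
  have c: "coeffs \<phi> = cf k" by (rule coeffs_eq[OF ell2_cf assms])
  have one: "has_boundary_value (qseries (cf e0)) (\<lambda>_. 1)" using const_boundary[of 1] by (simp add: Q.act_1)
  have u: "(AE q in boundary_measure. norm (\<phi> q) = 1) \<longleftrightarrow> right_isometric (fp k)"
  proof
    assume "AE q in boundary_measure. norm (\<phi> q) = 1"
    then have "AE q in boundary_measure. norm (\<phi> q) = norm (1::quat)" by simp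
    from moduli_pi[OF assms one this] have "unimodular (cf k)"
      unfolding unimodular_def by eventually_elim (simp add: radial_e0)
    then show "right_isometric (fp k)" by (rule unimodular_right_isometric)
  next
    assume "right_isometric (fp k)"
    then have "unimodular (cf k)" by (rule right_isometric_unimodular)
    then have "AE t in lborel. t \<in> {0..pi} \<longrightarrow> (radial (cf k) t \<and> radial (cf e0) t \<and>
      (\<forall>I\<in>imag_units. norm (bB (cf k) t + I * bC (cf k) t) = norm (bB (cf e0) t + I * bC (cf e0) t)))"
      unfolding unimodular_def by eventually_elim (simp add: radial_e0)
    from norm_boundary_eqI[OF assms one this] show "AE q in boundary_measure. norm (\<phi> q) = 1" by simp
  qed
  then show ?thesis unfolding inner_function_def extension_def c using right_isometric_bounded[of k] by auto
qed

lemma inner_boundary_value: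
  assumes "right_isometric (fp k)"
  shows "inner_function (boundary_value (qseries (cf k)))"
proof -
  have h: "has_boundary_value (qseries (cf k)) (boundary_value (qseries (cf k)))"
    by (rule has_boundary_value_qseries) simp
  have "bounded (qseries (cf k) ` ball 0 1)"
    unfolding bounded_iff using right_isometric_bounded[OF assms] by (intro exI[of _ 1]) auto
  then have "boundary_value (qseries (cf k)) \<in> Hinf"
    unfolding Hinf_def using slice_regular_qseries[OF ell2_cf] h by blast
  then show ?thesis unfolding inner_iff[OF h] using assms by blast
qed

lemma innerE:
  assumes "inner_function \<phi>"
  obtains k where "coeffs \<phi> = cf k" "has_boundary_value (qseries (cf k)) \<phi>" "right_isometric (fp k)" "left_isometric (fp k)"
proof -
  have "\<phi> \<in> Hinf" using assms unfolding inner_function_def by blast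
  then obtain k where k: "cf k = coeffs \<phi>" "has_boundary_value (qseries (cf k)) \<phi>" using Hinf_l2 by blast
  then have "right_isometric (fp k)" using assms inner_iff by blast
  then show thesis using that[of k] k right_isometric_iff_left_isometric by simp
qed

text \<open>The product has modulus \<open>|x(q)|\<close> times the modulus of \<open>u\<close> at
  another point of the ball, which is at most 1; where \<open>x\<close> vanishes, so does the
  product.\<close>

lemma norm_qseries_mult_le:
  assumes "fp y = fp x * fp u" "right_isometric (fp u)" "norm q < 1"
  shows "norm (qseries (cf y) q) \<le> norm (qseries (cf x) q)"
proof -
  obtain I z where Iz: "I \<in> imag_units" "q = slice I z" using ex_slice by blast
  have z: "norm z < 1" using assms(3) Iz norm_slice by simp
  show ?thesis
  proof (cases "qseries (cf x) q = 0")
    case True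
    then show ?thesis using qseries_mult[OF assms(1) Iz(1) z] by (simp add: Iz)
  next
    case False
    then obtain J where J: "J \<in> imag_units"
      "norm (qseries (cf y) (slice I z)) = norm (qseries (cf x) (slice I z)) * norm (qseries (cf u) (slice J z))"
      using norm_qseries_mult[OF assms(1) Iz(1) z] unfolding Iz(2) by blast
    have "norm (qseries (cf u) (slice J z)) \<le> 1"
      using right_isometric_bounded[OF assms(2)] norm_slice[OF J(1)] z by simp
    then show ?thesis unfolding Iz(2) J(2) by (intro mult_left_le) auto
  qed
qed

lemma finite_fps_mult: "finite_fps p \<Longrightarrow> finite_fps q \<Longrightarrow> finite_fps (p * q)"
proof -
  assume "finite_fps p" "finite_fps q"
  then obtain M N where MN: "\<And>n. n \<ge> M \<Longrightarrow> p $ n = 0" "\<And>n. n \<ge> N \<Longrightarrow> q $ n = 0" unfolding finite_fps_def by blast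
  have "p $ i * q $ (n - i) = 0" if "n \<ge> M + N" for n i
    using MN(1)[of i] MN(2)[of "n - i"] that by (cases "i \<ge> M") auto
  then show ?thesis unfolding finite_fps_def fps_mult_nth
    by (intro exI[of _ "M + N"] allI impI sum.neutral ballI)
qed

section \<open>Outer functions and cyclic series\<close>

lemma bounded_op_finite_fps:
  assumes "finite_fps p"
  shows "bounded_op (\<lambda>f. p * f)"
proof -
  obtain N where N: "p = trunc N (fps_nth p)" using finE[OF assms] .
  have "\<exists>y. fp y = p * fp x \<and> norm y \<le> (\<Sum>k<N. norm (p $ k)) * norm x" for x
  proof (intro exI conjI)
    show "fp (Q.comb N (fps_nth p) x) = p * fp x" using N by (simp add: fp_comb)
    show "norm (Q.comb N (fps_nth p) x) \<le> (\<Sum>k<N. norm (p $ k)) * norm x"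
      unfolding Q.comb_def sum_distrib_right
      by (rule sum_norm_le) (simp add: Q.funpow_S(2) norm_l2_smult)
  qed
  then show ?thesis by (intro bddI) (simp_all add: right_diff_distrib)
qed

text \<open>If \<open>f\<close> and \<open>g\<close> have the same modulus on the boundary, then \<open>p * g \<mapsto> p * f\<close> is isometric; for
  cyclic \<open>g\<close> it extends to right multiplication by an inner function.\<close>

lemma left_cyclic_outer:
  assumes g: "has_boundary_value (qseries (cf y)) g" and cyc: "left_cyclic y"
  shows "outer_function g"
proof -
  have cg: "coeffs g = cf y" by (rule coeffs_eq[OF ell2_cf g])
  have "norm (extension f q) \<le> norm (extension g q)"
    if f: "f \<in> H2" and m: "AE q in boundary_measure. norm (g q) = norm (f q)" and q: "q \<in> ball 0 1" for f q
  proof -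
    obtain x where x: "cf x = coeffs f" "has_boundary_value (qseries (cf x)) f" using coeffs_l2[OF f] .
    have N: "norm b = norm a" if ab: "fp a = p * fp y" "fp b = p * fp x" "finite_fps p" for a b p
    proof -
      obtain w where "fp w = p" using finite_fps_l2[OF ab(3)] by blast
      then show ?thesis using norm_left_mult_eq(1)[OF moduli_pi[OF g x(2) m], of a w b] ab by simp
    qed
    obtain Y p where Yp: "\<And>j. finite_fps (p j)" "\<And>j. fp (Y j) = p j * fp y" "Y \<longlonglongrightarrow> e0"
      using cyc unfolding left_cyclic_iff by blast
    have "\<forall>j. \<exists>b. fp b = p j * fp x" using finite_fps_mult_left[OF Yp(1)] by blast
    from choice[OF this] obtain X where X: "\<And>j. fp (X j) = p j * fp x" by blast
    have fd: "finite_fps (p i - p j)" for i j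
    proof -
      obtain M N where "\<forall>n\<ge>M. p i $ n = 0" "\<forall>n\<ge>N. p j $ n = 0" using Yp(1) unfolding finite_fps_def by metis
      then show ?thesis unfolding finite_fps_def by (intro exI[of _ "max M N"]) simp
    qed
    have "norm (X i - X j) = norm (Y i - Y j)" for i j
      by (rule N[OF _ _ fd[of i j]]) (simp_all add: fp_simps Yp X algebra_simps)
    then have "Cauchy X" using LIMSEQ_imp_Cauchy[OF Yp(3)] by (simp add: Cauchy_def dist_norm)
    \<comment> \<open>Since \<open>p j * y\<close> tends to 1, the limit \<open>u\<close> of
      \<open>p j * x\<close> plays the role of the quotient of \<open>x\<close> by \<open>y\<close>
      from the left.\<close>
    then obtain u where u: "X \<longlonglongrightarrow> u" using Cauchy_convergent convergent_def by blast
    have iso: "right_isometric (fp u)"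
    proof (rule right_isometric_from_poly)
      fix q a b assume q: "finite_fps q" "fp a = q" "fp b = q * fp u"
      from bounded_op_tendsto[OF bounded_op_finite_fps[OF q(1)] u] obtain B b' where
        B: "\<And>j. fp (B j) = q * fp (X j)" "fp b' = q * fp u" "B \<longlonglongrightarrow> b'" by blast
      from bounded_op_tendsto[OF bounded_op_finite_fps[OF q(1)] Yp(3)] obtain A a' where
        A: "\<And>j. fp (A j) = q * fp (Y j)" "fp a' = q * fp e0" "A \<longlonglongrightarrow> a'" by blast
      have "norm (B j) = norm (A j)" for j
        by (rule N[of _ "q * p j"]) (simp_all add: A B Yp X mult.assoc finite_fps_mult q)
      then have "norm b' = norm a'" using LIMSEQ_unique[OF tendsto_norm[OF A(3)]] tendsto_norm[OF B(3)] by simp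
      moreover have "b' = b" "a' = a" using A B q by (simp_all add: fp_e0 flip: fp_eq_iff)
      ultimately show "norm b = norm a" by simp
    qed
    obtain w where w: "fp w = fp y * fp u" using iso unfolding right_isometric_def by blast
    define G where "G N = Q.comb N (cf y) e0" for N
    have G: "fp (G N) = trunc N (cf y)" for N by (simp add: G_def fp_comb fp_e0)
    have Gl: "G \<longlonglongrightarrow> y" unfolding G_def by (rule comb_e0_tendsto)
    have "\<forall>N. \<exists>v. fp v = fp (G N) * fp u" using iso unfolding right_isometric_def by blast
    from choice[OF this] obtain W where W: "\<And>N. fp (W N) = fp (G N) * fp u" by blast
    have Wl: "W \<longlonglongrightarrow> w" by (rule right_isometric_tendsto[OF iso W Gl w])
    \<comment> \<open>For a truncation \<open>q\<close> of \<open>y\<close> the products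
      \<open>q * p j * y\<close> and \<open>q * p j * x\<close> tend to \<open>q\<close> and
      \<open>q * u\<close>. The isometry turns the distance from \<open>y\<close> to
      \<open>q\<close> into that from \<open>x\<close> to \<open>q * u\<close>; since
      \<open>q\<close> tends to \<open>y\<close>, this yields \<open>x = y * u\<close>.\<close>
    have "norm (x - W n) = norm (y - G n)" for n
    proof -
      let ?q = "trunc n (cf y)"
      from bounded_op_tendsto[OF bounded_op_finite_fps[OF finite_fps_trunc] u] obtain B b where
        B: "\<And>j. fp (B j) = ?q * fp (X j)" "fp b = ?q * fp u" "B \<longlonglongrightarrow> b" by blast
      from bounded_op_tendsto[OF bounded_op_finite_fps[OF finite_fps_trunc] Yp(3)] obtain A a where
        A: "\<And>j. fp (A j) = ?q * fp (Y j)" "fp a = ?q * fp e0" "A \<longlonglongrightarrow> a" by blast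
      have f1: "finite_fps (1 - ?q * p j)" for j
      proof -
        obtain K where "\<forall>n\<ge>K. (?q * p j) $ n = 0" using finite_fps_mult[OF finite_fps_trunc Yp(1)] unfolding finite_fps_def by blast
        then show ?thesis unfolding finite_fps_def by (intro exI[of _ "Suc K"]) simp
      qed
      have "norm (x - B j) = norm (y - A j)" for j
        by (rule N[OF _ _ f1[of j]]) (simp_all add: fp_simps A B Yp X algebra_simps)
      moreover have "(\<lambda>j. norm (x - B j)) \<longlonglongrightarrow> norm (x - b)" "(\<lambda>j. norm (y - A j)) \<longlonglongrightarrow> norm (y - a)"
        by (intro tendsto_intros A B)+
      ultimately have "norm (x - b) = norm (y - a)" using LIMSEQ_unique by fastforce
      moreover have "b = W n" "a = G n" using A B W G by (simp_all add: fp_e0 flip: fp_eq_iff)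
      ultimately show ?thesis by simp
    qed
    moreover have "(\<lambda>n. norm (x - W n)) \<longlonglongrightarrow> norm (x - w)" "(\<lambda>n. norm (y - G n)) \<longlonglongrightarrow> norm (y - y)"
      by (intro tendsto_intros Wl Gl)+
    ultimately have "norm (x - w) = norm (y - y)" using LIMSEQ_unique by fastforce
    then have "fp x = fp y * fp u" using w by simp
    from norm_qseries_mult_le[OF this iso] q show ?thesis
      unfolding extension_def cg x(1)[symmetric] by simp
  qed
  moreover have "g \<in> H2" unfolding H2_def using g by (auto intro!: exI[of _ "cf y"])
  ultimately show ?thesis unfolding outer_function_def by blast
qed

text \<open>Multiplying the approximating polynomials by \<open>inverse c\<close> on the left
  conjugates the approximants by \<open>c\<close>, and conjugation fixes the limit 1.\<close>

lemma left_cyclic_const: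
  assumes "left_cyclic h" "c \<noteq> 0" "fp y = fp h * fps_const c"
  shows "left_cyclic y"
proof -
  obtain Y p where Yp: "\<And>j. finite_fps (p j)" "\<And>j. fp (Y j) = p j * fp h" "Y \<longlonglongrightarrow> e0"
    using \<open>left_cyclic h\<close> unfolding left_cyclic_iff by blast
  from bounded_op_tendsto[OF bounded_op_comp[OF bounded_op_const_left[of "inverse c"] bounded_op_const_right[of c]] Yp(3)]
  obtain Z z where Z: "\<And>j. fp (Z j) = fps_const (inverse c) * (fp (Y j) * fps_const c)"
    "fp z = fps_const (inverse c) * (fp e0 * fps_const c)" "Z \<longlonglongrightarrow> z" by blast
  have "fp z = fp e0" using Z(2) \<open>c \<noteq> 0\<close> by (simp add: fp_e0)
  then have z: "z = e0" by (simp only: fp_eq_iff)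
  have "finite_fps (fps_const (inverse c) * p j)" for j
    by (intro finite_fps_mult Yp) (auto simp: finite_fps_def intro!: exI[of _ 1])
  moreover have "fp (Z j) = (fps_const (inverse c) * p j) * fp y" for j
    by (simp only: Z(1) Yp(2) assms(3) mult.assoc)
  ultimately show ?thesis unfolding left_cyclic_iff using Z(3) z
    by (intro exI[of _ Z] exI[of _ "\<lambda>j. fps_const (inverse c) * p j"]) simp
qed

text \<open>A vanishing constant term is inherited by all left multiples and by their limits, which
  excludes 1.\<close>

lemma left_cyclic_nonzero: "left_cyclic h \<Longrightarrow> cf h 0 \<noteq> 0"
proof
  assume "left_cyclic h" and h: "cf h 0 = 0"
  then obtain Y p where Yp: "\<And>j. fp (Y j) = p j * fp h" "Y \<longlonglongrightarrow> e0" unfolding left_cyclic_iff by blast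
  have "cf (Y j) 0 = 0" for j using arg_cong[OF Yp(1)[of j], of "\<lambda>f. f $ 0"] h by simp
  then have "cf e0 0 = 0" using tendsto_cf[OF Yp(2), of 0] LIMSEQ_unique[OF tendsto_const] by fastforce
  then show False by (simp add: cf_e0)
qed

text \<open>The factorization into a left cyclic series and an inner right factor is always
  available; right cyclicity reduces the inner factor to a constant.\<close>

lemma right_cyclic_imp_left_cyclic:
  assumes "right_cyclic g"
  shows "left_cyclic g"
proof -
  have "g \<noteq> 0"
    using left_cyclic_nonzero[OF assms[unfolded right_cyclic_def]] by (auto simp: cf_l2_cnj cf_simps qcnj_simps)
  from left_beurling[OF this] obtain h u where u: "fp g = fp h * fp u" "right_isometric (fp u)" "left_cyclic h" by blast
  have "left_isometric (fp u)" using u(2) by (simp add: right_isometric_iff_left_isometric)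
  from inner_right_factor_constant[OF u(1,2) this u(3) assms] obtain c where c: "norm c = 1" "fp u = fps_const c" by blast
  then have "c \<noteq> 0" by auto
  then show ?thesis using left_cyclic_const[OF u(3)] u(1) c(2) by simp
qed

lemma left_cyclic_iff_right_cyclic: "left_cyclic g \<longleftrightarrow> right_cyclic g"
  using right_cyclic_imp_left_cyclic[of g] right_cyclic_imp_left_cyclic[of "l2_cnj g"] by (auto simp: right_cyclic_def l2_cnj_simps)

lemma outer_left_cyclic:
  assumes out: "outer_function g" and g: "coeffs g = cf y" "has_boundary_value (qseries (cf y)) g" and "y \<noteq> 0"
  shows "left_cyclic y"
proof -
  obtain h u where u: "fp y = fp h * fp u" "right_isometric (fp u)" "left_cyclic h" using left_beurling[OF \<open>y \<noteq> 0\<close>] by blast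
  define H where "H = boundary_value (qseries (cf h))"
  have H: "H \<in> H2" "has_boundary_value (qseries (cf h)) H" "coeffs H = cf h"
    unfolding H_def by (auto intro: boundary_value_H2 has_boundary_value_qseries simp: coeffs_cf)
  have "AE q in boundary_measure. norm (g q) = norm (H q)"
    by (rule norm_boundary_eqI[OF g(2) H(2) unimodular_mult[OF right_isometric_unimodular[OF u(2)] u(1)]])
  then have "norm (extension H 0) \<le> norm (extension g 0)"
    using out H(1) unfolding outer_function_def by simp
  moreover have "qseries a 0 = a 0" for a
  proof -
    have "(\<Sum>n. 0 ^ n * a n) = (\<Sum>n\<in>{0}. 0 ^ n * a n)" by (rule suminf_finite) auto
    then show ?thesis by (simp add: qseries_def)
  qed
  ultimately have "norm (cf h 0) \<le> norm (cf y 0)" by (simp add: extension_def g H)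
  also have "cf y 0 = cf h 0 * cf u 0" using arg_cong[OF u(1), of "\<lambda>f. f $ 0"] by simp
  finally have "norm (cf h 0) * 1 \<le> norm (cf h 0) * norm (cf u 0)" by (simp add: norm_mult)
  moreover have "0 < norm (cf h 0)" using left_cyclic_nonzero[OF u(3)] by simp
  ultimately have "1 \<le> norm (cf u 0)" by (simp only: mult_le_cancel_left_pos)
  moreover have "norm u = 1" using right_isometric_l2[OF u(2)] fp_eq_iff by auto
  ultimately have "fp u = fps_const (cf u 0)" "norm (cf u 0) = 1" using norm_one_constant by blast+
  then have "fp y = fp h * fps_const (cf u 0)" "cf u 0 \<noteq> 0" using u(1) by auto
  then show ?thesis using left_cyclic_const[OF u(3)] by blast
qed

lemma left_isometric_norm: "left_isometric u \<Longrightarrow> fp y = u * fp x \<Longrightarrow> norm y = norm x"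
  unfolding left_isometric_def using fp_eq_iff by metis

text \<open>Right cyclicity of \<open>y\<close> makes \<open>k\<close> a limit of
  \<open>k * y * p = l * z * p\<close>, and the left multiples by \<open>l\<close> form a closed
  set.\<close>

lemma inner_factor_divides:
  assumes L: "left_isometric (fp k)" "left_isometric (fp l)" and eq: "fp k * fp y = fp l * fp z" and cyc: "right_cyclic y"
  shows "\<exists>m. fp k = fp l * fp m \<and> norm m = 1"
proof -
  obtain Y p where Yp: "\<And>j. finite_fps (p j)" "\<And>j. fp (Y j) = fp y * p j" "Y \<longlonglongrightarrow> e0"
    using cyc unfolding right_cyclic_iff by blast
  have "\<forall>j. \<exists>a. fp a = fp k * fp (Y j)" using L(1) unfolding left_isometric_def by blast
  from choice[OF this] obtain K where K: "\<And>j. fp (K j) = fp k * fp (Y j)" by blast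
  have Kl: "K \<longlonglongrightarrow> k" by (rule left_isometric_tendsto[OF L(1) K Yp(3)]) (simp add: fp_e0)
  have "\<forall>j. \<exists>a. fp a = fp z * p j" using finite_fps_mult_right[OF Yp(1)] by blast
  from choice[OF this] obtain V where V: "\<And>j. fp (V j) = fp z * p j" by blast
  have "fp (K j) = fp l * fp (V j)" for j
    by (simp only: K Yp(2) V mult.assoc[symmetric] eq)
  from left_isometric_closed[OF L(2) this Kl] obtain m where m: "fp k = fp l * fp m" by blast
  have "norm k = 1" using left_isometric_norm[OF L(1), of k e0] by (simp add: fp_e0 norm_e0)
  then have "norm m = 1" using left_isometric_norm[OF L(2) m] by simp
  then show ?thesis using m by blast
qed

lemma existence:
  assumes x: "has_boundary_value (qseries (cf x)) f" and "x \<noteq> 0"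
  shows "\<exists>\<phi> g. inner_function \<phi> \<and> g \<in> H2 \<and> outer_function g \<and> f \<doteq> \<phi> \<star> g"
proof -
  \<comment> \<open>Factoring the conjugated series puts the inner factor on the right; conjugating
    back puts it on the left.\<close>
  have "l2_cnj x \<noteq> 0" using \<open>x \<noteq> 0\<close> l2_cnj_simps(2)[of x] by (metis norm_eq_zero)
  from left_beurling[OF this] obtain h u where u: "fp (l2_cnj x) = fp h * fp u" "right_isometric (fp u)" "left_cyclic h" by blast
  define k y where "k = l2_cnj u" and "y = l2_cnj h"
  have xky: "fp x = fp k * fp y"
    using arg_cong[OF u(1), of fps_cnj] by (simp add: k_def y_def fp_l2_cnj fps_cnj_simps)
  have k: "right_isometric (fp k)" using u(2) by (simp add: right_isometric_iff_left_isometric left_isometric_iff k_def fp_l2_cnj fps_cnj_simps)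
  have "right_cyclic y" using u(3) by (simp add: right_cyclic_def y_def l2_cnj_simps)
  then have y: "left_cyclic y" by (rule right_cyclic_imp_left_cyclic)
  define \<phi> g where "\<phi> = boundary_value (qseries (cf k))" and "g = boundary_value (qseries (cf y))"
  have "inner_function \<phi>" unfolding \<phi>_def by (rule inner_boundary_value[OF k])
  moreover have "g \<in> H2" unfolding g_def by (intro boundary_value_H2) simp
  moreover have "outer_function g"
    unfolding g_def by (rule left_cyclic_outer[OF has_boundary_value_qseries y]) simp
  moreover have "\<phi> \<star> g = boundary_value (qseries (cf x))"
    by (rule star_prod_eq[OF _ _ xky]) (simp_all add: \<phi>_def g_def coeffs_cf)
  then have "f \<doteq> \<phi> \<star> g" using has_boundary_value_eq[OF x] by simp
  ultimately show ?thesis by blast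
qed

text \<open>The isometric factor guarantees that the product is square summable, so its boundary
  values determine its coefficients.\<close>

lemma star_coeffs:
  assumes x: "has_boundary_value (qseries (cf x)) f" and "f \<doteq> \<phi> \<star> g"
    and "coeffs \<phi> = cf k" "coeffs g = cf y" "left_isometric (fp k)"
  shows "fp x = fp k * fp y"
proof -
  obtain z where z: "fp z = fp k * fp y" using assms(5) unfolding left_isometric_def by blast
  have s: "\<phi> \<star> g = boundary_value (qseries (cf z))" by (rule star_prod_eq[OF assms(3,4) z])
  have "cf x = cf z"
    by (rule boundary_value_unique[OF ell2_cf x ell2_cf has_boundary_value_qseries assms(2)[unfolded s]]) simp
  then have "x = z" by (simp add: cf_inject)
  then show ?thesis using z by simp
qed

lemma uniqueness:
  assumes x: "has_boundary_value (qseries (cf x)) f" "x \<noteq> 0"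
    and inn: "inner_function \<phi>" "inner_function \<phi>\<^sub>1" and out: "outer_function g" "outer_function g\<^sub>1"
    and eq: "f \<doteq> \<phi> \<star> g" "f \<doteq> \<phi>\<^sub>1 \<star> g\<^sub>1"
  shows "\<exists>c. norm c = 1 \<and> \<phi>\<^sub>1 \<doteq> \<phi> \<star> (\<lambda>_. c) \<and> g\<^sub>1 \<doteq> (\<lambda>_. qcnj c) \<star> g"
proof -
  obtain k where k: "coeffs \<phi> = cf k" "has_boundary_value (qseries (cf k)) \<phi>" "right_isometric (fp k)" "left_isometric (fp k)"
    using innerE[OF inn(1)] .
  obtain k1 where k1: "coeffs \<phi>\<^sub>1 = cf k1" "has_boundary_value (qseries (cf k1)) \<phi>\<^sub>1" "right_isometric (fp k1)" "left_isometric (fp k1)"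
    using innerE[OF inn(2)] .
  have "g \<in> H2" "g\<^sub>1 \<in> H2" using out unfolding outer_function_def by blast+
  then obtain y y1 where y: "cf y = coeffs g" "has_boundary_value (qseries (cf y)) g"
    and y1: "cf y1 = coeffs g\<^sub>1" "has_boundary_value (qseries (cf y1)) g\<^sub>1" using coeffs_l2 by metis
  have xy: "fp x = fp k * fp y" by (rule star_coeffs[OF x(1) eq(1) k(1) y(1)[symmetric] k(4)])
  have xy1: "fp x = fp k1 * fp y1" by (rule star_coeffs[OF x(1) eq(2) k1(1) y1(1)[symmetric] k1(4)])
  have fx: "fp x \<noteq> 0" using x(2) fp_eq_iff[of x 0] by (simp add: fp_simps)
  then have "y \<noteq> 0" "y1 \<noteq> 0" using xy xy1 by (auto simp: fp_simps)
  then have "left_cyclic y" "left_cyclic y1"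
    using outer_left_cyclic[OF out(1) y(1)[symmetric] y(2)] outer_left_cyclic[OF out(2) y1(1)[symmetric] y1(2)] by blast+
  then have ry: "right_cyclic y" "right_cyclic y1" by (simp_all add: left_cyclic_iff_right_cyclic)
  have kk: "fp k * fp y = fp k1 * fp y1" using xy xy1 by simp
  obtain m where m: "fp k = fp k1 * fp m" "norm m = 1" using inner_factor_divides[OF k(4) k1(4) kk ry(1)] by blast
  obtain m1 where m1: "fp k1 = fp k * fp m1" "norm m1 = 1"
    using inner_factor_divides[OF k1(4) k(4) kk[symmetric] ry(2)] by blast
  have k0: "fp k \<noteq> 0" using fx xy by auto
  \<comment> \<open>The inner factors divide each other. Cancelling \<open>k\<close>, the quotients
    are mutually inverse series of norm 1, so the constant terms multiply to 1 although neither
    exceeds 1 in modulus; this makes \<open>m1\<close> constant.\<close>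
  have "fp k * (fp m1 * fp m) = fp k * 1" using m(1) m1(1) by (simp add: mult.assoc[symmetric])
  then have mm: "fp m1 * fp m = 1" using k0 by (simp only: mult_cancel_left) simp
  have "cf m1 0 * cf m 0 = 1" using arg_cong[OF mm, of "\<lambda>f. f $ 0"] by simp
  then have "1 = norm (cf m1 0) * norm (cf m 0)" by (metis norm_mult norm_one)
  also have "\<dots> \<le> norm (cf m1 0) * 1" using norm_cf_le[of m 0] m(2) by (intro mult_left_mono) auto
  finally have "1 \<le> norm (cf m1 0)" by simp
  from norm_one_constant[OF m1(2) this] obtain c where c: "fp m1 = fps_const c" "norm c = 1" by blast
  have cc: "qcnj c * c = 1" using c(2) by (simp add: qcnj_mult_self)
  have k1c: "fp k1 = fp k * fp (l2_smult c e0)" using m1(1) c(1) by (simp add: fp_l2_smult fp_e0)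
  have "fp k * fp y = fp k * (fps_const c * fp y1)" using kk m1(1) c(1) by (simp add: mult.assoc)
  then have yc: "fp y = fps_const c * fp y1" using k0 by (simp only: mult_cancel_left) simp
  have "fp y1 = fps_const (qcnj c * c) * fp y1" by (simp add: cc)
  also have "\<dots> = fp (l2_smult (qcnj c) e0) * fp y" by (simp add: fp_l2_smult fp_e0 yc mult.assoc[symmetric])
  finally have y1c: "fp y1 = fp (l2_smult (qcnj c) e0) * fp y" .
  have "\<phi> \<star> (\<lambda>_. c) = boundary_value (qseries (cf k1))"
    by (rule star_prod_eq[OF k(1) coeffs_const k1c])
  then have "\<phi>\<^sub>1 \<doteq> \<phi> \<star> (\<lambda>_. c)" using has_boundary_value_eq[OF k1(2)] by simp
  moreover have "(\<lambda>_. qcnj c) \<star> g = boundary_value (qseries (cf y1))"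
    by (rule star_prod_eq[OF coeffs_const y(1)[symmetric] y1c])
  then have "g\<^sub>1 \<doteq> (\<lambda>_. qcnj c) \<star> g" using has_boundary_value_eq[OF y1(2)] by simp
  ultimately show ?thesis using c(2) by blast
qed

theorem theorem1p5:
  fixes f :: "quat \<Rightarrow> quat"
  assumes "f \<in> H2" and "\<not> (f \<doteq> (\<lambda>_. 0))"
  shows "(\<exists>\<phi> g. inner_function \<phi> \<and> g \<in> H2 \<and> outer_function g \<and> f \<doteq> \<phi> \<star> g) \<and>
    (\<forall>\<phi> g \<phi>\<^sub>1 g\<^sub>1.
       inner_function \<phi> \<and> inner_function \<phi>\<^sub>1 \<and> outer_function g \<and> outer_function g\<^sub>1 \<and>
       f \<doteq> \<phi> \<star> g \<and> f \<doteq> \<phi>\<^sub>1 \<star> g\<^sub>1 \<longrightarrow>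
       (\<exists>c. norm c = 1 \<and> \<phi>\<^sub>1 \<doteq> \<phi> \<star> (\<lambda>_. c) \<and> g\<^sub>1 \<doteq> (\<lambda>_. qcnj c) \<star> g))"
proof -
  obtain x where x: "cf x = coeffs f" "has_boundary_value (qseries (cf x)) f" using coeffs_l2[OF assms(1)] .
  have "x \<noteq> 0"
  proof
    assume "x = 0"
    then have "qseries (cf x) = (\<lambda>_. 0)" by (simp add: qseries_def fun_eq_iff cf_simps)
    then have "boundary_value (qseries (cf x)) = (\<lambda>_. 0)"
      unfolding boundary_value_def by (auto intro!: tendsto_Lim)
    then show False using has_boundary_value_eq[OF x(2)] assms(2) by simp
  qed
  show ?thesis
  proof (intro conjI allI impI)
    show "\<exists>\<phi> g. inner_function \<phi> \<and> g \<in> H2 \<and> outer_function g \<and> f \<doteq> \<phi> \<star> g"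
      by (rule existence[OF x(2) \<open>x \<noteq> 0\<close>])
  next
    fix \<phi> g \<phi>\<^sub>1 g\<^sub>1
    assume "inner_function \<phi> \<and> inner_function \<phi>\<^sub>1 \<and> outer_function g \<and> outer_function g\<^sub>1 \<and>
       f \<doteq> \<phi> \<star> g \<and> f \<doteq> \<phi>\<^sub>1 \<star> g\<^sub>1"
    then show "\<exists>c. norm c = 1 \<and> \<phi>\<^sub>1 \<doteq> \<phi> \<star> (\<lambda>_. c) \<and> g\<^sub>1 \<doteq> (\<lambda>_. qcnj c) \<star> g"
      by (intro uniqueness[OF x(2) \<open>x \<noteq> 0\<close>]) auto
  qed
qed

end
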